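(* Let $N\geqslant 4$ be an integer, let $\mathcal{C}$ be a category of noncrossing (two-coloured) partitions and let $\mathbb{G}$ be the associated easy quantum group, with fundamental representation $u$. Then, for any word $w$ in $\{1,-1\}$, $$u^{\otimes w}=\bigoplus_{p\in\mathrm{Proj}_{\mathcal{C}}(w)}u_{p}.$$
   Context: **Partitions.** A (two-coloured) partition in $P^{\circ,\bullet}(k,l)$, $k,l\geqslant 0$, is a set partition of $k$ upper points and $l$ lower points (each row ordered from left to right) together with a colour, white ($\circ$) or black ($\bullet$), for each point. It is noncrossing if its blocks can be drawn by strings between the two rows without crossings. $\beta(p)$ is the number of blocks of $p$ that do not contain both upper and lower points. Operations: $p\otimes q$ is horizontal concatenation; for $p\in P^{\circ,\bullet}(k,l)$, $q\in P^{\circ,\bullet}(l,m)$ with the lower colouring of $p$ equal to the upper colouring of $q$, $qp\in P^{\circ,\bullet}(k,m)$ is vertical concatenation ($p$ on top of $q$, middle points and closed loops being removed); $p^{*}$ is the reflection in the horizontal axis (colours unchanged); a rotation moves the leftmost (resp. rightmost) point of one row to the left (resp. right) end of the other row, keeping its connections and inverting its colour. A category of partitions $\mathcal{C}$ is a set of coloured partitions stable under all these operations and containing the white identity (one upper and one lower point, both white, connected). It is a category of noncrossing partitions if all its elements are noncrossing. $p\in P^{\circ,\bullet}(k,k)$ is projective if $pp=p=p^{*}$. For projective $p,q\in\mathcal{C}$, $q\prec p$ means $pq=qp=q$ and $q\neq p$. Words $w$ in $\{1,-1\}$ are identified with colourings via $\circ\mapsto 1$, $\bullet\mapsto -1$;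 $\mathrm{Proj}_{\mathcal{C}}(w)$ is the set of projective partitions in $\mathcal{C}$ with upper (hence lower) colouring $w$. **Easy quantum group.** For $p\in P^{\circ,\bullet}(k,l)$ let $\mathring{T}_p:(\mathbb{C}^N)^{\otimes k}\to(\mathbb{C}^N)^{\otimes l}$, $\mathring{T}_p(e_{i_1}\otimes\dots\otimes e_{i_k})=\sum_{j_1,\dots,j_l=1}^N\delta_p(i,j)\,e_{j_1}\otimes\dots\otimes e_{j_l}$, with $\delta_p(i,j)=1$ if all points in a common block of $p$ carry equal indices and $0$ otherwise, and $T_p=N^{-\beta(p)/2}\mathring{T}_p$ (a projection if $p$ is projective). For a word $w=w_1\dots w_k$, $u^{\otimes w}=u^{w_1}\otimes\dots\otimes u^{w_k}$ with $u^{1}=u$, $u^{-1}=\overline{u}$, acting on $(\mathbb{C}^N)^{\otimes k}$. The easy quantum group associated to $\mathcal{C}$ and $N$ is the compact quantum group $\mathbb{G}$ with fundamental representation $u$ on $\mathbb{C}^N$, given by Woronowicz's Tannaka–Krein duality, such that $\mathrm{Hom}(u^{\otimes w},u^{\otimes w'})$ is the linear span of the $T_p$ for $p\in\mathcal{C}$ with upper colouring $w$ and lower colouring $w'$. For $p\in\mathrm{Proj}_{\mathcal{C}}(w)$ put $P_p=T_p-\bigvee_{q\prec p}T_q$ (with $q\in\mathrm{Proj}_{\mathcal{C}}(w)$, $\bigvee$ the supremum of projections) and $u_p=(\mathrm{id}\otimes P_p)(u^{\otimes w})$, the subrepresentation of $u^{\otimes w}$ on the range of $P_p$. The equality in the claim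 means that $u^{\otimes w}$ is the sum of the subrepresentations $u_p$ and that this sum is direct (not necessarily orthogonal), so that $u^{\otimes w}$ is equivalent to the direct sum of the $u_p$. *)

theory Defs
  imports
    "HOL-Analysis.Analysis"
    "HOL-Library.Disjoint_Sets"
    "HOL-Library.FuncSet"
    "HOL-Library.Function_Algebras"
begin

section \<open>Two-coloured partitions\<close>

text \<open>
  \<open>White\<close> is the colour written as a circle and identified with the letter 1, \<open>Black\<close> is the
  bullet and identified with -1, so a word in 1 and -1 is a colour list.
\<close>

datatype colour = White | Black

fun inv_col :: "colour \<Rightarrow> colour" where
  "inv_col White = Black"
| "inv_col Black = White"

text \<open>
  \<open>Inl i\<close> is the \<open>i\<close>-th upper point and \<open>Inr j\<close> the \<open>j\<close>-th lower point, both counted from the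
  left and starting with 0.
\<close>

type_synonym point = "nat + nat"

datatype partition = Part (up: "colour list") (low: "colour list") (blocks: "point set set")

definition points :: "nat \<Rightarrow> nat \<Rightarrow> point set" where
  "points k l = Inl ` {..<k} \<union> Inr ` {..<l}"

definition all_partitions :: "partition set" where
  "all_partitions = {p. partition_on (points (length (up p)) (length (low p))) (blocks p)}"

text \<open>
  The position of a point when one walks around the boundary of the strip between the two rows:
  the upper row from left to right, then the lower row from right to left. Noncrossing strings
  exist iff no two distinct blocks interlace for this order.
\<close>

definition boundary_pos :: "partition \<Rightarrow> point \<Rightarrow> nat" where
  "boundary_pos p x =
     (case x of Inl i \<Rightarrow> i | Inr j \<Rightarrow> length (up p) + (length (low p) - 1 - j))"

definition noncrossing :: "partition \<Rightarrow> bool" where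
  "noncrossing p \<longleftrightarrow>
     \<not> (\<exists>B\<in>blocks p. \<exists>B'\<in>blocks p. B \<noteq> B' \<and>
          (\<exists>a\<in>B. \<exists>b\<in>B'. \<exists>c\<in>B. \<exists>d\<in>B'.
             boundary_pos p a < boundary_pos p b \<and> boundary_pos p b < boundary_pos p c \<and>
             boundary_pos p c < boundary_pos p d))"

definition non_through :: "partition \<Rightarrow> nat" (\<open>\<beta>\<close>) where
  "\<beta> p = card {B \<in> blocks p. \<not> ((\<exists>i. Inl i \<in> B) \<and> (\<exists>j. Inr j \<in> B))}"

definition relabel :: "(point \<Rightarrow> point) \<Rightarrow> point set set \<Rightarrow> point set set" where
  "relabel f \<B> = (\<lambda>B. f ` B) ` \<B>"

definition white_identity :: partition where
  "white_identity = Part [White] [White] {{Inl 0, Inr 0}}"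

definition hconcat :: "partition \<Rightarrow> partition \<Rightarrow> partition" where
  "hconcat p q = Part (up p @ up q) (low p @ low q)
     (blocks p \<union>
      relabel (map_sum (\<lambda>i. i + length (up p)) (\<lambda>j. j + length (low p))) (blocks q))"

definition reflect :: "partition \<Rightarrow> partition" where
  "reflect p = Part (low p) (up p) (relabel (case_sum Inr Inl) (blocks p))"

text \<open>
  Vertical concatenation \<open>qp\<close> (\<open>p\<close> on top, meaningful for \<open>low p = up q\<close>): the lower points of
  \<open>p\<close> are glued to the upper points of \<open>q\<close>, and two outer points of the result are connected iff
  they are joined by a chain of connections in \<open>p\<close> and \<open>q\<close>. Components consisting of middle
  points only do not meet the outer points and hence disappear.
\<close>

datatype glued = Top nat | Mid nat | Bot nat

definition glue_links :: "partition \<Rightarrow> partition \<Rightarrow> (glued \<times> glued) set" where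
  "glue_links q p =
     {(case_sum Top Mid x, case_sum Top Mid y) | x y B. B \<in> blocks p \<and> x \<in> B \<and> y \<in> B} \<union>
     {(case_sum Mid Bot x, case_sum Mid Bot y) | x y B. B \<in> blocks q \<and> x \<in> B \<and> y \<in> B}"

definition vconcat :: "partition \<Rightarrow> partition \<Rightarrow> partition" where
  "vconcat q p = Part (up p) (low q)
     (points (length (up p)) (length (low q)) //
       {(x, y). x \<in> points (length (up p)) (length (low q)) \<and>
                y \<in> points (length (up p)) (length (low q)) \<and>
                (case_sum Top Bot x, case_sum Top Bot y) \<in> (glue_links q p)\<^sup>*})"

definition rotate_left_down :: "partition \<Rightarrow> partition" where
  "rotate_left_down p = Part (tl (up p)) (inv_col (hd (up p)) # low p)
     (relabel (\<lambda>x. case x of Inl i \<Rightarrow> (if i = 0 then Inr 0 else Inl (i - 1)) | Inr j \<Rightarrow> Inr (Suc j))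
       (blocks p))"

definition rotate_right_down :: "partition \<Rightarrow> partition" where
  "rotate_right_down p = Part (butlast (up p)) (low p @ [inv_col (last (up p))])
     (relabel (\<lambda>x. if x = Inl (length (up p) - 1) then Inr (length (low p)) else x) (blocks p))"

definition rotate_left_up :: "partition \<Rightarrow> partition" where
  "rotate_left_up p = reflect (rotate_left_down (reflect p))"

definition rotate_right_up :: "partition \<Rightarrow> partition" where
  "rotate_right_up p = reflect (rotate_right_down (reflect p))"

definition category_of_partitions :: "partition set \<Rightarrow> bool" where
  "category_of_partitions \<C> \<longleftrightarrow>
     \<C> \<subseteq> all_partitions \<and>
     white_identity \<in> \<C> \<and>
     (\<forall>p\<in>\<C>. \<forall>q\<in>\<C>. hconcat p q \<in> \<C>) \<and>
     (\<forall>p\<in>\<C>. \<forall>q\<in>\<C>. low p = up q \<longrightarrow> vconcat q p \<in> \<C>) \<and>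
     (\<forall>p\<in>\<C>. reflect p \<in> \<C>) \<and>
     (\<forall>p\<in>\<C>. up p \<noteq> [] \<longrightarrow> rotate_left_down p \<in> \<C> \<and> rotate_right_down p \<in> \<C>) \<and>
     (\<forall>p\<in>\<C>. low p \<noteq> [] \<longrightarrow> rotate_left_up p \<in> \<C> \<and> rotate_right_up p \<in> \<C>)"

definition category_of_noncrossing_partitions :: "partition set \<Rightarrow> bool" where
  "category_of_noncrossing_partitions \<C> \<longleftrightarrow>
     category_of_partitions \<C> \<and> (\<forall>p\<in>\<C>. noncrossing p)"

definition projective :: "partition \<Rightarrow> bool" where
  "projective p \<longleftrightarrow>
     p \<in> all_partitions \<and> low p = up p \<and> vconcat p p = p \<and> reflect p = p"

definition Proj :: "partition set \<Rightarrow> colour list \<Rightarrow> partition set" where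
  "Proj \<C> w = {p \<in> \<C>. projective p \<and> up p = w}"

definition dominated :: "partition \<Rightarrow> partition \<Rightarrow> bool" (infix \<open>\<prec>\<close> 50) where
  "q \<prec> p \<longleftrightarrow> vconcat p q = q \<and> vconcat q p = q \<and> q \<noteq> p"


section \<open>Tensor powers of the standard Hilbert space\<close>

text \<open>
  Basis vectors of the \<open>k\<close>-th tensor power of the space of \<open>N\<close>-tuples are indexed by multi-indices.
  Vectors are complex functions of a multi-index and linear maps are matrices (row first) indexed
  by multi-indices; all of them vanish outside the relevant index sets, so that equality of
  functions is equality of vectors and of linear maps.
\<close>

type_synonym index = "nat list"
type_synonym tvec = "index \<Rightarrow> complex"
type_synonym tmat = "index \<Rightarrow> index \<Rightarrow> complex"

definition idx :: "nat \<Rightarrow> nat \<Rightarrow> index set" where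
  "idx N k = {i. length i = k \<and> set i \<subseteq> {..<N}}"

definition tensor_space :: "nat \<Rightarrow> nat \<Rightarrow> tvec set" where
  "tensor_space N k = {\<xi>. \<forall>i. i \<notin> idx N k \<longrightarrow> \<xi> i = 0}"

definition tensor_maps :: "nat \<Rightarrow> nat \<Rightarrow> nat \<Rightarrow> tmat set" where
  "tensor_maps N k l = {M. \<forall>j i. \<not> (j \<in> idx N l \<and> i \<in> idx N k) \<longrightarrow> M j i = 0}"

definition tvec_scale :: "complex \<Rightarrow> tvec \<Rightarrow> tvec" where
  "tvec_scale c \<xi> = (\<lambda>i. c * \<xi> i)"

definition tmat_scale :: "complex \<Rightarrow> tmat \<Rightarrow> tmat" where
  "tmat_scale c M = (\<lambda>j i. c * M j i)"

global_interpretation tvec: vector_space tvec_scale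
  by unfold_locales (simp_all add: tvec_scale_def plus_fun_def ring_distribs mult.assoc)

global_interpretation tmat: vector_space tmat_scale
  by unfold_locales (simp_all add: tmat_scale_def plus_fun_def ring_distribs mult.assoc)

definition mat_apply :: "nat \<Rightarrow> nat \<Rightarrow> tmat \<Rightarrow> tvec \<Rightarrow> tvec" where
  "mat_apply N k M \<xi> = (\<lambda>j. \<Sum>i\<in>idx N k. M j i * \<xi> i)"

definition mat_comp :: "nat \<Rightarrow> nat \<Rightarrow> tmat \<Rightarrow> tmat \<Rightarrow> tmat" where
  "mat_comp N k A B = (\<lambda>j i. \<Sum>m\<in>idx N k. A j m * B m i)"

definition mat_adj :: "tmat \<Rightarrow> tmat" where
  "mat_adj A = (\<lambda>j i. cnj (A i j))"

definition mat_range :: "nat \<Rightarrow> nat \<Rightarrow> tmat \<Rightarrow> tvec set" where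
  "mat_range N k M = mat_apply N k M ` tensor_space N k"

definition is_projection :: "nat \<Rightarrow> nat \<Rightarrow> tmat \<Rightarrow> bool" where
  "is_projection N k P \<longleftrightarrow>
     P \<in> tensor_maps N k k \<and> mat_comp N k P P = P \<and> mat_adj P = P"

definition proj_le :: "nat \<Rightarrow> nat \<Rightarrow> tmat \<Rightarrow> tmat \<Rightarrow> bool" where
  "proj_le N k P Q \<longleftrightarrow> mat_comp N k Q P = P"

definition proj_sup :: "nat \<Rightarrow> nat \<Rightarrow> tmat set \<Rightarrow> tmat" where
  "proj_sup N k S =
     (THE Q. is_projection N k Q \<and> (\<forall>P\<in>S. proj_le N k P Q) \<and>
             (\<forall>Q'. is_projection N k Q' \<and> (\<forall>P\<in>S. proj_le N k P Q') \<longrightarrow> proj_le N k Q Q'))"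


section \<open>The linear maps associated to partitions\<close>

definition compatible :: "partition \<Rightarrow> index \<Rightarrow> index \<Rightarrow> bool" where
  "compatible p i j \<longleftrightarrow>
     (\<forall>B\<in>blocks p. \<forall>x\<in>B. \<forall>y\<in>B. case_sum (nth i) (nth j) x = case_sum (nth i) (nth j) y)"

definition T_unnormalised :: "nat \<Rightarrow> partition \<Rightarrow> tmat" where
  "T_unnormalised N p = (\<lambda>j i.
     if i \<in> idx N (length (up p)) \<and> j \<in> idx N (length (low p)) \<and> compatible p i j then 1 else 0)"

definition T_map :: "nat \<Rightarrow> partition \<Rightarrow> tmat" where
  "T_map N p = (\<lambda>j i. of_real (real N powr (- real (\<beta> p) / 2)) * T_unnormalised N p j i)"

definition P_map :: "nat \<Rightarrow> partition set \<Rightarrow> partition \<Rightarrow> tmat" where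
  "P_map N \<C> p = T_map N p - proj_sup N (length (up p)) {T_map N q | q. q \<in> Proj \<C> (up p) \<and> q \<prec> p}"


section \<open>Unital C*-algebras and their minimal tensor product\<close>

class cstar_algebra = real_normed_algebra_1 + banach +
  fixes scaleC :: "complex \<Rightarrow> 'a \<Rightarrow> 'a"  (infixr \<open>*\<^sub>C\<close> 75)
    and star :: "'a \<Rightarrow> 'a"
  assumes scaleC_of_real: "complex_of_real r *\<^sub>C x = r *\<^sub>R x"
    and scaleC_add_right: "c *\<^sub>C (x + y) = c *\<^sub>C x + c *\<^sub>C y"
    and scaleC_add_left: "(c + d) *\<^sub>C x = c *\<^sub>C x + d *\<^sub>C x"
    and scaleC_scaleC: "c *\<^sub>C d *\<^sub>C x = (c * d) *\<^sub>C x"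
    and mult_scaleC_left: "(c *\<^sub>C x) * y = c *\<^sub>C (x * y)"
    and mult_scaleC_right: "x * (c *\<^sub>C y) = c *\<^sub>C (x * y)"
    and norm_scaleC: "norm (c *\<^sub>C x) = cmod c * norm x"
    and star_star: "star (star x) = x"
    and star_add: "star (x + y) = star x + star y"
    and star_scaleC: "star (c *\<^sub>C x) = cnj c *\<^sub>C star x"
    and star_mult: "star (x * y) = star y * star x"
    and cstar_identity: "norm (star x * x) = (norm x)\<^sup>2"

definition star_hom :: "('a::cstar_algebra \<Rightarrow> 'b::cstar_algebra) \<Rightarrow> bool" where
  "star_hom f \<longleftrightarrow>
     f 1 = 1 \<and> (\<forall>x y. f (x + y) = f x + f y) \<and> (\<forall>c x. f (c *\<^sub>C x) = c *\<^sub>C f x) \<and>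
     (\<forall>x y. f (x * y) = f x * f y) \<and> (\<forall>x. f (star x) = star (f x))"

definition state :: "('a::cstar_algebra \<Rightarrow> complex) \<Rightarrow> bool" where
  "state \<phi> \<longleftrightarrow>
     (\<forall>x y. \<phi> (x + y) = \<phi> x + \<phi> y) \<and> (\<forall>c x. \<phi> (c *\<^sub>C x) = c * \<phi> x) \<and>
     (\<forall>x. \<phi> (star x * x) \<in> \<real> \<and> 0 \<le> Re (\<phi> (star x * x))) \<and> \<phi> 1 = 1"

text \<open>
  A list of pairs stands for the corresponding sum of elementary tensors in the algebraic tensor
  product; \<open>tl_mult\<close>, \<open>tl_star\<close> and \<open>tl_eval\<close> are the product, the involution and the
  product functional on such sums.
\<close>

definition tl_mult ::
  "('a::cstar_algebra \<times> 'a) list \<Rightarrow> ('a \<times> 'a) list \<Rightarrow> ('a \<times> 'a) list" where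
  "tl_mult xs ys = [(fst x * fst y, snd x * snd y). x \<leftarrow> xs, y \<leftarrow> ys]"

definition tl_star :: "('a::cstar_algebra \<times> 'a) list \<Rightarrow> ('a \<times> 'a) list" where
  "tl_star xs = map (map_prod star star) xs"

definition tl_eval ::
  "('a::cstar_algebra \<Rightarrow> complex) \<Rightarrow> ('a \<Rightarrow> complex) \<Rightarrow> ('a \<times> 'a) list \<Rightarrow> complex" where
  "tl_eval \<phi> \<psi> xs = (\<Sum>x\<leftarrow>xs. \<phi> (fst x) * \<psi> (snd x))"

text \<open>
  The spatial (minimal) C*-norm, as the supremum over pairs of states of the operator norm in the
  tensor product of the two GNS representations, computed on the dense subspace of vectors \<open>y\<close>
  in the algebraic tensor product.
\<close>

definition spatial_norm :: "('a::cstar_algebra \<times> 'a) list \<Rightarrow> real" where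
  "spatial_norm xs =
     Sup {sqrt (Re (tl_eval \<phi> \<psi> (tl_mult (tl_star (tl_mult xs ys)) (tl_mult xs ys)))) | \<phi> \<psi> ys.
            state \<phi> \<and> state \<psi> \<and> tl_eval \<phi> \<psi> (tl_mult (tl_star ys) ys) = 1}"

text \<open>
  The type \<open>'b\<close> together with the map \<open>tens\<close> (taking \<open>a\<close>, \<open>b\<close> to the elementary tensor) is the
  minimal C*-tensor product of \<open>'a\<close> with itself, i.e. the completion of the algebraic tensor
  product for the spatial norm.
\<close>

definition minimal_tensor_product ::
  "('a::cstar_algebra \<Rightarrow> 'a \<Rightarrow> 'b::cstar_algebra) \<Rightarrow> bool" where
  "minimal_tensor_product tens \<longleftrightarrow>
     (\<forall>a a' b. tens (a + a') b = tens a b + tens a' b) \<and>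
     (\<forall>a b b'. tens a (b + b') = tens a b + tens a b') \<and>
     (\<forall>c a b. tens (c *\<^sub>C a) b = c *\<^sub>C tens a b \<and> tens a (c *\<^sub>C b) = c *\<^sub>C tens a b) \<and>
     tens 1 1 = 1 \<and>
     (\<forall>a a' b b'. tens a b * tens a' b' = tens (a * a') (b * b')) \<and>
     (\<forall>a b. star (tens a b) = tens (star a) (star b)) \<and>
     (\<forall>xs. norm (\<Sum>x\<leftarrow>xs. tens (fst x) (snd x)) = spatial_norm xs) \<and>
     closure {\<Sum>x\<leftarrow>xs. tens (fst x) (snd x) | xs. True} = UNIV"


section \<open>Compact matrix quantum groups\<close>

inductive_set star_subalgebra :: "'a::cstar_algebra set \<Rightarrow> 'a set" for S where
  gen: "x \<in> S \<Longrightarrow> x \<in> star_subalgebra S"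
| one: "1 \<in> star_subalgebra S"
| add: "x \<in> star_subalgebra S \<Longrightarrow> y \<in> star_subalgebra S \<Longrightarrow> x + y \<in> star_subalgebra S"
| scale: "x \<in> star_subalgebra S \<Longrightarrow> c *\<^sub>C x \<in> star_subalgebra S"
| mult: "x \<in> star_subalgebra S \<Longrightarrow> y \<in> star_subalgebra S \<Longrightarrow> x * y \<in> star_subalgebra S"
| adj: "x \<in> star_subalgebra S \<Longrightarrow> star x \<in> star_subalgebra S"

record ('a, 'b) quantum_group =
  fund_dim :: nat
  fund :: "nat \<Rightarrow> nat \<Rightarrow> 'a"
  tensor :: "'a \<Rightarrow> 'a \<Rightarrow> 'b"
  comult :: "'a \<Rightarrow> 'b"

text \<open>
  Woronowicz's axioms for a compact quantum group with a distinguished fundamental representation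
  \<open>u = fund G\<close> (unitary, with invertible conjugate) whose coefficients generate the C*-algebra.
  Coassociativity of the comultiplication follows from its values on the generators.
\<close>

definition compact_matrix_quantum_group ::
  "('a::cstar_algebra, 'b::cstar_algebra) quantum_group \<Rightarrow> bool" where
  "compact_matrix_quantum_group G \<longleftrightarrow>
     (let N = fund_dim G; u = fund G in
       minimal_tensor_product (tensor G) \<and>
       closure (star_subalgebra {u i j | i j. i < N \<and> j < N}) = UNIV \<and>
       (\<forall>i<N. \<forall>j<N. (\<Sum>k<N. u i k * star (u j k)) = (if i = j then 1 else 0)) \<and>
       (\<forall>i<N. \<forall>j<N. (\<Sum>k<N. star (u k i) * u k j) = (if i = j then 1 else 0)) \<and>
       (\<exists>v. \<forall>i<N. \<forall>j<N.
          (\<Sum>k<N. star (u i k) * v k j) = (if i = j then 1 else 0) \<and>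
          (\<Sum>k<N. v i k * star (u k j)) = (if i = j then 1 else 0)) \<and>
       star_hom (comult G) \<and>
       (\<forall>i<N. \<forall>j<N. comult G (u i j) = (\<Sum>k<N. tensor G (u i k) (u k j))))"

fun fund_col :: "('a::cstar_algebra, 'b) quantum_group \<Rightarrow> colour \<Rightarrow> nat \<Rightarrow> nat \<Rightarrow> 'a" where
  "fund_col G White i j = fund G i j"
| "fund_col G Black i j = star (fund G i j)"

text \<open>
  Representations on a tensor power are matrices over the C*-algebra indexed by multi-indices.
\<close>

fun tensor_rep ::
  "('a::cstar_algebra, 'b) quantum_group \<Rightarrow> colour list \<Rightarrow> index \<Rightarrow> index \<Rightarrow> 'a" where
  "tensor_rep G [] [] [] = 1"
| "tensor_rep G (c # w) (i # is) (j # js) = fund_col G c i j * tensor_rep G w is js"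
| "tensor_rep G _ _ _ = 0"

definition Hom :: "('a::cstar_algebra, 'b) quantum_group \<Rightarrow> colour list \<Rightarrow> colour list \<Rightarrow> tmat set" where
  "Hom G w w' =
     (let N = fund_dim G in
      {M \<in> tensor_maps N (length w) (length w').
         \<forall>j\<in>idx N (length w'). \<forall>i\<in>idx N (length w).
           (\<Sum>m\<in>idx N (length w). M j m *\<^sub>C tensor_rep G w m i) =
           (\<Sum>m\<in>idx N (length w'). M m i *\<^sub>C tensor_rep G w' j m)})"

definition easy_quantum_group ::
  "nat \<Rightarrow> partition set \<Rightarrow> ('a::cstar_algebra, 'b::cstar_algebra) quantum_group \<Rightarrow> bool" where
  "easy_quantum_group N \<C> G \<longleftrightarrow>
     compact_matrix_quantum_group G \<and> fund_dim G = N \<and>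
     (\<forall>w w'. Hom G w w' = tmat.span {T_map N p | p. p \<in> \<C> \<and> up p = w \<and> low p = w'})"


section \<open>Subrepresentations and direct sums\<close>

text \<open>
  A matrix \<open>U\<close> over the C*-algebra acts on a vector \<open>\<xi>\<close> by sending it to a vector with coefficients
  in the algebra, i.e. to an element of the tensor product of the space with the algebra;
  \<open>algebra_span V\<close> is the subspace \<open>V \<otimes> A\<close> of the latter.
\<close>

definition coaction ::
  "nat \<Rightarrow> nat \<Rightarrow> (index \<Rightarrow> index \<Rightarrow> 'a::cstar_algebra) \<Rightarrow> tvec \<Rightarrow> index \<Rightarrow> 'a" where
  "coaction N k U \<xi> = (\<lambda>i. if i \<in> idx N k then \<Sum>j\<in>idx N k. \<xi> j *\<^sub>C U i j else 0)"

definition algebra_span :: "tvec set \<Rightarrow> (index \<Rightarrow> 'a::cstar_algebra) set" where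
  "algebra_span V =
     {(\<lambda>i. \<Sum>r<n. v r i *\<^sub>C a r) | (n::nat) (v :: nat \<Rightarrow> tvec) a. \<forall>r<n. v r \<in> V}"

text \<open>
  \<open>U'\<close> is the subrepresentation of \<open>U\<close> on the subspace \<open>V\<close>.
\<close>

definition subrepresentation ::
  "nat \<Rightarrow> nat \<Rightarrow> (index \<Rightarrow> index \<Rightarrow> 'a::cstar_algebra) \<Rightarrow> tvec set \<Rightarrow>
     (index \<Rightarrow> index \<Rightarrow> 'a) \<Rightarrow> bool" where
  "subrepresentation N k U V U' \<longleftrightarrow>
     V \<subseteq> tensor_space N k \<and> tvec.subspace V \<and>
     (\<forall>\<xi>\<in>V. coaction N k U \<xi> \<in> algebra_span V \<and> coaction N k U' \<xi> = coaction N k U \<xi>)"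

definition is_direct_sum_of_subrepresentations ::
  "nat \<Rightarrow> nat \<Rightarrow> (index \<Rightarrow> index \<Rightarrow> 'a::cstar_algebra) \<Rightarrow> 'i set \<Rightarrow> ('i \<Rightarrow> tvec set) \<Rightarrow>
     ('i \<Rightarrow> index \<Rightarrow> index \<Rightarrow> 'a) \<Rightarrow> bool" where
  "is_direct_sum_of_subrepresentations N k U I V U' \<longleftrightarrow>
     finite I \<and>
     (\<forall>p\<in>I. subrepresentation N k U (V p) (U' p)) \<and>
     (\<forall>\<xi>\<in>tensor_space N k. \<exists>!v. v \<in> (\<Pi>\<^sub>E p\<in>I. V p) \<and> \<xi> = (\<Sum>p\<in>I. v p))"

text \<open>\<open>u_part G \<C> p\<close> is \<open>(id \<otimes> P\<^sub>p)(u\<^sup>w)\<close> for the colouring \<open>w\<close> of \<open>p\<close>.\<close>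

definition u_part ::
  "('a::cstar_algebra, 'b) quantum_group \<Rightarrow> partition set \<Rightarrow> partition \<Rightarrow> index \<Rightarrow> index \<Rightarrow> 'a" where
  "u_part G \<C> p = (\<lambda>i j.
     \<Sum>m\<in>idx (fund_dim G) (length (up p)). P_map (fund_dim G) \<C> p i m *\<^sub>C tensor_rep G (up p) m j)"

end

(* A morphism r in C(w,w) satisfies r r* r = r, and p = r r* is a projective partition. Since
   q < p forces q into a strictly smaller two-sided ideal of the finite monoid C(w,w), the matrix
   P_p T_r equals T_r, up to a nonzero scalar, modulo T_x with x in smaller ideals. The T_r are
   linearly independent for N >= 4, so the P_{rr*} T_r form another basis of Hom(w,w), and those
   with rr* = p span the right ideal P_p Hom(w,w). Hence Hom(w,w) is the direct sum of these right
   ideals; decomposing the identity gives orthogonal idempotents with the same ranges as the P_p. *)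

theory Submission
  imports Defs
begin

section \<open>Noncrossing equivalence relations\<close>

text \<open>The bound 4 and noncrossingness are exploited in the linear independence. Placed on the
  boundary of the strip, a partition becomes a noncrossing equivalence relation on an initial
  segment of the naturals, and an entry of its map tells whether a labelling is constant on the
  classes. Four labels are two bits: one is tested for constancy, the other is Fourier transformed
  into a parity condition. Each relation supplies a pair of such data that it passes itself, and the
  matrix of all these tests is triangular. Two obstacles shape the rest. Removed loops create powers
  of N, so the maps represent the monoid only up to positive scalars. And P_p involves a supremum of
  projections, which has to stay in the span of the maps of smaller ideals; it does, since that span
  is an algebra and the support of a self-adjoint matrix is a polynomial in it without constant
  term. The ranges of different P_p need not be orthogonal, hence the passage through right
  ideals.\<close>

definition noncrossing_rel :: "nat rel \<Rightarrow> bool" where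
  "noncrossing_rel r \<longleftrightarrow>
     (\<forall>a b c d. a < b \<longrightarrow> b < c \<longrightarrow> c < d \<longrightarrow> (a, c) \<in> r \<longrightarrow> (b, d) \<in> r \<longrightarrow> (a, b) \<in> r)"

definition opener :: "nat rel \<Rightarrow> nat \<Rightarrow> bool" where
  "opener r j \<longleftrightarrow> (\<forall>i. (i, j) \<in> r \<longrightarrow> j \<le> i)"

definition closer :: "nat rel \<Rightarrow> nat \<Rightarrow> bool" where
  "closer r j \<longleftrightarrow> (\<forall>i. (i, j) \<in> r \<longrightarrow> i \<le> j)"

definition adjacent :: "nat rel \<Rightarrow> nat \<Rightarrow> nat \<Rightarrow> bool" where
  "adjacent r i j \<longleftrightarrow> (i, j) \<in> r \<and> i < j \<and> (\<forall>k. i < k \<longrightarrow> k < j \<longrightarrow> (i, k) \<notin> r)"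

text \<open>Modulo 2, \<open>D\<close> is orthogonal to the indicator of every class. This is dual
  to \<open>class_constant\<close> for a bit-valued function, which asks for a combination of such
  indicators.\<close>

definition even_classes :: "nat \<Rightarrow> nat rel \<Rightarrow> nat set \<Rightarrow> bool" where
  "even_classes n r D \<longleftrightarrow> (\<forall>j<n. even (card (D \<inter> r `` {j})))"

definition class_constant :: "nat rel \<Rightarrow> (nat \<Rightarrow> 'b) \<Rightarrow> bool" where
  "class_constant r u \<longleftrightarrow> (\<forall>(i, j)\<in>r. u i = u j)"

section \<open>Parity counts inside noncrossing relations\<close>

lemma equiv_symD: "equiv A r \<Longrightarrow> (x, y) \<in> r \<Longrightarrow> (y, x) \<in> r"
  by (meson equiv_def symE)

lemma equiv_transD: "equiv A r \<Longrightarrow> (x, y) \<in> r \<Longrightarrow> (y, z) \<in> r \<Longrightarrow> (x, z) \<in> r"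
  by (meson equiv_def transE)

text \<open>A set closed under \<open>s\<close> is a disjoint union of classes; they are split off
  one at a time.\<close>

lemma even_card_closed:
  assumes s: "equiv {..<n} s" and E: "even_classes n s D"
    and W: "W \<subseteq> {..<n}" and cl: "\<And>i j. (i, j) \<in> s \<Longrightarrow> i \<in> W \<Longrightarrow> j \<in> W"
  shows "even (card (D \<inter> W))"
  using W cl
proof (induction "card W" arbitrary: W rule: less_induct)
  case less
  have fin: "finite W" using less.prems(1) finite_subset by blast
  show ?case
  proof (cases "W = {}")
    case False
    then obtain x where x: "x \<in> W" by auto
    let ?C = "s `` {x}"
    have xC: "x \<in> ?C" using s x less.prems(1) by (auto simp: equiv_def refl_on_def)
    have CW: "?C \<subseteq> W" using less.prems(2) x by blast
    have sym: "(j, i) \<in> s" if "(i, j) \<in> s" for i j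
      using s that by (meson equiv_def symE)
    have tr: "(i, k) \<in> s" if "(i, j) \<in> s" "(j, k) \<in> s" for i j k
      using s that by (meson equiv_def transE)
    have "even (card (D \<inter> (W - ?C)))"
    proof (rule less.hyps)
      show "card (W - ?C) < card W"
        using fin x xC by (metis DiffD1 DiffD2 Diff_subset card_mono nat_less_le psubsetI psubset_card_mono)
      show "W - ?C \<subseteq> {..<n}" using less.prems(1) by auto
      show "j \<in> W - ?C" if "(i, j) \<in> s" "i \<in> W - ?C" for i j
        using that less.prems(2) sym tr by blast
    qed
    moreover have "even (card (D \<inter> ?C))"
      using E x less.prems(1) by (auto simp: even_classes_def)
    moreover have "card (D \<inter> W) = card (D \<inter> ?C) + card (D \<inter> (W - ?C))"
    proof -
      have "D \<inter> W = (D \<inter> ?C) \<union> (D \<inter> (W - ?C))" using CW by auto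
      moreover have "card ((D \<inter> ?C) \<union> (D \<inter> (W - ?C))) = card (D \<inter> ?C) + card (D \<inter> (W - ?C))"
        by (rule card_Un_disjoint) (use fin CW finite_subset[of "D \<inter> ?C" W] in auto)
      ultimately show ?thesis by simp
    qed
    ultimately show ?thesis by simp
  qed auto
qed

text \<open>A class with a point strictly between \<open>i\<close> and \<open>j\<close> cannot leave
  the interval without crossing the class of \<open>i\<close>. Hence the gap, once the class of
  \<open>i\<close> is removed, is a union of classes.\<close>

lemma even_card_gap:
  assumes s: "equiv {..<n} s" and nc: "noncrossing_rel s" and E: "even_classes n s D"
    and ij: "(i, j) \<in> s"
  shows "even (card (D \<inter> ({i<..<j} - s `` {i})))"
proof (rule even_card_closed[OF s E])
  have sym: "(j, i) \<in> s" if "(i, j) \<in> s" for i j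
    using s that by (meson equiv_def symE)
  have tr: "(i, k) \<in> s" if "(i, j) \<in> s" "(j, k) \<in> s" for i j k
    using s that by (meson equiv_def transE)
  have "j < n" using s ij by (auto simp: equiv_def refl_on_def)
  then show "{i<..<j} - s `` {i} \<subseteq> {..<n}" by auto
  fix p q assume pq: "(p, q) \<in> s" "p \<in> {i<..<j} - s `` {i}"
  then have 1: "(i, q) \<notin> s" using sym tr by blast
  have "q < j"
  proof (rule ccontr)
    assume "\<not> q < j"
    then have "j < q" using 1 ij by (metis linorder_neqE_nat)
    then have "(i, p) \<in> s"
      using nc pq ij unfolding noncrossing_rel_def by (metis DiffD1 greaterThanLessThan_iff)
    then show False using pq by auto
  qed
  moreover have "i < q"
  proof (rule ccontr)
    assume "\<not> i < q"
    then have "q < i"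
      using 1 s ij by (metis equiv_class_eq_iff linorder_neqE_nat)
    then have "(q, i) \<in> s"
      using nc pq ij sym unfolding noncrossing_rel_def by (metis DiffD1 greaterThanLessThan_iff)
    then show False using 1 sym by blast
  qed
  ultimately show "q \<in> {i<..<j} - s `` {i}" using 1 by auto
qed

text \<open>
  For \<open>a\<close> and \<open>b\<close> the opener and closer predicates, \<open>mismatch\<close> consists of the end points of the
  classes with at least two elements, and \<open>level\<close> is the parity of the nesting depth. These are the
  labels that separate noncrossing relations.
\<close>

definition mismatch :: "nat \<Rightarrow> (nat \<Rightarrow> bool) \<Rightarrow> (nat \<Rightarrow> bool) \<Rightarrow> nat set" where
  "mismatch n a b = {j. j < n \<and> a j \<noteq> b j}"

definition level :: "nat \<Rightarrow> (nat \<Rightarrow> bool) \<Rightarrow> (nat \<Rightarrow> bool) \<Rightarrow> nat \<Rightarrow> bool" where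
  "level n a b j \<longleftrightarrow> (even (card (mismatch n a b \<inter> {..<j})) \<noteq> a j)"

lemma finite_mismatch: "finite (mismatch n a b)"
  by (simp add: mismatch_def)

text \<open>On the way from \<open>i\<close> to \<open>j\<close> the other classes contribute an
  even count, so the change of level depends on the class of \<open>i\<close> alone. Here
  \<open>a\<close> and \<open>b\<close> are arbitrary; later they are the opener and closer
  predicates of a relation that may differ from \<open>s\<close>.\<close>

lemma level_split:
  assumes s: "equiv {..<n} s" and nc: "noncrossing_rel s"
    and E: "even_classes n s (mismatch n a b)" and ij: "(i, j) \<in> s" "i < j"
  shows "(level n a b i = level n a b j) \<longleftrightarrow>
    (even (card (mismatch n a b \<inter> s `` {i} \<inter> {i..<j})) \<longleftrightarrow> (a i = a j))"
proof -
  let ?D = "mismatch n a b"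
  have 1: "?D \<inter> {..<j} =
     ?D \<inter> {..<i} \<union> (?D \<inter> s `` {i} \<inter> {i..<j} \<union> ?D \<inter> ({i<..<j} - s `` {i}))"
  proof -
    have "i \<in> s `` {i}" using s ij by (metis Image_singleton_iff equiv_class_eq_iff)
    then have "{..<j} = {..<i} \<union> (s `` {i} \<inter> {i..<j} \<union> ({i<..<j} - s `` {i}))"
      using ij(2) by (auto simp: nat_less_le)
    then show ?thesis by blast
  qed
  have 2: "card (?D \<inter> {..<j}) = card (?D \<inter> {..<i}) +
     (card (?D \<inter> s `` {i} \<inter> {i..<j}) + card (?D \<inter> ({i<..<j} - s `` {i})))"
    unfolding 1 by (subst card_Un_disjoint; (subst card_Un_disjoint)?) (auto simp: finite_mismatch)
  show ?thesis
    using even_card_gap[OF s nc E ij(1)] unfolding level_def 2 by auto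
qed

text \<open>In the half-open interval from \<open>i\<close> to \<open>j\<close> the class has the
  single point \<open>i\<close>, so equal levels mean that \<open>i\<close> is a mismatch iff
  \<open>a i\<close> differs from \<open>a j\<close>. Either way \<open>b i = a j\<close>.\<close>

lemma level_adjacent:
  assumes s: "equiv {..<n} s" and nc: "noncrossing_rel s"
    and E: "even_classes n s (mismatch n a b)" and R: "class_constant s (level n a b)"
    and adj: "adjacent s i j"
  shows "b i = a j"
proof -
  have ij: "(i, j) \<in> s" "i < j" using adj by (auto simp: adjacent_def)
  have refl: "(i, i) \<in> s" and n: "i < n" using s ij by (auto simp: equiv_def refl_on_def)
  have "s `` {i} \<inter> {i..<j} = {i}" using adj refl by (auto simp: adjacent_def nat_less_le)
  then have "mismatch n a b \<inter> s `` {i} \<inter> {i..<j} = (if a i = b i then {} else {i})"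
    using n by (auto simp: mismatch_def)
  moreover have "level n a b i = level n a b j" using R ij by (auto simp: class_constant_def)
  ultimately show ?thesis
    using level_split[OF s nc E ij] by (auto split: if_splits)
qed

text \<open>The counterpart of the adjacency rule for the two ends of a class. The class contains an
  even number of mismatches, so those before \<open>M\<close> have the parity contributed by
  \<open>M\<close> itself, and comparing the levels of \<open>m\<close> and \<open>M\<close> gives
  the claim. For a one-point class evenness suffices.\<close>

lemma level_hull:
  assumes s: "equiv {..<n} s" and nc: "noncrossing_rel s"
    and E: "even_classes n s (mismatch n a b)" and R: "class_constant s (level n a b)"
    and mM: "(m, M) \<in> s" "opener s m" "closer s M"
  shows "b M = a m"
proof (cases "m = M")
  case True
  have n: "m < n" using s mM by (auto simp: equiv_def refl_on_def)
  have "s `` {m} = {m}"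
    using mM equiv_symD[OF s] True unfolding opener_def closer_def
    by (auto intro: le_antisym)
  then have "even (card (mismatch n a b \<inter> {m}))"
    using E n unfolding even_classes_def by metis
  moreover have "mismatch n a b \<inter> {m} = (if a m = b m then {} else {m})"
    using n by (auto simp: mismatch_def)
  ultimately show ?thesis using True by (auto split: if_splits)
next
  case False
  have sym: "(j, i) \<in> s" if "(i, j) \<in> s" for i j
    using s that by (meson equiv_def symE)
  have tr: "(i, k) \<in> s" if "(i, j) \<in> s" "(j, k) \<in> s" for i j k
    using s that by (meson equiv_def transE)
  have n: "m < n" "M < n" using s mM by (auto simp: equiv_def refl_on_def)
  have lt: "m < M" using False mM by (auto simp: opener_def nat_less_le sym)
  let ?D = "mismatch n a b"
  have "s `` {m} \<subseteq> {m..M}"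
    using mM sym tr unfolding opener_def closer_def by (metis Image_singleton_iff atLeastAtMost_iff subsetI)
  then have eq: "?D \<inter> s `` {m} = (?D \<inter> s `` {m} \<inter> {m..<M}) \<union> (?D \<inter> {M})"
    using mM by (auto simp: nat_less_le)
  have "card (?D \<inter> s `` {m}) = card (?D \<inter> s `` {m} \<inter> {m..<M}) + card (?D \<inter> {M})"
    by (subst eq, subst card_Un_disjoint) (auto simp: finite_mismatch)
  moreover have "even (card (?D \<inter> s `` {m}))" using E n by (auto simp: even_classes_def)
  ultimately have "even (card (?D \<inter> s `` {m} \<inter> {m..<M})) \<longleftrightarrow> even (card (?D \<inter> {M}))"
    by (metis even_add)
  also have "?D \<inter> {M} = (if a M = b M then {} else {M})" using n by (auto simp: mismatch_def)
  also have "even (card \<dots>) \<longleftrightarrow> a M = b M" by simp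
  finally have "even (card (?D \<inter> s `` {m} \<inter> {m..<M})) \<longleftrightarrow> a M = b M" .
  moreover have "level n a b m = level n a b M" using R mM by (auto simp: class_constant_def)
  ultimately show ?thesis using level_split[OF s nc E mM(1) lt] by auto
qed

section \<open>Recovering a noncrossing relation from the first and last points of its
  classes\<close>

lemma opener_exists:
  assumes s: "equiv {..<n} s" and j: "j < n"
  obtains m where "(m, j) \<in> s" "opener s m" "m \<le> j"
proof -
  have jj: "(j, j) \<in> s" using s j by (auto simp: equiv_def refl_on_def)
  let ?m = "LEAST i. (i, j) \<in> s"
  have m: "(?m, j) \<in> s" using jj by (rule LeastI)
  moreover have "opener s ?m" unfolding opener_def
    by (auto intro!: Least_le intro: equiv_transD[OF s _ m])
  ultimately show ?thesis using that[of ?m] jj by (simp add: Least_le)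
qed

lemma adjacent_pred_exists:
  assumes s: "equiv {..<n} s" and j: "j < n" and ij: "\<not> opener s j"
  obtains i where "adjacent s i j"
proof -
  obtain k where k: "(k, j) \<in> s" "k < j" using ij by (auto simp: opener_def not_le)
  let ?S = "{i. (i, j) \<in> s \<and> i < j}"
  have fin: "finite ?S" by (rule finite_subset[of _ "{..<j}"]) auto
  have P: "Max ?S \<in> ?S" using k by (intro Max_in[OF fin]) auto
  have "(Max ?S, l) \<notin> s" if "Max ?S < l" "l < j" for l
  proof
    assume "(Max ?S, l) \<in> s"
    then have "(l, j) \<in> s" using P equiv_symD[OF s] equiv_transD[OF s] by blast
    then have "l \<le> Max ?S" using that by (intro Max_ge[OF fin]) auto
    then show False using that by simp
  qed
  then show ?thesis using that P by (auto simp: adjacent_def)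
qed

lemma adjacent_succ_exists:
  assumes s: "equiv {..<n} s" and j: "j < n" and ij: "\<not> closer s j"
  obtains i where "adjacent s j i"
proof -
  obtain k where k: "(k, j) \<in> s" "j < k" using ij by (auto simp: closer_def not_le)
  let ?P = "\<lambda>i. (j, i) \<in> s \<and> j < i"
  have P: "?P (Least ?P)" by (rule LeastI[of ?P k]) (use k equiv_symD[OF s] in blast)
  have "(j, l) \<notin> s" if "j < l" "l < Least ?P" for l
    using not_less_Least[of l ?P] that by blast
  then show ?thesis using that P by (auto simp: adjacent_def)
qed

text \<open>Suppose that \<open>i'\<close> lies to the right of \<open>i\<close>. It is not last in
  its class for \<open>r\<close>, so it has a successor \<open>k\<close> in \<open>s\<close>. Now
  \<open>k < j\<close> contradicts the agreement to the left of \<open>j\<close>,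
  \<open>k = j\<close> contradicts the adjacency of \<open>i\<close> and \<open>j\<close>, and
  \<open>k > j\<close> is a crossing.\<close>

lemma adjacent_transfer_aux:
  assumes s: "equiv {..<n} s" and nc: "noncrossing_rel s" and r: "equiv {..<n} r"
    and agree: "\<And>i. i < n \<Longrightarrow> closer r i = closer s i"
    and IH: "\<And>i k. k < j \<Longrightarrow> adjacent s i k \<Longrightarrow> adjacent r i k"
    and adj: "adjacent s i j" "adjacent r i' j"
  shows "i' \<le> i"
proof (rule ccontr)
  assume "\<not> i' \<le> i"
  then have lt: "i < i'" "i' < j" using adj by (auto simp: adjacent_def)
  have jn: "j < n" using s adj by (auto simp: adjacent_def equiv_def refl_on_def)
  have "\<not> closer r i'" 
    using adj lt equiv_symD[OF r, of i' j] by (force simp: adjacent_def closer_def)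
  then have "\<not> closer s i'" using agree lt jn by simp
  then obtain k where k: "adjacent s i' k" 
    using adjacent_succ_exists[OF s order.strict_trans[OF lt(2) jn]] by blast
  consider "k < j" | "k = j" | "j < k" by linarith
  then show False
  proof cases
    case 1
    then have "adjacent r i' k" using IH k by blast
    then show False using adj 1 by (auto simp: adjacent_def)
  next
    case 2
    then have "(i, i') \<in> s"
      using k adj equiv_transD[OF s _ equiv_symD[OF s], of i j i'] by (simp add: adjacent_def)
    then show False using adj lt by (auto simp: adjacent_def)
  next
    case 3
    then have "(i, i') \<in> s"
      using nc[unfolded noncrossing_rel_def, rule_format, of i i' j k] lt adj k
      by (simp add: adjacent_def)
    then show False using adj lt by (auto simp: adjacent_def)
  qed
qed

text \<open>Bracket matching: the left neighbour of \<open>j\<close> in its class is the rightmost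
  point that still awaits a successor, which depends on the opener and closer data alone. Formally,
  the candidates from the two relations bound each other.\<close>

lemma adjacent_determined:
  assumes s: "equiv {..<n} s" "noncrossing_rel s" and r: "equiv {..<n} r" "noncrossing_rel r"
    and agree: "\<And>i. i < n \<Longrightarrow> opener r i = opener s i" "\<And>i. i < n \<Longrightarrow> closer r i = closer s i"
  shows "adjacent s i j \<longleftrightarrow> adjacent r i j"
proof (induction j arbitrary: i rule: less_induct)
  case (less j)
  \<comment> \<open>Stated for local \<open>r\<close> and \<open>s\<close>, because the converse
    implication exchanges their roles.\<close>
  have *: "adjacent r i j"
    if s: "equiv {..<n} s" "noncrossing_rel s" and r: "equiv {..<n} r" "noncrossing_rel r"
    and agree: "\<And>i. i < n \<Longrightarrow> opener r i = opener s i" "\<And>i. i < n \<Longrightarrow> closer r i = closer s i"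
    and IH: "\<And>i k. k < j \<Longrightarrow> adjacent s i k = adjacent r i k" and adj: "adjacent s i j" for r s i
  proof -
    have jn: "j < n" using s adj by (auto simp: adjacent_def equiv_def refl_on_def)
    have "\<not> opener s j" using adj by (auto simp: adjacent_def opener_def)
    then obtain i' where i': "adjacent r i' j"
      using adjacent_pred_exists[OF r(1) jn] agree jn by metis
    have "i' \<le> i" using adjacent_transfer_aux[OF s r(1) agree(2) _ adj i'] IH by blast
    moreover have "i \<le> i'"
      using adjacent_transfer_aux[OF r s(1) agree(2)[symmetric] _ i' adj] IH by blast
    ultimately show ?thesis using i' by simp
  qed
  show ?case
    using *[OF s r agree] *[OF r s agree[symmetric]] less.IH by blast
qed

text \<open>A related pair is linked by a chain of adjacent pairs, found by stepping repeatedly from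
  the right point to its left neighbour.\<close>

lemma equiv_subset_if_adjacent:
  assumes s: "equiv {..<n} s" and r: "equiv {..<n} r"
    and adj: "\<And>i j. adjacent s i j \<Longrightarrow> adjacent r i j"
  shows "s \<subseteq> r"
proof -
  have sym: "(j, i) \<in> r" if "(i, j) \<in> r" for i j
    using r that by (meson equiv_def symE)
  have *: "(i, j) \<in> r" if "(i, j) \<in> s" "i \<le> j" for i j
    using that
  proof (induction j rule: less_induct)
    case (less j)
    have jn: "j < n" "i < n" using s less.prems by (auto simp: equiv_def refl_on_def)
    show ?case
    proof (cases "i = j")
      case True
      then show ?thesis using r jn by (auto simp: equiv_def refl_on_def)
    next
      case False
      then have "\<not> opener s j" using less.prems by (auto simp: opener_def)
      then obtain k where k: "adjacent s k j" using adjacent_pred_exists[OF s jn(1)] by blast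
      have ik: "(i, k) \<in> s" 
        using k less.prems equiv_transD[OF s _ equiv_symD[OF s], of i j k] by (simp add: adjacent_def)
      have "i \<le> k"
      proof (rule ccontr)
        assume "\<not> i \<le> k"
        moreover have "(k, i) \<in> s" using ik s by (meson equiv_def symE)
        ultimately show False using k False less.prems by (auto simp: adjacent_def)
      qed
      then have "(i, k) \<in> r" using less.IH[of k] ik k by (auto simp: adjacent_def)
      then show ?thesis 
        using adj[OF k] equiv_transD[OF r, of i k j] by (simp add: adjacent_def)
    qed
  qed
  show ?thesis
  proof clarify
    fix i j assume "(i, j) \<in> s"
    moreover from this have "(j, i) \<in> s" using s by (meson equiv_def symE)
    ultimately show "(i, j) \<in> r" using * sym nat_le_linear by metis
  qed
qed

section \<open>Lexicographic triangularity of the tests\<close>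

text \<open>The digits 0, 1, 2, 3 stand for the first point of a longer class, a singleton, an inner
  point and a last point. The opener bit has weight 2 because its comparison at the first difference
  is unconditional, whereas closers are compared only when the opener bits agree.\<close>

definition profile :: "nat \<Rightarrow> nat rel \<Rightarrow> nat list" where
  "profile n r = map (\<lambda>j. 2 * of_bool (\<not> opener r j) + of_bool (closer r j)) [0..<n]"

text \<open>Let \<open>j\<close> be the first place where the data differ. If \<open>r\<close> opens
  at \<open>j\<close> but \<open>j\<close> has a predecessor \<open>i\<close> in \<open>s\<close>,
  then \<open>i\<close> is a closer of \<open>r\<close>, hence of \<open>s\<close>, which is absurd.
  If the opener bits agree and \<open>j\<close> closes a class of \<open>s\<close>, that class
  starts at an opener of \<open>r\<close>, and the hull rule makes \<open>j\<close> a closer of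
  \<open>r\<close>. So the digit of \<open>s\<close> at \<open>j\<close> is the smaller one.\<close>

lemma profile_triangular:
  assumes s: "equiv {..<n} s" "noncrossing_rel s" and r: "equiv {..<n} r" "noncrossing_rel r"
    and E: "even_classes n s (mismatch n (opener r) (closer r))"
    and R: "class_constant s (level n (opener r) (closer r))" and ne: "r \<noteq> s"
  shows "(profile n s, profile n r) \<in> lexn less_than n"
proof -
  have ex: "\<exists>j. j < n \<and> (opener r j \<noteq> opener s j \<or> closer r j \<noteq> closer s j)"
  proof (rule ccontr)
    assume "\<not> ?thesis"
    then have "adjacent s i j \<longleftrightarrow> adjacent r i j" for i j
      by (intro adjacent_determined[OF s r]) auto
    then have "s \<subseteq> r" "r \<subseteq> s"
      using equiv_subset_if_adjacent[OF s(1) r(1)] equiv_subset_if_adjacent[OF r(1) s(1)] by auto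
    then show False using ne by simp
  qed
  let ?Q = "\<lambda>j. j < n \<and> (opener r j \<noteq> opener s j \<or> closer r j \<noteq> closer s j)"
  define j where "j = Least ?Q"
  have j: "?Q j" unfolding j_def using ex by (rule LeastI_ex)
  have before: "opener r i = opener s i \<and> closer r i = closer s i" if "i < j" for i
    using not_less_Least[of i ?Q] that j unfolding j_def by auto
  have 1: "opener s j" if "opener r j"
  proof (rule ccontr)
    assume "\<not> opener s j"
    then obtain i where i: "adjacent s i j" using adjacent_pred_exists[OF s(1)] j by blast
    then have "closer r i" using level_adjacent[OF s E R i] that by simp
    then have "closer s i" using before i by (auto simp: adjacent_def)
    then show False 
      using i equiv_symD[OF s(1), of i j] by (force simp: adjacent_def closer_def)
  qed
  have 2: "closer r j" if "closer s j" "opener r j = opener s j"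
  proof -
    obtain m where m: "(m, j) \<in> s" "opener s m" "m \<le> j" using opener_exists[OF s(1)] j by blast
    then have "closer r j = opener r m" using level_hull[OF s E R] that by blast
    moreover have "opener r m" using m before that by (cases "m = j") auto
    ultimately show ?thesis by simp
  qed
  let ?f = "\<lambda>r j. 2 * of_bool (\<not> opener r j) + of_bool (closer r j) :: nat"
  have lt: "?f s j < ?f r j" using j 1 2 by (auto simp: of_bool_def)
  have upt: "[0..<n] = [0..<j] @ j # [Suc j..<n]"
    using j upt_conv_Cons[of j n] upt_add_eq_append[of 0 j "n - j"] by auto
  have split: "profile n q = map (?f q) [0..<j] @ ?f q j # map (?f q) [Suc j..<n]" for q
    unfolding profile_def upt by simp
  have same: "map (?f s) [0..<j] = map (?f r) [0..<j]"
    using before by simp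
  have len: "length (profile n s) = n" "length (profile n r) = n" by (simp_all add: profile_def)
  show ?thesis unfolding lexn_conv
    using len split[of s] split[of r, folded same] lt by blast
qed

section \<open>Each relation passes its own test\<close>

lemma closer_exists:
  assumes s: "equiv {..<n} s" and j: "j < n"
  obtains M where "(j, M) \<in> s" "closer s M" "j \<le> M"
proof -
  have "(j, j) \<in> s" using s j by (auto simp: equiv_def refl_on_def)
  then have jS: "j \<in> s `` {j}" by simp
  have fin: "finite (s `` {j})"
    using s finite_subset[of "s `` {j}" "{..<n}"] by (auto simp: equiv_def refl_on_def)
  have M: "Max (s `` {j}) \<in> s `` {j}" using jS by (intro Max_in[OF fin]) auto
  have "closer s (Max (s `` {j}))" unfolding closer_def
  proof clarify
    fix i assume "(i, Max (s `` {j})) \<in> s"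
    then have "(j, i) \<in> s" using M equiv_transD[OF s _ equiv_symD[OF s]] by blast
    then show "i \<le> Max (s `` {j})" by (intro Max_ge[OF fin]) simp
  qed
  then show ?thesis using that M Max_ge[OF fin jS] by simp
qed

lemma opener_closer_unique:
  assumes "equiv A r" "(i, j) \<in> r"
  shows "opener r i \<Longrightarrow> opener r j \<Longrightarrow> i = j" "closer r i \<Longrightarrow> closer r j \<Longrightarrow> i = j"
  using assms equiv_symD[OF assms] by (force simp: opener_def closer_def)+

text \<open>Inner points carry neither bit and a singleton carries both, so only the two ends of a
  longer class are mismatches.\<close>

lemma mismatch_class:
  assumes r: "equiv {..<n} r" and m: "(m, j) \<in> r" "opener r m" and M: "(j, M) \<in> r" "closer r M"
  shows "mismatch n (opener r) (closer r) \<inter> r `` {j} = (if m = M then {} else {m, M})"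
proof -
  have op: "opener r x \<longleftrightarrow> x = m" if "(j, x) \<in> r" for x
    using opener_closer_unique(1)[OF r equiv_transD[OF r m(1) that]] m by auto
  have cl: "closer r x \<longleftrightarrow> x = M" if "(j, x) \<in> r" for x
    using opener_closer_unique(2)[OF r equiv_transD[OF r equiv_symD[OF r that] M(1)]] M by auto
  have "x < n" if "(j, x) \<in> r" for x using r that by (auto simp: equiv_def refl_on_def)
  then show ?thesis
    using op cl equiv_symD[OF r m(1)] M(1) unfolding mismatch_def by auto
qed

lemma even_classes_mismatch:
  assumes r: "equiv {..<n} r"
  shows "even_classes n r (mismatch n (opener r) (closer r))"
  unfolding even_classes_def
proof clarify
  fix j assume "j < n"
  then obtain m M where "(m, j) \<in> r" "opener r m" "(j, M) \<in> r" "closer r M"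
    using opener_exists[OF r] closer_exists[OF r] by metis
  then show "even (card (mismatch n (opener r) (closer r) \<inter> r `` {j}))"
    unfolding mismatch_class[OF r \<open>(m, j) \<in> r\<close> \<open>opener r m\<close> \<open>(j, M) \<in> r\<close> \<open>closer r M\<close>] by auto
qed

text \<open>Compare each point with the first point \<open>m\<close> of its class. Before any later
  point of the class the only mismatch in the class is \<open>m\<close>, an odd count, and this
  compensates the loss of the opener bit.\<close>

lemma class_constant_level:
  assumes r: "equiv {..<n} r" and nc: "noncrossing_rel r"
  shows "class_constant r (level n (opener r) (closer r))"
proof -
  let ?l = "level n (opener r) (closer r)" and ?D = "mismatch n (opener r) (closer r)"
  have *: "?l m = ?l j" if mj: "(m, j) \<in> r" and m: "opener r m" for m j
  proof (cases "m = j")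
    case False
    then have lt: "m < j" using that equiv_symD[OF r mj] by (auto simp: opener_def nat_less_le)
    have j: "j < n" and mm: "(m, m) \<in> r" using r mj by (auto simp: equiv_def refl_on_def)
    obtain M where M: "(j, M) \<in> r" "closer r M" "j \<le> M" using closer_exists[OF r j] .
    have "?D \<inter> r `` {m} = {m, M}"
      using mismatch_class[OF r mm m equiv_transD[OF r mj M(1)] M(2)] lt M(3) by auto
    then have "?D \<inter> r `` {m} \<inter> {m..<j} = {m}" using lt M(3) by auto
    moreover have "\<not> opener r j" using opener_closer_unique(1)[OF r mj m] False by auto
    ultimately show ?thesis
      using level_split[OF r nc even_classes_mismatch[OF r] mj lt] m by simp
  qed simp
  show ?thesis unfolding class_constant_def
  proof clarify
    fix i j assume ij: "(i, j) \<in> r"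
    then have "i < n" using r by (auto simp: equiv_def refl_on_def)
    then obtain m where "(m, i) \<in> r" "opener r m" using opener_exists[OF r] by blast
    then have "?l i = ?l m" "?l j = ?l m" using * equiv_transD[OF r _ ij] by metis+
    then show "?l i = ?l j" by simp
  qed
qed

text \<open>Orthogonality of characters on the vector space over two elements formed by the unions
  of classes: if a class meets \<open>D\<close> in an odd number of points, adding that class modulo
  2 is a sign-reversing involution.\<close>

lemma sign_sum_even_classes:
  assumes r: "equiv {..<n} r"
  defines "\<W> \<equiv> {W \<in> Pow {..<n}. class_constant r (\<lambda>j. j \<in> W)}"
  shows "(\<Sum>W\<in>\<W>. (-1) ^ card (D \<inter> W) :: complex) =
    (if even_classes n r D then of_nat (card \<W>) else 0)"
proof (cases "even_classes n r D")
  case True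
  have "even (card (D \<inter> W))" if "W \<in> \<W>" for W
    by (rule even_card_closed[OF r True]) (use that in \<open>auto simp: \<W>_def class_constant_def\<close>)
  then have "(\<Sum>W\<in>\<W>. (-1) ^ card (D \<inter> W) :: complex) = (\<Sum>W\<in>\<W>. 1)"
    by (intro sum.cong) auto
  then show ?thesis using True by simp
next
  case False
  then obtain j where j: "j < n" "odd (card (D \<inter> r `` {j}))" by (auto simp: even_classes_def)
  let ?C = "r `` {j}"
  let ?f = "\<lambda>W. (W - ?C) \<union> (?C - W)"
  have jC: "j \<in> ?C" using r j by (auto simp: equiv_def refl_on_def)
  have C: "x \<in> ?C \<longleftrightarrow> y \<in> ?C" if "(x, y) \<in> r" for x y
    using that equiv_transD[OF r _ that] equiv_transD[OF r _ equiv_symD[OF r that]] by auto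
  have Cn: "?C \<subseteq> {..<n}" using r by (auto simp: equiv_def refl_on_def)
  have f: "?f W \<in> \<W>" if "W \<in> \<W>" for W
    using that Cn C unfolding \<W>_def class_constant_def by fast
  have sgn: "(-1) ^ card (D \<inter> ?f W) = - ((-1) ^ card (D \<inter> W) :: complex)" if W: "W \<in> \<W>" for W
  proof -
    have fin: "finite W" "finite ?C"
      using W Cn finite_subset[of _ "{..<n}"] by (auto simp: \<W>_def)
    have "x \<in> W \<longleftrightarrow> j \<in> W" if "x \<in> ?C" for x
      using W that by (auto simp: \<W>_def class_constant_def)
    then consider "?C \<subseteq> W" | "?C \<inter> W = {}" by blast
    then show ?thesis
    proof cases
      case 1
      then have "D \<inter> W = (D \<inter> ?f W) \<union> (D \<inter> ?C)" by auto
      then have "card (D \<inter> W) = card (D \<inter> ?f W) + card (D \<inter> ?C)"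
        using 1 fin card_Un_disjoint[of "D \<inter> ?f W" "D \<inter> ?C"] by auto
      then show ?thesis using j by (simp add: power_add)
    next
      case 2
      then have "D \<inter> ?f W = (D \<inter> W) \<union> (D \<inter> ?C)" by auto
      then have "card (D \<inter> ?f W) = card (D \<inter> W) + card (D \<inter> ?C)"
        using 2 fin card_Un_disjoint[of "D \<inter> W" "D \<inter> ?C"] by auto
      then show ?thesis using j by (simp add: power_add)
    qed
  qed
  have inv: "?f (?f W) = W" for W by auto
  have "(\<Sum>W\<in>\<W>. (-1) ^ card (D \<inter> W) :: complex) = (\<Sum>W\<in>\<W>. (-1) ^ card (D \<inter> ?f W))"
    by (rule sum.reindex_bij_witness[of _ ?f ?f]) (use f inv in auto)
  also have "\<dots> = - (\<Sum>W\<in>\<W>. (-1) ^ card (D \<inter> W) :: complex)"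
    using sgn by (simp add: sum_negf)
  finally show ?thesis using False by simp
qed

text \<open>
  Write the labels 0, ..., 3 as \<open>2u + v\<close>. Summing against the character of \<open>v\<close> given by a set \<open>D\<close>
  tests whether \<open>u\<close> is constant and \<open>D\<close> even on each class; on the pairs \<open>(u, D)\<close> attached to the
  relations themselves this test is triangular for the lexicographic order of the profiles.
\<close>

theorem noncrossing_independent:
  fixes e :: "'b \<Rightarrow> nat rel" and c :: "'b \<Rightarrow> complex"
  assumes X: "finite X" and inj: "inj_on e X"
    and e: "\<And>x. x \<in> X \<Longrightarrow> equiv {..<n} (e x)" "\<And>x. x \<in> X \<Longrightarrow> noncrossing_rel (e x)"
    and zero: "\<And>z :: nat \<Rightarrow> nat. (\<And>j. z j < 4) \<Longrightarrow> (\<Sum>x\<in>X. c x * of_bool (class_constant (e x) z)) = 0"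
    and x: "x \<in> X"
  shows "c x = 0"
proof (rule ccontr)
  assume "c x \<noteq> 0"
  define \<W> where "\<W> r = {W \<in> Pow {..<n}. class_constant r (\<lambda>j. j \<in> W)}" for r :: "nat rel"
  \<comment> \<open>The value of the test \<open>(u, D)\<close> at the relation \<open>e y\<close>;
    the cardinality is the positive factor left over from the character sum.\<close>
  define K where "K y u D = of_bool (class_constant (e y) u \<and> even_classes n (e y) D) * (of_nat (card (\<W> (e y))) :: complex)"
    for y D and u :: "nat \<Rightarrow> bool"
  have test: "(\<Sum>y\<in>X. c y * K y u D) = (0::complex)" for u :: "nat \<Rightarrow> bool" and D
  proof -
    let ?z = "\<lambda>W j. 2 * of_bool (u j) + of_bool (j \<in> W) :: nat"
    have "c y * K y u D = (\<Sum>W\<in>Pow {..<n}. (-1) ^ card (D \<inter> W) * (c y * of_bool (class_constant (e y) (?z W))))"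
      if "y \<in> X" for y
    proof -
      have "class_constant (e y) (?z W) \<longleftrightarrow>
          class_constant (e y) u \<and> class_constant (e y) (\<lambda>j. j \<in> W)" for W
      proof -
        have "?z W i = ?z W j \<longleftrightarrow> u i = u j \<and> (i \<in> W) = (j \<in> W)" for i j
          by (auto simp: of_bool_def)
        then show ?thesis unfolding class_constant_def by auto
      qed
      then have "(\<Sum>W\<in>Pow {..<n}. (-1) ^ card (D \<inter> W) * (c y * of_bool (class_constant (e y) (?z W)))) =
         c y * of_bool (class_constant (e y) u) *
          (\<Sum>W\<in>Pow {..<n}. if class_constant (e y) (\<lambda>j. j \<in> W) then (-1) ^ card (D \<inter> W) else 0)"
        unfolding sum_distrib_left by (intro sum.cong) simp_all
      also have "(\<Sum>W\<in>Pow {..<n}. if class_constant (e y) (\<lambda>j. j \<in> W) then (-1) ^ card (D \<inter> W) else 0)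
         = (\<Sum>W\<in>\<W> (e y). (-1) ^ card (D \<inter> W) :: complex)"
        unfolding \<W>_def by (intro sum.inter_filter[symmetric]) simp
      finally show ?thesis
        using sign_sum_even_classes[OF e(1)[OF that], of D] unfolding K_def \<W>_def by simp
    qed
    then have "(\<Sum>y\<in>X. c y * K y u D) = (\<Sum>W\<in>Pow {..<n}. \<Sum>y\<in>X.
        (-1) ^ card (D \<inter> W) * (c y * of_bool (class_constant (e y) (?z W))))"
      unfolding sum.swap[of _ "X"] by (intro sum.cong) auto
    also have "\<dots> = (\<Sum>W\<in>Pow {..<n}. (-1) ^ card (D \<inter> W) *
        (\<Sum>y\<in>X. c y * of_bool (class_constant (e y) (?z W))))"
      by (simp add: sum_distrib_left)
    also have "\<dots> = 0"
    proof (rule sum.neutral, rule ballI)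
      fix W
      have "(\<Sum>y\<in>X. c y * of_bool (class_constant (e y) (?z W))) = 0"
        by (rule zero) (simp add: of_bool_def)
      then show "(-1) ^ card (D \<inter> W) * (\<Sum>y\<in>X. c y * of_bool (class_constant (e y) (?z W))) = 0"
        by simp
    qed
    finally show ?thesis .
  qed
  \<comment> \<open>Choose a nonzero coefficient of minimal profile and test with the data of its
    own relation: any other relation passing this test has a smaller profile, hence coefficient
    zero.\<close>
  let ?lt = "inv_image (lexn less_than n) (\<lambda>y. profile n (e y))"
  have "wf ?lt" by (simp add: wf_lexn)
  moreover have "x \<in> {y \<in> X. c y \<noteq> 0}" using x \<open>c x \<noteq> 0\<close> by simp
  ultimately have "\<exists>p\<in>{y \<in> X. c y \<noteq> 0}. \<forall>y. (y, p) \<in> ?lt \<longrightarrow> y \<notin> {y \<in> X. c y \<noteq> 0}"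
    by (rule wf_eq_minimal[THEN iffD1, rule_format])
  then obtain p where p: "p \<in> X" "c p \<noteq> 0" and min: "\<And>y. (y, p) \<in> ?lt \<Longrightarrow> y \<in> X \<Longrightarrow> c y = 0"
    by auto
  let ?u = "level n (opener (e p)) (closer (e p))" and ?D = "mismatch n (opener (e p)) (closer (e p))"
  have "c y * K y ?u ?D = 0" if y: "y \<in> X - {p}" for y
  proof (cases "K y ?u ?D = 0")
    case False
    then have "class_constant (e y) ?u" "even_classes n (e y) ?D"
      unfolding K_def by (auto simp: of_bool_def split: if_splits)
    moreover have "e p \<noteq> e y" using inj p y by (auto dest: inj_onD)
    ultimately have "(y, p) \<in> ?lt"
      using profile_triangular[of n "e y" "e p"] e p y by simp
    then show ?thesis using min y by auto
  qed simp
  then have "(\<Sum>y\<in>X. c y * K y ?u ?D) = c p * K p ?u ?D"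
    by (subst sum.remove[OF X p(1)]) (simp add: sum.neutral)
  then have "K p ?u ?D = 0" using test p by simp
  moreover have "K p ?u ?D = of_nat (card (\<W> (e p)))"
    unfolding K_def using class_constant_level[OF e[OF p(1)]] even_classes_mismatch[OF e(1)[OF p(1)]]
    by simp
  moreover have "card (\<W> (e p)) > 0"
  proof -
    have "{} \<in> \<W> (e p)" by (simp add: \<W>_def class_constant_def)
    moreover have "finite (\<W> (e p))" by (simp add: \<W>_def)
    ultimately show ?thesis using card_gt_0_iff by blast
  qed
  ultimately show False by simp
qed

section \<open>Partitions as relations between labellings\<close>

definition label :: "index \<Rightarrow> index \<Rightarrow> point \<Rightarrow> nat" where
  "label i j = case_sum (nth i) (nth j)"

lemma label_simps [simp]: "label i j (Inl t) = i ! t" "label i j (Inr t) = j ! t"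
  by (simp_all add: label_def)

lemma compatible_iff:
  "compatible p i j \<longleftrightarrow> (\<forall>B\<in>blocks p. \<forall>x\<in>B. \<forall>y\<in>B. label i j x = label i j y)"
  by (simp add: compatible_def label_def)

lemma compatibleD:
  "compatible p i j \<Longrightarrow> B \<in> blocks p \<Longrightarrow> x \<in> B \<Longrightarrow> y \<in> B \<Longrightarrow> label i j x = label i j y"
  unfolding compatible_iff by blast

lemma idx_length: "i \<in> idx N k \<Longrightarrow> length i = k"
  by (simp add: idx_def)

lemma idx_nth: "i \<in> idx N k \<Longrightarrow> t < k \<Longrightarrow> i ! t < N"
  by (auto simp: idx_def dest!: nth_mem)

lemma finite_idx [simp]: "finite (idx N k)"
  using finite_lists_length_eq[of "{..<N}" k] by (simp add: idx_def conj_commute)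

lemma map_upt_in_idx: "(\<And>t. t < k \<Longrightarrow> f t < N) \<Longrightarrow> map f [0..<k] \<in> idx N k"
  by (auto simp: idx_def)

lemma label_less:
  "i \<in> idx N k \<Longrightarrow> j \<in> idx N l \<Longrightarrow> x \<in> points k l \<Longrightarrow> label i j x < N"
  by (auto simp: points_def idx_nth)

lemma all_partitionsD:
  assumes "p \<in> all_partitions"
  shows "B \<in> blocks p \<Longrightarrow> B \<subseteq> points (length (up p)) (length (low p))"
    and "B \<in> blocks p \<Longrightarrow> B \<noteq> {}"
    and "x \<in> points (length (up p)) (length (low p)) \<Longrightarrow> \<exists>B\<in>blocks p. x \<in> B"
    and "B \<in> blocks p \<Longrightarrow> B' \<in> blocks p \<Longrightarrow> x \<in> B \<Longrightarrow> x \<in> B' \<Longrightarrow> B = B'"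
  using assms by (auto simp: all_partitions_def partition_on_def disjoint_def)

lemma compatible_if_agrees:
  assumes p: "p \<in> all_partitions"
    and agree: "\<And>x. x \<in> points (length (up p)) (length (low p)) \<Longrightarrow> label i j x = f x"
    and const: "\<And>B x y. B \<in> blocks p \<Longrightarrow> x \<in> B \<Longrightarrow> y \<in> B \<Longrightarrow> f x = f y"
  shows "compatible p i j"
  unfolding compatible_iff
proof (intro ballI)
  fix B x y assume B: "B \<in> blocks p" "x \<in> B" "y \<in> B"
  then have "x \<in> points (length (up p)) (length (low p))" "y \<in> points (length (up p)) (length (low p))"
    using all_partitionsD(1)[OF p B(1)] by auto
  then show "label i j x = label i j y" using agree const[OF B] by simp
qed

text \<open>The indicator of a block is a compatible labelling with values 0 and 1, and it separates
  the block from all other points. So two labels suffice to read the blocks off the compatibility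
  relation.\<close>

lemma blocks_eq_compatible:
  assumes p: "p \<in> all_partitions" and N: "N \<ge> 2"
    and k: "k = length (up p)" and l: "l = length (low p)"
  shows "blocks p = (\<lambda>x. {y \<in> points k l. \<forall>i\<in>idx N k. \<forall>j\<in>idx N l.
     compatible p i j \<longrightarrow> label i j x = label i j y}) ` points k l"
proof -
  let ?C = "\<lambda>x. {y \<in> points k l. \<forall>i\<in>idx N k. \<forall>j\<in>idx N l.
     compatible p i j \<longrightarrow> label i j x = label i j y}"
  have *: "B = ?C x" if B: "B \<in> blocks p" and x: "x \<in> B" for B x
  proof
    show "B \<subseteq> ?C x"
      using all_partitionsD(1)[OF p B] B x unfolding k l compatible_iff by blast
    show "?C x \<subseteq> B"
    proof
      fix y assume y: "y \<in> ?C x"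
      let ?i = "map (\<lambda>t. of_bool (Inl t \<in> B)) [0..<k]" and ?j = "map (\<lambda>t. of_bool (Inr t \<in> B)) [0..<l]"
      have lab: "label ?i ?j z = of_bool (z \<in> B)" if "z \<in> points k l" for z
        using that by (auto simp: points_def)
      have ij: "?i \<in> idx N k" "?j \<in> idx N l"
        using N by (auto intro!: map_upt_in_idx simp: of_bool_def)
      have "compatible p ?i ?j" unfolding compatible_iff
      proof (intro ballI)
        fix B' u v assume B': "B' \<in> blocks p" and uv: "u \<in> B'" "v \<in> B'"
        then have "u \<in> B \<longleftrightarrow> v \<in> B" using all_partitionsD(4)[OF p] B by blast
        moreover have "u \<in> points k l" "v \<in> points k l"
          using all_partitionsD(1)[OF p B'] uv k l by auto
        ultimately show "label ?i ?j u = label ?i ?j v" using lab by simp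
      qed
      then have "label ?i ?j x = label ?i ?j y" using y ij by blast
      moreover have "x \<in> points k l" using all_partitionsD(1)[OF p B] x k l by auto
      ultimately show "y \<in> B" using lab x y by (simp add: of_bool_def split: if_splits)
    qed
  qed
  show ?thesis
  proof
    show "blocks p \<subseteq> ?C ` points k l"
    proof
      fix B assume B: "B \<in> blocks p"
      then obtain x where "x \<in> B" using all_partitionsD(2)[OF p] by blast
      then show "B \<in> ?C ` points k l"
        using *[OF B] all_partitionsD(1)[OF p B] k l by blast
    qed
    show "?C ` points k l \<subseteq> blocks p"
      using * all_partitionsD(3)[OF p] k l by fastforce
  qed
qed

text \<open>Turns identities between partitions into identities between relations on labellings,
  where vertical concatenation is ordinary composition.\<close>

lemma partition_eqI:
  assumes "p \<in> all_partitions" "q \<in> all_partitions" "N \<ge> 2" "up p = up q" "low p = low q"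
    and "\<And>i j. i \<in> idx N (length (up p)) \<Longrightarrow> j \<in> idx N (length (low p)) \<Longrightarrow>
       compatible p i j = compatible q i j"
  shows "p = q"
proof -
  have "blocks p = blocks q"
    unfolding blocks_eq_compatible[OF assms(1,3) refl refl] blocks_eq_compatible[OF assms(2,3) refl refl]
    using assms(4-6) by (intro image_cong Collect_cong) auto
  then show ?thesis using assms(4,5) by (cases p; cases q) auto
qed

lemma compatible_reflect: "compatible (reflect p) i j = compatible p j i"
proof -
  have "label i j (case_sum Inr Inl x) = label j i x" for x by (cases x) auto
  then show ?thesis by (simp add: compatible_iff reflect_def relabel_def)
qed

section \<open>Vertical concatenation as composition of relations\<close>

lemma up_reflect [simp]: "up (reflect p) = low p" "low (reflect p) = up p"
  by (simp_all add: reflect_def)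

lemma up_vconcat [simp]: "up (vconcat q p) = up p" "low (vconcat q p) = low q"
  by (simp_all add: vconcat_def)

text \<open>For multi-indices \<open>i\<close> and \<open>j\<close> of the right shape, the
  cardinality of this set is the entry in row \<open>j\<close> and column \<open>i\<close> of the
  product of the unnormalised maps.\<close>

definition middle :: "nat \<Rightarrow> partition \<Rightarrow> partition \<Rightarrow> index \<Rightarrow> index \<Rightarrow> index set" where
  "middle N q p i j = {m \<in> idx N (length (low p)). compatible p i m \<and> compatible q m j}"

lemma glue_linksI:
  "B \<in> blocks p \<Longrightarrow> x \<in> B \<Longrightarrow> y \<in> B \<Longrightarrow> (case_sum Top Mid x, case_sum Top Mid y) \<in> glue_links q p"
  "B \<in> blocks q \<Longrightarrow> x \<in> B \<Longrightarrow> y \<in> B \<Longrightarrow> (case_sum Mid Bot x, case_sum Mid Bot y) \<in> glue_links q p"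
  unfolding glue_links_def by blast+

lemma sym_glue_links: "sym (glue_links q p)"
  unfolding sym_def glue_links_def by blast

definition glued_label :: "index \<Rightarrow> index \<Rightarrow> index \<Rightarrow> glued \<Rightarrow> nat" where
  "glued_label i m j = case_glued (nth i) (nth m) (nth j)"

lemma glued_label_simps:
  "glued_label i m j (case_sum Top Mid x) = label i m x"
  "glued_label i m j (case_sum Mid Bot x) = label m j x"
  "glued_label i m j (case_sum Top Bot x) = label i j x"
  by (cases x; simp add: glued_label_def)+

definition outer_related :: "partition \<Rightarrow> partition \<Rightarrow> point rel" where
  "outer_related q p =
     {(x, y). x \<in> points (length (up p)) (length (low q)) \<and>
              y \<in> points (length (up p)) (length (low q)) \<and>
              (case_sum Top Bot x, case_sum Top Bot y) \<in> (glue_links q p)\<^sup>*}"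

lemma blocks_vconcat:
  "blocks (vconcat q p) = points (length (up p)) (length (low q)) // outer_related q p"
  by (simp add: vconcat_def outer_related_def)

text \<open>With a middle row, the three rows carry one labelling that is constant along each link,
  hence along chains of links.\<close>

lemma compatible_vconcat_if_middle:
  assumes m: "m \<in> middle N q p i j"
  shows "compatible (vconcat q p) i j"
proof -
  have 1: "glued_label i m j u = glued_label i m j v" if "(u, v) \<in> glue_links q p" for u v
    using that unfolding glue_links_def
  proof (elim UnE CollectE exE conjE)
    fix x y B assume "(u, v) = (case_sum Top Mid x, case_sum Top Mid y)" "B \<in> blocks p" "x \<in> B" "y \<in> B"
    moreover have "label i m x = label i m y"
      by (rule compatibleD[of p]) (use m \<open>B \<in> blocks p\<close> \<open>x \<in> B\<close> \<open>y \<in> B\<close> in \<open>auto simp: middle_def\<close>)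
    ultimately show ?thesis by (simp only: prod.inject glued_label_simps)
  next
    fix x y B assume "(u, v) = (case_sum Mid Bot x, case_sum Mid Bot y)" "B \<in> blocks q" "x \<in> B" "y \<in> B"
    moreover have "label m j x = label m j y"
      by (rule compatibleD[of q]) (use m \<open>B \<in> blocks q\<close> \<open>x \<in> B\<close> \<open>y \<in> B\<close> in \<open>auto simp: middle_def\<close>)
    ultimately show ?thesis by (simp only: prod.inject glued_label_simps)
  qed
  have *: "glued_label i m j u = glued_label i m j v" if "(u, v) \<in> (glue_links q p)\<^sup>*" for u v
    using that by (induction rule: rtrancl_induct) (simp_all add: 1)
  have "label i j x = label i j y" if "(x, y) \<in> outer_related q p" for x y
    using that *[of "case_sum Top Bot x" "case_sum Top Bot y"]
    by (simp only: outer_related_def mem_Collect_eq prod.case glued_label_simps)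
  then show ?thesis
    unfolding compatible_iff blocks_vconcat by (auto elim!: quotientE) metis
qed

text \<open>Every glued component that reaches an outer row passes on the common label of its outer
  points, which exists by compatibility.\<close>

lemma middle_nonempty:
  assumes p: "p \<in> all_partitions" and q: "q \<in> all_partitions" and pq: "low p = up q" and N: "N > 0"
    and i: "i \<in> idx N (length (up p))" and j: "j \<in> idx N (length (low q))"
    and c: "compatible (vconcat q p) i j"
  shows "middle N q p i j \<noteq> {}"
proof -
  let ?P = "points (length (up p)) (length (low q))"
  let ?L = "(glue_links q p)\<^sup>*"
  let ?e = "case_sum Top Bot"
  \<comment> \<open>Components without outer points, which become closed loops, receive 0; this is a
    label because \<open>N > 0\<close>.\<close>
  define z where "z g = (if \<exists>x\<in>?P. (?e x, g) \<in> ?L then label i j (SOME x. x \<in> ?P \<and> (?e x, g) \<in> ?L) else 0)" for g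
  have L: "sym ?L" using sym_glue_links sym_rtrancl by blast
  have uniq: "label i j x = label i j y"
    if "x \<in> ?P" "y \<in> ?P" "(?e x, g) \<in> ?L" "(?e y, g) \<in> ?L" for x y g
  proof -
    have "(?e x, ?e y) \<in> ?L" using that L by (meson rtrancl_trans symE)
    then have "x \<in> outer_related q p `` {x}" "y \<in> outer_related q p `` {x}"
      using that by (auto simp: outer_related_def)
    moreover have "outer_related q p `` {x} \<in> blocks (vconcat q p)"
      unfolding blocks_vconcat using that(1) by (rule quotientI)
    ultimately show ?thesis using c unfolding compatible_iff by blast
  qed
  have zx: "z g = label i j x" if "x \<in> ?P" "(?e x, g) \<in> ?L" for x g
  proof -
    have "(SOME x. x \<in> ?P \<and> (?e x, g) \<in> ?L) \<in> ?P \<and> (?e (SOME x. x \<in> ?P \<and> (?e x, g) \<in> ?L), g) \<in> ?L"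
      using that by (intro someI[where P = "\<lambda>x. x \<in> ?P \<and> (?e x, g) \<in> ?L"]) simp
    then show ?thesis
      unfolding z_def using that uniq[of "SOME x. x \<in> ?P \<and> (?e x, g) \<in> ?L" x g]
      by (metis (no_types, lifting))
  qed
  have zc: "z g = z h" if "(g, h) \<in> glue_links q p" for g h
  proof -
    have "(?e x, g) \<in> ?L \<longleftrightarrow> (?e x, h) \<in> ?L" for x
      using that sym_glue_links[of q p] by (meson rtrancl.rtrancl_into_rtrancl symE)
    then show ?thesis by (simp add: z_def)
  qed
  have zN: "z g < N" for g
  proof (cases "\<exists>x\<in>?P. (?e x, g) \<in> ?L")
    case True
    then show ?thesis using zx label_less[OF i j] by metis
  qed (use N in \<open>auto simp: z_def\<close>)
  let ?m = "map (\<lambda>t. z (Mid t)) [0..<length (low p)]"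
  have m: "?m \<in> idx N (length (low p))" by (rule map_upt_in_idx) (rule zN)
  have top: "z (Top t) = i ! t" if "t < length (up p)" for t
    using zx[of "Inl t" "Top t"] that by (auto simp: points_def)
  have bot: "z (Bot t) = j ! t" if "t < length (low q)" for t
    using zx[of "Inr t" "Bot t"] that by (auto simp: points_def)
  have "label i ?m x = z (case_sum Top Mid x)" if "x \<in> points (length (up p)) (length (low p))" for x
    using that top by (auto simp: points_def)
  then have "compatible p i ?m"
    by (rule compatible_if_agrees[OF p]) (blast intro: zc[OF glue_linksI(1)])+
  moreover have "label ?m j x = z (case_sum Mid Bot x)" if "x \<in> points (length (up q)) (length (low q))" for x
    using that bot pq by (auto simp: points_def)
  then have "compatible q ?m j"
    by (rule compatible_if_agrees[OF q]) (blast intro: zc[OF glue_linksI(2)])+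
  ultimately show ?thesis using m unfolding middle_def by blast
qed

text \<open>
  Labellings compatible with a partition are closed under \<open>a - b + c\<close> modulo \<open>N\<close>; both the regularity
  \<open>r r\<^sup>* r = r\<close> and the constancy of the number of loops follow from this.
\<close>

definition shift :: "nat \<Rightarrow> index \<Rightarrow> index \<Rightarrow> index \<Rightarrow> index" where
  "shift N a b c = map (\<lambda>t. (a ! t + (N - b ! t) + c ! t) mod N) [0..<length a]"

lemma shift_in_idx: "a \<in> idx N k \<Longrightarrow> N > 0 \<Longrightarrow> shift N a b c \<in> idx N k"
  unfolding shift_def by (simp add: idx_length map_upt_in_idx)

lemma shift_nth: "a \<in> idx N k \<Longrightarrow> t < k \<Longrightarrow> shift N a b c ! t = (a ! t + (N - b ! t) + c ! t) mod N"
  by (simp add: shift_def idx_length)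

lemma shift_cancel:
  assumes "a \<in> idx N k" "b \<in> idx N k"
  shows "shift N a a b = b" "shift N a b b = a"
proof -
  show "shift N a a b = b"
  proof (rule nth_equalityI)
    fix t assume "t < length (shift N a a b)"
    then have t: "t < k" using assms(1) by (simp add: shift_def idx_length)
    have "a ! t + (N - a ! t) + b ! t = b ! t + N" using idx_nth[OF assms(1) t] by simp
    then show "shift N a a b ! t = b ! t" using shift_nth[OF assms(1) t] idx_nth[OF assms(2) t] by simp
  qed (use assms in \<open>simp add: shift_def idx_length\<close>)
  have "(a ! t + (N - b ! t) + b ! t) mod N = a ! t" if "t < k" for t
  proof -
    have "a ! t + (N - b ! t) + b ! t = a ! t + N"
      using idx_nth[OF assms(2) that] by simp
    then show ?thesis using idx_nth[OF assms(1) that] by simp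
  qed
  then show "shift N a b b = a"
    using assms by (auto intro!: nth_equalityI simp: idx_length shift_def)
qed

lemma shift_shift:
  assumes "m \<in> idx N k" "a \<in> idx N k" "b \<in> idx N k"
  shows "shift N (shift N m a b) b a = m"
proof (rule nth_equalityI)
  fix t assume "t < length (shift N (shift N m a b) b a)"
  then have t: "t < k" using assms(1) by (simp add: shift_def idx_length)
  have N: "N > 0" using idx_nth[OF assms(1) t] by simp
  have lt: "a ! t < N" "b ! t < N" "m ! t < N" using assms idx_nth t by auto
  have "shift N (shift N m a b) b a ! t = ((m ! t + (N - a ! t) + b ! t) mod N + (N - b ! t) + a ! t) mod N"
    using shift_nth[OF shift_in_idx[OF assms(1) N] t] shift_nth[OF assms(1) t] by simp
  also have "\<dots> = (m ! t + (N - a ! t) + b ! t + (N - b ! t) + a ! t) mod N"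
    by (simp add: mod_add_left_eq add.assoc)
  also have "m ! t + (N - a ! t) + b ! t + (N - b ! t) + a ! t = m ! t + 2 * N" using lt by simp
  also have "\<dots> mod N = m ! t" using lt by simp
  finally show "shift N (shift N m a b) b a ! t = m ! t" .
qed (simp add: shift_def)

lemma compatible_shift:
  assumes p: "p \<in> all_partitions" and i: "i \<in> idx N (length (up p))" and j: "j \<in> idx N (length (low p))"
    and c: "compatible p i j" "compatible p i' j'" "compatible p i'' j''"
  shows "compatible p (shift N i i' i'') (shift N j j' j'')"
proof -
  have "label (shift N i i' i'') (shift N j j' j'') x =
      (label i j x + (N - label i' j' x) + label i'' j'' x) mod N"
    if "x \<in> points (length (up p)) (length (low p))" for x
    using that i j by (auto simp: points_def shift_nth)
  then show ?thesis using all_partitionsD(1)[OF p] c unfolding compatible_iff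
    by (smt (verit, best) subsetD)
qed

text \<open>With \<open>a\<close> and \<open>b\<close> chosen in the two sets,
  \<open>m - a + b\<close> modulo \<open>N\<close> carries one set onto the other. So the factor due
  to closed loops is the same for all outer labellings, and this is seen without counting
  loops.\<close>

lemma card_middle:
  assumes p: "p \<in> all_partitions" and q: "q \<in> all_partitions" and pq: "low p = up q" and N: "N > 0"
    and i: "i \<in> idx N (length (up p))" "i' \<in> idx N (length (up p))"
    and j: "j \<in> idx N (length (low q))" "j' \<in> idx N (length (low q))"
    and ne: "middle N q p i j \<noteq> {}" "middle N q p i' j' \<noteq> {}"
  shows "card (middle N q p i j) = card (middle N q p i' j')"
proof -
  have *: "shift N m a b \<in> middle N q p i' j'"
    if "m \<in> middle N q p i j" "a \<in> middle N q p i j" "b \<in> middle N q p i' j'"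
    and i: "i \<in> idx N (length (up p))" "i' \<in> idx N (length (up p))"
    and j: "j \<in> idx N (length (low q))" "j' \<in> idx N (length (low q))"
    for m a b i j i' j'
  proof -
    have m: "m \<in> idx N (length (low p))" "m \<in> idx N (length (up q))"
      using that pq by (auto simp: middle_def)
    have "compatible p (shift N i i i') (shift N m a b)"
      using that by (intro compatible_shift[OF p i(1) m(1)]) (auto simp: middle_def)
    moreover have "compatible q (shift N m a b) (shift N j j j')"
      using that by (intro compatible_shift[OF q m(2) j(1)]) (auto simp: middle_def)
    ultimately show ?thesis
      using shift_in_idx[OF m(1) N] shift_cancel i j by (simp add: middle_def)
  qed
  obtain a b where ab: "a \<in> middle N q p i j" "b \<in> middle N q p i' j'" using ne by blast
  have "bij_betw (\<lambda>m. shift N m a b) (middle N q p i j) (middle N q p i' j')"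
  proof (rule bij_betw_byWitness[where f' = "\<lambda>m. shift N m b a"])
    show "(\<lambda>m. shift N m a b) ` middle N q p i j \<subseteq> middle N q p i' j'"
      using * ab i j by blast
    show "(\<lambda>m. shift N m b a) ` middle N q p i' j' \<subseteq> middle N q p i j"
      using * ab i j by blast
  qed (use ab shift_shift in \<open>auto simp: middle_def\<close>)
  then show ?thesis by (rule bij_betw_same_card)
qed

section \<open>Products of the maps of partitions\<close>

lemma T_map_entry:
  "T_map N p j i = of_real (real N powr (- real (\<beta> p) / 2)) *
     of_bool (i \<in> idx N (length (up p)) \<and> j \<in> idx N (length (low p)) \<and> compatible p i j)"
  by (simp add: T_map_def T_unnormalised_def)

lemma zeros_in_idx: "N > 0 \<Longrightarrow> replicate k 0 \<in> idx N k"
  by (auto simp: idx_def)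

lemma compatible_zeros:
  assumes "p \<in> all_partitions" "k = length (up p)" "l = length (low p)"
  shows "compatible p (replicate k 0) (replicate l 0)"
proof -
  have "label (replicate k 0) (replicate l 0) x = 0" if "x \<in> points k l" for x
    using that by (auto simp: points_def)
  then show ?thesis using all_partitionsD(1)[OF assms(1)] assms unfolding compatible_iff
    by (metis subsetD)
qed

lemma zeros_in_middle:
  assumes "p \<in> all_partitions" "q \<in> all_partitions" "low p = up q" "N > 0"
  shows "replicate (length (low p)) 0 \<in>
    middle N q p (replicate (length (up p)) 0) (replicate (length (low q)) 0)"
  using assms compatible_zeros[OF assms(1) refl refl] compatible_zeros[OF assms(2) refl refl]
  by (simp add: middle_def zeros_in_idx)

text \<open>All nonempty middle sets have equal size, so the multiplicity can be read off at the
  zero labellings, where the zero middle row is always admissible.\<close>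

lemma T_unnormalised_comp:
  assumes p: "p \<in> all_partitions" and q: "q \<in> all_partitions" and pq: "low p = up q" and N: "N > 0"
  shows "mat_comp N (length (low p)) (T_unnormalised N q) (T_unnormalised N p) =
    tmat_scale (of_nat (card (middle N q p (replicate (length (up p)) 0) (replicate (length (low q)) 0))))
      (T_unnormalised N (vconcat q p))" (is "?l = tmat_scale (of_nat (card ?Z)) ?r")
proof (intro ext)
  fix j i
  show "?l j i = tmat_scale (of_nat (card ?Z)) ?r j i"
  proof (cases "i \<in> idx N (length (up p)) \<and> j \<in> idx N (length (low q))")
    case True
    then have "?l j i = (\<Sum>m\<in>idx N (length (low p)). of_bool (m \<in> middle N q p i j))"
      unfolding mat_comp_def T_unnormalised_def using pq
      by (intro sum.cong) (auto simp: middle_def)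
    also have "\<dots> = of_nat (card (middle N q p i j))"
    proof -
      have "idx N (length (low p)) \<inter> {m. m \<in> middle N q p i j} = middle N q p i j"
        by (auto simp: middle_def)
      then show ?thesis by (simp add: sum.If_cases of_bool_def)
    qed
    finally have l: "?l j i = of_nat (card (middle N q p i j))" .
    show ?thesis
    proof (cases "compatible (vconcat q p) i j")
      case c: True
      have ne: "middle N q p i j \<noteq> {}" using middle_nonempty[OF p q pq N] True c by blast
      have "card (middle N q p i j) = card ?Z"
        using True N ne zeros_in_middle[OF p q pq N]
        by (intro card_middle[OF p q pq N]) (auto intro: zeros_in_idx)
      then show ?thesis using l True c by (simp add: tmat_scale_def T_unnormalised_def)
    next
      case False
      then have "middle N q p i j = {}" using compatible_vconcat_if_middle by blast
      then show ?thesis using l False by (simp add: tmat_scale_def T_unnormalised_def)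
    qed
  qed (auto simp: mat_comp_def T_unnormalised_def tmat_scale_def intro!: sum.neutral)
qed

lemma mat_comp_scale:
  "mat_comp N k (tmat_scale a A) B = tmat_scale a (mat_comp N k A B)"
  "mat_comp N k A (tmat_scale a B) = tmat_scale a (mat_comp N k A B)"
  by (simp_all add: mat_comp_def tmat_scale_def sum_distrib_left mult_ac)

lemma T_map_eq:
  "T_map N p = tmat_scale (of_real (real N powr (- real (\<beta> p) / 2))) (T_unnormalised N p)"
  by (simp add: T_map_def tmat_scale_def)

lemma tmat_scale_scale [simp]: "tmat_scale a (tmat_scale b A) = tmat_scale (a * b) A"
  by (simp add: tmat_scale_def mult_ac)

text \<open>The loops and the three normalisations merge into one factor; its positivity is recorded
  so that it can be divided out.\<close>

lemma T_map_comp: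
  assumes p: "p \<in> all_partitions" and q: "q \<in> all_partitions" and pq: "low p = up q" and N: "N > 0"
  shows "\<exists>c>0. mat_comp N (length (low p)) (T_map N q) (T_map N p) =
    tmat_scale (of_real c) (T_map N (vconcat q p))"
proof -
  let ?\<nu> = "\<lambda>p. real N powr (- real (\<beta> p) / 2)"
  let ?Z = "middle N q p (replicate (length (up p)) 0) (replicate (length (low q)) 0)"
  have \<nu>: "?\<nu> p > 0" for p using N by simp
  have "finite ?Z" by (simp add: middle_def)
  then have Z: "card ?Z > 0" using zeros_in_middle[OF assms] card_gt_0_iff by blast
  let ?c = "?\<nu> q * ?\<nu> p * real (card ?Z) / ?\<nu> (vconcat q p)"
  have "mat_comp N (length (low p)) (T_map N q) (T_map N p) =
     tmat_scale (of_real ?c) (T_map N (vconcat q p))"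
    unfolding T_map_eq mat_comp_scale T_unnormalised_comp[OF assms] tmat_scale_scale
    using \<nu>[of "vconcat q p"] by (simp add: mult_ac)
  moreover have "?c > 0" using \<nu> Z by simp
  ultimately show ?thesis by blast
qed

section \<open>Projective partitions\<close>

definition lower_blocks :: "partition \<Rightarrow> point set set" where
  "lower_blocks p = {B \<in> blocks p. \<not> (\<exists>t. Inl t \<in> B)}"

text \<open>With the upper row labelled 0, blocks reaching that row are forced to be 0, and each
  remaining block takes any of \<open>N\<close> values.\<close>

lemma card_lower_labellings:
  assumes p: "p \<in> all_partitions" and N: "N > 0"
    and k: "k = length (up p)" and l: "l = length (low p)"
  shows "card {m \<in> idx N l. compatible p (replicate k 0) m} = N ^ card (lower_blocks p)"
proof -
  let ?z = "replicate k 0"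
  define blk where "blk x = (THE B. B \<in> blocks p \<and> x \<in> B)" for x
  have blk: "blk x = B" if "B \<in> blocks p" "x \<in> B" for x B
    unfolding blk_def using that all_partitionsD(4)[OF p] by (intro the_equality) blast+
  \<comment> \<open>\<open>?F\<close> spreads block values over the lower row, and \<open>?G\<close>
    reads them off one chosen point of each block; \<open>?G\<close> is restricted in order to be
    extensional.\<close>
  let ?F = "\<lambda>f. map (\<lambda>t. if blk (Inr t) \<in> lower_blocks p then f (blk (Inr t)) else 0) [0..<l]"
  let ?G = "\<lambda>m. \<lambda>B\<in>lower_blocks p. label ?z m (SOME x. x \<in> B)"
  have fin: "finite (lower_blocks p)"
  proof (rule finite_subset)
    show "lower_blocks p \<subseteq> Pow (points k l)"
      using all_partitionsD(1)[OF p] k l by (auto simp: lower_blocks_def)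
    show "finite (Pow (points k l))" by (simp add: points_def)
  qed
  have some: "(SOME x. x \<in> B) \<in> B" if "B \<in> lower_blocks p" for B
    using that all_partitionsD(2)[OF p] by (auto simp: lower_blocks_def some_in_eq)
  have low: "\<exists>t<l. x = Inr t" if "B \<in> lower_blocks p" "x \<in> B" for B x
    using that all_partitionsD(1)[OF p, of B] k l by (auto simp: lower_blocks_def points_def)
  have F: "label ?z (?F f) x = (if blk x \<in> lower_blocks p then f (blk x) else 0)" if x: "x \<in> points k l" for f x
  proof (cases x)
    case (Inl t)
    obtain B where B: "B \<in> blocks p" "x \<in> B" using all_partitionsD(3)[OF p] x k l by blast
    then have "blk x \<notin> lower_blocks p" using blk[OF B] Inl by (auto simp: lower_blocks_def)
    then show ?thesis using Inl x by (auto simp: points_def)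
  next
    case (Inr t)
    then show ?thesis using x by (auto simp: points_def)
  qed
  have "bij_betw ?F (lower_blocks p \<rightarrow>\<^sub>E {..<N}) {m \<in> idx N l. compatible p ?z m}"
  proof (rule bij_betw_byWitness[where f' = ?G])
    show "\<forall>f\<in>lower_blocks p \<rightarrow>\<^sub>E {..<N}. ?G (?F f) = f"
    proof
      fix f assume f: "f \<in> lower_blocks p \<rightarrow>\<^sub>E {..<N}"
      show "?G (?F f) = f"
      proof
        fix B
        show "?G (?F f) B = f B"
        proof (cases "B \<in> lower_blocks p")
          case True
          have "(SOME x. x \<in> B) \<in> points k l"
            using some[OF True] True all_partitionsD(1)[OF p] k l by (auto simp: lower_blocks_def)
          moreover have "blk (SOME x. x \<in> B) = B"
            using some[OF True] True by (intro blk) (auto simp: lower_blocks_def)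
          ultimately show ?thesis using F[of "SOME x. x \<in> B" f] True by simp
        next
          case False
          then show ?thesis using PiE_arb[OF f False] by simp
        qed
      qed
    qed
    show "\<forall>m\<in>{m \<in> idx N l. compatible p ?z m}. ?F (?G m) = m"
    proof
      fix m assume m: "m \<in> {m \<in> idx N l. compatible p ?z m}"
      show "?F (?G m) = m"
      proof (rule nth_equalityI)
        fix t assume "t < length (?F (?G m))"
        then have t: "t < l" by simp
        then have x: "Inr t \<in> points k l" by (simp add: points_def)
        then obtain B where B: "B \<in> blocks p" "Inr t \<in> B" using all_partitionsD(3)[OF p] k l by blast
        have c: "compatible p ?z m" using m by simp
        show "?F (?G m) ! t = m ! t"
        proof (cases "B \<in> lower_blocks p")
          case True
          then have "label ?z m (SOME x. x \<in> B) = label ?z m (Inr t)"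
            using compatibleD[OF c B(1) some[OF True] B(2)] by simp
          then show ?thesis using t True blk[OF B] by simp
        next
          case False
          then obtain s where s: "Inl s \<in> B" using B by (auto simp: lower_blocks_def)
          then have "s < k" using all_partitionsD(1)[OF p B(1)] k by (auto simp: points_def)
          then have "m ! t = 0" using compatibleD[OF c B(1) s B(2)] by simp
          then show ?thesis using t False blk[OF B] by simp
        qed
      qed (use m in \<open>auto simp: idx_length\<close>)
    qed
    show "?F ` (lower_blocks p \<rightarrow>\<^sub>E {..<N}) \<subseteq> {m \<in> idx N l. compatible p ?z m}"
    proof clarify
      fix f assume f: "f \<in> lower_blocks p \<rightarrow>\<^sub>E {..<N}"
      have "compatible p ?z (?F f)"
      proof (rule compatible_if_agrees[OF p])
        show "label ?z (?F f) x = (if blk x \<in> lower_blocks p then f (blk x) else 0)"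
          if "x \<in> points (length (up p)) (length (low p))" for x
          using F[of x f] that k l by simp
      qed (use blk in auto)
      moreover have "?F f \<in> idx N l"
        using f N by (intro map_upt_in_idx) (auto dest: PiE_mem)
      ultimately show "?F f \<in> idx N l \<and> compatible p ?z (?F f)" by simp
    qed
    show "?G ` {m \<in> idx N l. compatible p ?z m} \<subseteq> lower_blocks p \<rightarrow>\<^sub>E {..<N}"
    proof clarify
      fix m assume m: "m \<in> idx N l"
      have "label ?z m (SOME x. x \<in> B) \<in> {..<N}" if B: "B \<in> lower_blocks p" for B
        using low[OF B some[OF B]] idx_nth[OF m] by (auto simp: label_def)
      then show "?G m \<in> lower_blocks p \<rightarrow>\<^sub>E {..<N}" by simp
    qed
  qed
  then have "card (lower_blocks p \<rightarrow>\<^sub>E {..<N}) = card {m \<in> idx N l. compatible p ?z m}"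
    by (rule bij_betw_same_card)
  then show ?thesis using fin by (simp add: card_PiE)
qed

text \<open>Reflection fixes \<open>p\<close> and exchanges the blocks contained in the upper row
  with those contained in the lower row. Hence the exponent in the normalisation is an integer, the
  number of blocks in one row.\<close>

lemma non_through_projective:
  assumes p: "projective p"
  shows "\<beta> p = 2 * card (lower_blocks p)"
proof -
  have all: "p \<in> all_partitions" and refl: "reflect p = p" using p by (auto simp: projective_def)
  let ?s = "case_sum Inr Inl :: point \<Rightarrow> point"
  have bl: "blocks p = (`) ?s ` blocks p"
    using arg_cong[OF refl, of blocks] by (simp add: reflect_def relabel_def)
  have ss: "?s ` ?s ` B = B" for B
  proof -
    have "?s (?s x) = x" for x by (cases x) auto
    then show ?thesis by (simp add: image_image)
  qed
  have Inl: "Inl t \<in> ?s ` B \<longleftrightarrow> Inr t \<in> B" and Inr: "Inr t \<in> ?s ` B \<longleftrightarrow> Inl t \<in> B" for t B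
    by (auto simp: image_iff split: sum.splits) (metis old.sum.simps sum.exhaust)+
  let ?U = "{B \<in> blocks p. \<not> (\<exists>t. Inr t \<in> B)}"
  have mem: "?s ` B \<in> blocks p" if "B \<in> blocks p" for B using that bl by blast
  have U: "?U = (`) ?s ` lower_blocks p"
  proof
    show "(`) ?s ` lower_blocks p \<subseteq> ?U" using mem Inr by (auto simp: lower_blocks_def)
    show "?U \<subseteq> (`) ?s ` lower_blocks p"
    proof
      fix B assume B: "B \<in> ?U"
      then have "?s ` B \<in> lower_blocks p" using mem Inl by (auto simp: lower_blocks_def)
      then show "B \<in> (`) ?s ` lower_blocks p" using ss[of B] by (metis imageI)
    qed
  qed
  have "card ?U = card (lower_blocks p)"
    unfolding U by (intro card_image inj_on_inverseI[where g = "(`) ?s"]) (rule ss)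
  moreover have "{B \<in> blocks p. \<not> ((\<exists>i. Inl i \<in> B) \<and> (\<exists>j. Inr j \<in> B))} = lower_blocks p \<union> ?U"
    by (auto simp: lower_blocks_def)
  moreover have "finite (blocks p)"
  proof (rule finite_subset)
    show "blocks p \<subseteq> Pow (points (length (up p)) (length (low p)))"
      using all_partitionsD(1)[OF all] by auto
    show "finite (Pow (points (length (up p)) (length (low p))))" by (simp add: points_def)
  qed
  moreover have "lower_blocks p \<inter> ?U = {}"
  proof -
    have False if "B \<in> blocks p" "\<And>t. Inl t \<notin> B" "\<And>t. Inr t \<notin> B" for B
      using all_partitionsD(2)[OF all that(1)] that(2,3) by (metis equals0I sum.exhaust)
    then show ?thesis by (auto simp: lower_blocks_def)
  qed
  ultimately show ?thesis
    unfolding non_through_def by (simp add: card_Un_disjoint lower_blocks_def)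
qed

text \<open>Squaring the unnormalised map produces a factor \<open>N\<close> for each block
  contained in the lower row, exactly what the normalisation removes.\<close>

lemma T_map_projection:
  assumes p: "projective p" and N: "N > 0"
  shows "is_projection N (length (up p)) (T_map N p)"
proof -
  let ?k = "length (up p)" and ?n = "card (lower_blocks p)"
  have all: "p \<in> all_partitions" and low: "low p = up p" and pp: "vconcat p p = p" and refl: "reflect p = p"
    using p by (auto simp: projective_def)
  have sym: "compatible p i j = compatible p j i" for i j
    using compatible_reflect[of p i j] refl by simp
  \<comment> \<open>By the symmetry of \<open>p\<close> the two conditions on the middle row
    coincide.\<close>
  have "middle N p p (replicate ?k 0) (replicate ?k 0) = {m \<in> idx N ?k. compatible p (replicate ?k 0) m}"
    unfolding middle_def low using sym by blast
  then have card: "card (middle N p p (replicate ?k 0) (replicate ?k 0)) = N ^ ?n"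
    using card_lower_labellings[OF all N HOL.refl HOL.refl] unfolding low by (simp only:)
  have "mat_comp N ?k (T_unnormalised N p) (T_unnormalised N p) =
      tmat_scale (of_nat (N ^ ?n)) (T_unnormalised N p)"
    by (rule T_unnormalised_comp[OF all all low N, unfolded low pp card])
  moreover have "real N powr (- real (\<beta> p) / 2) = 1 / real (N ^ ?n)"
  proof -
    have "- real (\<beta> p) / 2 = - real ?n" unfolding non_through_projective[OF p] by simp
    then show ?thesis using N powr_realpow[of "real N" ?n] by (simp add: powr_minus_divide)
  qed
  ultimately have "mat_comp N ?k (T_map N p) (T_map N p) = T_map N p"
    using N by (simp add: T_map_eq mat_comp_scale)
  moreover have "T_map N p \<in> tensor_maps N ?k ?k"
    using low by (auto simp: tensor_maps_def T_map_entry)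
  moreover have "mat_adj (T_map N p) = T_map N p"
    using low sym by (auto simp: mat_adj_def T_map_entry fun_eq_iff)
  ultimately show ?thesis by (simp add: is_projection_def)
qed

section \<open>Linear independence of noncrossing partitions\<close>

definition boundary_rel :: "partition \<Rightarrow> nat rel" where
  "boundary_rel p = {(boundary_pos p x, boundary_pos p y) | x y B. B \<in> blocks p \<and> x \<in> B \<and> y \<in> B}"

lemma inj_on_boundary_pos: "inj_on (boundary_pos p) (points (length (up p)) (length (low p)))"
  by (auto simp: inj_on_def boundary_pos_def points_def)

lemma boundary_pos_less:
  "x \<in> points (length (up p)) (length (low p)) \<Longrightarrow> boundary_pos p x < length (up p) + length (low p)"
  by (auto simp: boundary_pos_def points_def)

lemma boundary_pos_surj:
  assumes "t < length (up p) + length (low p)"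
  obtains x where "x \<in> points (length (up p)) (length (low p))" "boundary_pos p x = t"
proof (cases "t < length (up p)")
  case True
  then show ?thesis using that[of "Inl t"] by (simp add: points_def boundary_pos_def)
next
  case False
  let ?s = "length (low p) - 1 - (t - length (up p))"
  show ?thesis using that[of "Inr ?s"] False assms by (simp add: points_def boundary_pos_def image_iff)
qed

lemma equiv_boundary_rel:
  assumes p: "p \<in> all_partitions"
  shows "equiv {..<length (up p) + length (low p)} (boundary_rel p)"
proof (rule equivI)
  show "boundary_rel p \<subseteq> {..<length (up p) + length (low p)} \<times> {..<length (up p) + length (low p)}"
    using all_partitionsD(1)[OF p] boundary_pos_less unfolding boundary_rel_def by blast
  show "refl_on {..<length (up p) + length (low p)} (boundary_rel p)"
  proof (rule refl_onI)
    fix t assume "t \<in> {..<length (up p) + length (low p)}"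
    then obtain x where x: "x \<in> points (length (up p)) (length (low p))" "boundary_pos p x = t"
      using boundary_pos_surj by blast
    then show "(t, t) \<in> boundary_rel p"
      using all_partitionsD(3)[OF p x(1)] unfolding boundary_rel_def by blast
  qed
  show "sym (boundary_rel p)" unfolding sym_def boundary_rel_def by blast
  show "trans (boundary_rel p)"
  proof (rule transI)
    fix a b c assume "(a, b) \<in> boundary_rel p" "(b, c) \<in> boundary_rel p"
    then obtain B x y B' y' z where
      B: "B \<in> blocks p" "x \<in> B" "y \<in> B" "a = boundary_pos p x" "b = boundary_pos p y"
      and B': "B' \<in> blocks p" "y' \<in> B'" "z \<in> B'" "b = boundary_pos p y'" "c = boundary_pos p z"
      unfolding boundary_rel_def by blast
    then have "y \<in> points (length (up p)) (length (low p))" "y' \<in> points (length (up p)) (length (low p))"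
      using all_partitionsD(1)[OF p] by blast+
    then have "y = y'" using inj_onD[OF inj_on_boundary_pos[of p], of y y'] B(5) B'(4) by simp
    then have "B = B'" using all_partitionsD(4)[OF p] B B' by blast
    then show "(a, c) \<in> boundary_rel p" using B B' unfolding boundary_rel_def by blast
  qed
qed

lemma noncrossing_boundary_rel:
  assumes "noncrossing p"
  shows "noncrossing_rel (boundary_rel p)"
  unfolding noncrossing_rel_def
proof (intro allI impI)
  fix a b c d assume lt: "a < b" "b < c" "c < d" and "(a, c) \<in> boundary_rel p" "(b, d) \<in> boundary_rel p"
  then obtain B x z B' y w where
    B: "B \<in> blocks p" "x \<in> B" "z \<in> B" "a = boundary_pos p x" "c = boundary_pos p z"
    and B': "B' \<in> blocks p" "y \<in> B'" "w \<in> B'" "b = boundary_pos p y" "d = boundary_pos p w"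
    unfolding boundary_rel_def by blast
  then have "B = B'" using assms lt unfolding noncrossing_def by blast
  then show "(a, b) \<in> boundary_rel p" using B B' unfolding boundary_rel_def by blast
qed

lemma compatible_iff_class_constant:
  assumes p: "p \<in> all_partitions"
    and z: "\<And>x. x \<in> points (length (up p)) (length (low p)) \<Longrightarrow> label i j x = z (boundary_pos p x)"
  shows "compatible p i j \<longleftrightarrow> class_constant (boundary_rel p) z"
proof
  assume c: "compatible p i j"
  show "class_constant (boundary_rel p) z"
    unfolding class_constant_def
  proof clarify
    fix a b assume "(a, b) \<in> boundary_rel p"
    then obtain B x y where B: "B \<in> blocks p" "x \<in> B" "y \<in> B" "a = boundary_pos p x" "b = boundary_pos p y"
      unfolding boundary_rel_def by blast
    then have "label i j x = z a" "label i j y = z b" using z all_partitionsD(1)[OF p B(1)] by auto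
    then show "z a = z b" using compatibleD[OF c B(1-3)] by simp
  qed
next
  assume "class_constant (boundary_rel p) z"
  then have "z (boundary_pos p x) = z (boundary_pos p y)" if "B \<in> blocks p" "x \<in> B" "y \<in> B" for B x y
    using that unfolding class_constant_def boundary_rel_def by blast
  then show "compatible p i j"
    by (intro compatible_if_agrees[OF p, where f = "\<lambda>x. z (boundary_pos p x)"] z)
qed

text \<open>Compatibility depends on the boundary relation alone, and labellings with two values
  already determine a partition.\<close>

lemma boundary_rel_inject:
  assumes p: "p \<in> all_partitions" and q: "q \<in> all_partitions"
    and ul: "up p = up q" "low p = low q" and eq: "boundary_rel p = boundary_rel q"
  shows "p = q"
proof (rule partition_eqI[OF p q order.refl ul])
  fix i j :: index assume i: "i \<in> idx 2 (length (up p))" and j: "j \<in> idx 2 (length (low p))"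
  \<comment> \<open>The lower row is reversed because the boundary runs through it from right to
    left.\<close>
  have lab: "label i j x = (i @ rev j) ! boundary_pos r x"
    if "x \<in> points (length (up r)) (length (low r))" "up r = up p" "low r = low p" for r x
    using that idx_length[OF i] idx_length[OF j]
    by (auto simp: points_def boundary_pos_def nth_append rev_nth)
  have *: "compatible r i j = class_constant (boundary_rel r) (\<lambda>t. (i @ rev j) ! t)"
    if "r \<in> all_partitions" "up r = up p" "low r = low p" for r
    by (rule compatible_iff_class_constant[OF that(1) lab[OF _ that(2,3)]])
  show "compatible p i j = compatible q i j"
    unfolding *[OF p refl refl] *[OF q ul(1)[symmetric] ul(2)[symmetric]] eq ..
qed

text \<open>Labellings of the boundary by values below 4 are read as matrix entries of the vanishing
  combination; the normalising factors are nonzero and are absorbed into the coefficients.\<close>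

lemma T_map_independent:
  assumes X: "finite X" and N: "N \<ge> 4"
    and all: "\<And>p. p \<in> X \<Longrightarrow> p \<in> all_partitions \<and> noncrossing p \<and> up p = w \<and> low p = w'"
    and zero: "(\<Sum>p\<in>X. tmat_scale (c p) (T_map N p)) = 0" and p: "p \<in> X"
  shows "c p = 0"
proof -
  let ?k = "length w" and ?l = "length w'"
  let ?\<nu> = "\<lambda>p. complex_of_real (real N powr (- real (\<beta> p) / 2))"
  have "c p * ?\<nu> p = 0"
  proof (rule noncrossing_independent[OF X, of boundary_rel "?k + ?l"])
    show "inj_on boundary_rel X"
      using all boundary_rel_inject by (metis inj_onI)
    show "equiv {..<?k + ?l} (boundary_rel x)" "noncrossing_rel (boundary_rel x)" if "x \<in> X" for x
      using equiv_boundary_rel noncrossing_boundary_rel all[OF that] by auto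
    fix z :: "nat \<Rightarrow> nat" assume z: "\<And>j. z j < 4"
    let ?i = "map z [0..<?k]" and ?j = "map (\<lambda>t. z (?k + (?l - 1 - t))) [0..<?l]"
    have ij: "?i \<in> idx N ?k" "?j \<in> idx N ?l"
      using z N by (auto intro!: map_upt_in_idx intro: less_le_trans)
    have "compatible q ?i ?j \<longleftrightarrow> class_constant (boundary_rel q) z" if "q \<in> X" for q
      using all[OF that] by (intro compatible_iff_class_constant) (auto simp: points_def boundary_pos_def)
    then have "(\<Sum>q\<in>X. c q * ?\<nu> q * of_bool (class_constant (boundary_rel q) z)) =
        (\<Sum>q\<in>X. tmat_scale (c q) (T_map N q) ?j ?i)"
      using all ij by (intro sum.cong) (auto simp: T_map_entry tmat_scale_def)
    also have "\<dots> = (\<Sum>q\<in>X. tmat_scale (c q) (T_map N q)) ?j ?i"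
      using X by (induction X rule: finite_induct) auto
    also have "\<dots> = 0" unfolding zero by simp
    finally show "(\<Sum>q\<in>X. c q * ?\<nu> q * of_bool (class_constant (boundary_rel q) z)) = 0" .
  qed (use p in simp)
  then show ?thesis using N by simp
qed

section \<open>The involutive monoid of endomorphisms of a word\<close>

definition id_part :: "colour list \<Rightarrow> partition" where
  "id_part w = Part w w ((\<lambda>t. {Inl t, Inr t}) ` {..<length w})"

lemma up_id_part [simp]: "up (id_part w) = w" "low (id_part w) = w"
  by (simp_all add: id_part_def)

lemma compatible_id_part:
  assumes "i \<in> idx N (length w)" "j \<in> idx N (length w)"
  shows "compatible (id_part w) i j \<longleftrightarrow> i = j"
proof -
  have "compatible (id_part w) i j \<longleftrightarrow> (\<forall>t<length w. i ! t = j ! t)"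
    unfolding compatible_iff id_part_def by (auto simp: eq_commute[of "j ! _"])
  then show ?thesis using assms by (auto simp: idx_length intro: nth_equalityI)
qed

lemma non_through_id_part: "\<beta> (id_part w) = 0"
proof -
  have "{B \<in> blocks (id_part w). \<not> ((\<exists>i. Inl i \<in> B) \<and> (\<exists>j. Inr j \<in> B))} = {}"
    by (auto simp: id_part_def)
  then show ?thesis unfolding non_through_def by (simp only: card.empty)
qed

lemma id_part_Cons: "id_part (c # w) = hconcat (id_part [c]) (id_part w)"
proof -
  have "{..<length (c # w)} = insert 0 (Suc ` {..<length w})"
    by (auto simp: image_iff less_Suc_eq_0_disj)
  then show ?thesis by (simp add: id_part_def hconcat_def relabel_def image_image lessThan_Suc)
qed

lemma reflect_reflect: "reflect (reflect p) = p"
proof -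
  have "case_sum Inr Inl (case_sum Inr Inl x) = x" for x :: point by (cases x) auto
  then show ?thesis by (cases p) (simp add: reflect_def relabel_def image_image)
qed

text \<open>Here \<open>N\<close> is the number of labels with which partitions are compared as
  relations; two are enough to separate them.\<close>

locale partition_category =
  fixes \<C> :: "partition set" and N :: nat
  assumes cat: "category_of_partitions \<C>" and N2: "N \<ge> 2"
begin

lemma N0: "N > 0" using N2 by simp

lemma all_partitions: "p \<in> \<C> \<Longrightarrow> p \<in> all_partitions"
  using cat by (auto simp: category_of_partitions_def)

lemma vconcat_closed: "p \<in> \<C> \<Longrightarrow> q \<in> \<C> \<Longrightarrow> low p = up q \<Longrightarrow> vconcat q p \<in> \<C>"
  using cat by (auto simp: category_of_partitions_def)

lemma hconcat_closed: "p \<in> \<C> \<Longrightarrow> q \<in> \<C> \<Longrightarrow> hconcat p q \<in> \<C>"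
  using cat by (auto simp: category_of_partitions_def)

lemma reflect_closed: "p \<in> \<C> \<Longrightarrow> reflect p \<in> \<C>"
  using cat by (auto simp: category_of_partitions_def)

text \<open>The black strand arises from the white one by turning its upper point down on the left
  and its lower point up on the right; each point changes colour once.\<close>

lemma id_part_letter: "id_part [c] \<in> \<C>"
proof (cases c)
  case White
  moreover have "id_part [White] = white_identity" by (simp add: id_part_def white_identity_def lessThan_Suc)
  ultimately show ?thesis using cat by (simp add: category_of_partitions_def)
next
  case Black
  have "white_identity \<in> \<C>" using cat by (simp add: category_of_partitions_def)
  then have 1: "rotate_left_down white_identity \<in> \<C>"
    using cat by (auto simp: category_of_partitions_def white_identity_def)
  then have "rotate_right_up (rotate_left_down white_identity) \<in> \<C>"
    using cat by (auto simp: category_of_partitions_def rotate_left_down_def)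
  moreover have "rotate_right_up (rotate_left_down white_identity) = id_part [Black]"
    by (auto simp: rotate_right_up_def rotate_right_down_def rotate_left_down_def white_identity_def
        reflect_def relabel_def id_part_def lessThan_Suc)
  ultimately show ?thesis using Black by simp
qed

lemma id_part_closed: "id_part w \<in> \<C>"
proof (induction w)
  case Nil
  \<comment> \<open>A rotated strand has an empty upper row, so composing it with its reflection
    leaves the empty partition, the loop being removed.\<close>
  let ?p = "rotate_left_down white_identity"
  have "white_identity \<in> \<C>" using cat by (simp add: category_of_partitions_def)
  then have "?p \<in> \<C>"
    using cat by (auto simp: category_of_partitions_def white_identity_def)
  then have "vconcat (reflect ?p) ?p \<in> \<C>"
    using reflect_closed vconcat_closed by simp
  moreover have "vconcat (reflect ?p) ?p = id_part []"
    by (simp add: vconcat_def id_part_def rotate_left_down_def white_identity_def points_def quotient_def reflect_def)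
  ultimately show ?case by simp
next
  case (Cons c w)
  then show ?case unfolding id_part_Cons[of c w] by (intro hconcat_closed id_part_letter)
qed

lemma compatible_vconcat:
  assumes "p \<in> \<C>" "q \<in> \<C>" "low p = up q"
    and "i \<in> idx N (length (up p))" "j \<in> idx N (length (low q))"
  shows "compatible (vconcat q p) i j \<longleftrightarrow>
    (\<exists>m\<in>idx N (length (low p)). compatible p i m \<and> compatible q m j)"
  using middle_nonempty[of p q N i j] compatible_vconcat_if_middle[of _ N q p i j]
    assms all_partitions N0 unfolding middle_def by auto

lemma partition_eqI':
  assumes "p \<in> \<C>" "q \<in> \<C>" "up p = up q" "low p = low q"
    and "\<And>i j. i \<in> idx N (length (up p)) \<Longrightarrow> j \<in> idx N (length (low p)) \<Longrightarrow>
       compatible p i j = compatible q i j"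
  shows "p = q"
  using assms by (intro partition_eqI[OF _ _ N2] all_partitions)

definition endos :: "colour list \<Rightarrow> partition set" where
  "endos w = {r \<in> \<C>. up r = w \<and> low r = w}"

lemma finite_endos: "finite (endos w)"
proof (rule finite_subset)
  let ?P = "points (length w) (length w)"
  show "endos w \<subseteq> Part w w ` Pow (Pow ?P)"
  proof
    fix r assume r: "r \<in> endos w"
    then have "blocks r \<subseteq> Pow ?P"
      using all_partitionsD(1)[of r] all_partitions by (fastforce simp: endos_def)
    moreover have "r = Part w w (blocks r)" using r by (cases r) (simp add: endos_def)
    ultimately show "r \<in> Part w w ` Pow (Pow ?P)" by blast
  qed
  show "finite (Part w w ` Pow (Pow ?P))" by (simp add: points_def)
qed

lemma compatible_endos:
  assumes "x \<in> endos w" "y \<in> endos w" "i \<in> idx N (length w)" "j \<in> idx N (length w)"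
  shows "compatible (vconcat x y) i j \<longleftrightarrow>
    (\<exists>m\<in>idx N (length w). compatible y i m \<and> compatible x m j)"
  using assms by (subst compatible_vconcat) (auto simp: endos_def)

lemma endos_closed:
  "x \<in> endos w \<Longrightarrow> y \<in> endos w \<Longrightarrow> vconcat x y \<in> endos w"
  "x \<in> endos w \<Longrightarrow> reflect x \<in> endos w"
  "id_part w \<in> endos w"
  by (auto simp: endos_def vconcat_closed reflect_closed id_part_closed)

lemma endos_eqI:
  assumes "p \<in> endos w" "q \<in> endos w"
    and "\<And>i j. i \<in> idx N (length w) \<Longrightarrow> j \<in> idx N (length w) \<Longrightarrow>
       compatible p i j = compatible q i j"
  shows "p = q"
  using assms by (intro partition_eqI') (auto simp: endos_def)

text \<open>Inherited from the composition of relations, which spares following chains of links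
  through three partitions.\<close>

lemma endos_assoc:
  assumes "x \<in> endos w" "y \<in> endos w" "z \<in> endos w"
  shows "vconcat (vconcat x y) z = vconcat x (vconcat y z)"
proof (rule endos_eqI)
  show "compatible (vconcat (vconcat x y) z) i j = compatible (vconcat x (vconcat y z)) i j"
    if "i \<in> idx N (length w)" "j \<in> idx N (length w)" for i j
    using assms that by (auto simp: compatible_endos[where w = w] endos_closed)
qed (use assms endos_closed in auto)

lemma endos_reflect_vconcat:
  assumes "x \<in> endos w" "y \<in> endos w"
  shows "reflect (vconcat x y) = vconcat (reflect y) (reflect x)"
proof (rule endos_eqI)
  show "compatible (reflect (vconcat x y)) i j = compatible (vconcat (reflect y) (reflect x)) i j"
    if "i \<in> idx N (length w)" "j \<in> idx N (length w)" for i j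
    using assms that by (auto simp: compatible_reflect compatible_endos[where w = w] endos_closed)
qed (use assms endos_closed in auto)

lemma endos_id:
  assumes "x \<in> endos w"
  shows "vconcat (id_part w) x = x" "vconcat x (id_part w) = x"
proof -
  show "vconcat (id_part w) x = x"
  proof (rule endos_eqI)
    show "compatible (vconcat (id_part w) x) i j = compatible x i j"
      if "i \<in> idx N (length w)" "j \<in> idx N (length w)" for i j
      using assms that by (auto simp: compatible_endos[where w = w] endos_closed compatible_id_part)
  qed (use assms endos_closed in auto)
  show "vconcat x (id_part w) = x"
  proof (rule endos_eqI)
    show "compatible (vconcat x (id_part w)) i j = compatible x i j"
      if "i \<in> idx N (length w)" "j \<in> idx N (length w)" for i j
      using assms that by (auto simp: compatible_endos[where w = w] endos_closed compatible_id_part)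
  qed (use assms endos_closed in auto)
qed

lemma endos_regular:
  assumes x: "x \<in> endos w"
  shows "vconcat (vconcat x (reflect x)) x = x"
proof (rule endos_eqI)
  fix i j assume ij: "i \<in> idx N (length w)" "j \<in> idx N (length w)"
  have "compatible (vconcat (vconcat x (reflect x)) x) i j \<longleftrightarrow>
      (\<exists>m\<in>idx N (length w). \<exists>m'\<in>idx N (length w). compatible x i m \<and> compatible x m' m \<and> compatible x m' j)"
    using x ij by (auto simp: compatible_endos[where w = w] endos_closed compatible_reflect)
  also have "\<dots> \<longleftrightarrow> compatible x i j"
  proof safe
    fix m m' assume m: "m \<in> idx N (length w)" "m' \<in> idx N (length w)"
      and c: "compatible x i m" "compatible x m' m" "compatible x m' j"
    \<comment> \<open>Two of the three labels cancel in each row: \<open>i - m' + m' = i\<close>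
      above and \<open>m - m + j = j\<close> below.\<close>
    have "compatible x (shift N i m' m') (shift N m m j)"
      using x ij m c by (intro compatible_shift all_partitions) (auto simp: endos_def)
    then show "compatible x i j" using shift_cancel ij m by metis
  qed (use ij in blast)
  finally show "compatible (vconcat (vconcat x (reflect x)) x) i j = compatible x i j" .
qed (use x endos_closed in auto)

end

section \<open>Matrices indexed by multi-indices\<close>

definition id_mat :: "nat \<Rightarrow> nat \<Rightarrow> tmat" where
  "id_mat N k = (\<lambda>j i. of_bool (j = i \<and> i \<in> idx N k))"

lemma mat_comp_assoc:
  "mat_comp N k (mat_comp N k A B) C = mat_comp N k A (mat_comp N k B C)"
proof (intro ext)
  fix j i
  have "(\<Sum>m\<in>idx N k. (\<Sum>l\<in>idx N k. A j l * B l m) * C m i) =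
      (\<Sum>m\<in>idx N k. \<Sum>l\<in>idx N k. A j l * (B l m * C m i))"
    by (simp add: sum_distrib_right mult.assoc)
  also have "\<dots> = (\<Sum>l\<in>idx N k. \<Sum>m\<in>idx N k. A j l * (B l m * C m i))"
    by (rule sum.swap)
  finally show "mat_comp N k (mat_comp N k A B) C j i = mat_comp N k A (mat_comp N k B C) j i"
    by (simp add: mat_comp_def sum_distrib_left)
qed

lemma mat_comp_add:
  "mat_comp N k (A + B) C = mat_comp N k A C + mat_comp N k B C"
  "mat_comp N k C (A + B) = mat_comp N k C A + mat_comp N k C B"
  by (simp_all add: mat_comp_def fun_eq_iff distrib_left distrib_right sum.distrib)

lemma mat_comp_diff:
  "mat_comp N k (A - B) C = mat_comp N k A C - mat_comp N k B C"
  "mat_comp N k C (A - B) = mat_comp N k C A - mat_comp N k C B"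
  by (simp_all add: mat_comp_def fun_eq_iff left_diff_distrib right_diff_distrib sum_subtractf)

lemma mat_comp_0 [simp]: "mat_comp N k 0 A = 0" "mat_comp N k A 0 = 0"
  by (simp_all add: mat_comp_def fun_eq_iff)

lemma mat_comp_sum:
  "mat_comp N k (\<Sum>x\<in>X. f x) A = (\<Sum>x\<in>X. mat_comp N k (f x) A)"
  "mat_comp N k A (\<Sum>x\<in>X. f x) = (\<Sum>x\<in>X. mat_comp N k A (f x))"
  by (induction X rule: infinite_finite_induct) (simp_all add: mat_comp_add)

lemma mat_comp_id:
  assumes "A \<in> tensor_maps N k k"
  shows "mat_comp N k (id_mat N k) A = A" "mat_comp N k A (id_mat N k) = A"
proof -
  show "mat_comp N k (id_mat N k) A = A"
  proof (intro ext)
    fix j i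
    have "mat_comp N k (id_mat N k) A j i = (\<Sum>m\<in>idx N k. if m = j then A j i else 0)"
      unfolding mat_comp_def id_mat_def by (intro sum.cong) auto
    then show "mat_comp N k (id_mat N k) A j i = A j i" using assms by (auto simp: tensor_maps_def)
  qed
  show "mat_comp N k A (id_mat N k) = A"
  proof (intro ext)
    fix j i
    have "mat_comp N k A (id_mat N k) j i = (\<Sum>m\<in>idx N k. if m = i then A j i else 0)"
      unfolding mat_comp_def id_mat_def by (intro sum.cong) auto
    then show "mat_comp N k A (id_mat N k) j i = A j i" using assms by (auto simp: tensor_maps_def)
  qed
qed

lemma sum_tmat_apply: "(\<Sum>x\<in>X. f x) j i = (\<Sum>x\<in>X. f x j i)" for f :: "'b \<Rightarrow> tmat"
  by (induction X rule: infinite_finite_induct) auto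

lemma mat_adj_simps [simp]:
  "mat_adj (mat_adj A) = A"
  "mat_adj (A + B) = mat_adj A + mat_adj B"
  "mat_adj (A - B) = mat_adj A - mat_adj B"
  "mat_adj 0 = 0"
  by (simp_all add: mat_adj_def fun_eq_iff)

lemma mat_adj_comp: "mat_adj (mat_comp N k A B) = mat_comp N k (mat_adj B) (mat_adj A)"
  by (simp add: mat_adj_def mat_comp_def fun_eq_iff mult.commute)

lemma mat_adj_sum: "mat_adj (\<Sum>x\<in>X. f x) = (\<Sum>x\<in>X. mat_adj (f x))"
  by (simp add: mat_adj_def fun_eq_iff sum_tmat_apply)

lemma subspace_tensor_maps: "tmat.subspace (tensor_maps N k l)"
  by (auto simp: tmat.subspace_def tensor_maps_def tmat_scale_def)

lemma tensor_maps_comp: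
  "A \<in> tensor_maps N k k \<Longrightarrow> B \<in> tensor_maps N k k \<Longrightarrow> mat_comp N k A B \<in> tensor_maps N k k"
  by (auto simp: tensor_maps_def mat_comp_def)

lemma id_mat_in_tensor_maps: "id_mat N k \<in> tensor_maps N k k"
  by (auto simp: tensor_maps_def id_mat_def)

section \<open>Positivity, supports and suprema of projections\<close>

text \<open>The diagonal entry at \<open>j\<close> is the sum of the squared moduli of the entries
  in row \<open>j\<close> of all the matrices.\<close>

lemma sum_comp_adj_eq_0:
  assumes X: "finite X" and zero: "(\<Sum>x\<in>X. mat_comp N k (f x) (mat_adj (f x))) = 0"
    and x: "x \<in> X" and f: "f x \<in> tensor_maps N k k"
  shows "f x = 0"
proof (intro ext)
  fix j i
  have "(\<Sum>x\<in>X. mat_comp N k (f x) (mat_adj (f x))) j j = (\<Sum>x\<in>X. mat_comp N k (f x) (mat_adj (f x)) j j)"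
    by (rule sum_tmat_apply)
  also have "\<dots> = of_real (\<Sum>x\<in>X. \<Sum>m\<in>idx N k. (cmod (f x j m))\<^sup>2)"
    by (simp add: mat_comp_def mat_adj_def flip: complex_norm_square)
  finally have "complex_of_real (\<Sum>x\<in>X. \<Sum>m\<in>idx N k. (cmod (f x j m))\<^sup>2) = 0"
    unfolding zero by simp
  then have "(\<Sum>x\<in>X. \<Sum>m\<in>idx N k. (cmod (f x j m))\<^sup>2) = 0"
    by (simp only: of_real_eq_0_iff)
  then have "(\<Sum>m\<in>idx N k. (cmod (f x j m))\<^sup>2) = 0"
    using X x by (subst (asm) sum_nonneg_eq_0_iff) (auto intro: sum_nonneg)
  then have "f x j m = 0" if "m \<in> idx N k" for m
    using that by (subst (asm) sum_nonneg_eq_0_iff) auto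
  then show "f x j i = 0 j i" using f by (cases "i \<in> idx N k") (auto simp: tensor_maps_def)
qed

text \<open>As \<open>A\<close> is self-adjoint, the hypothesis makes the product of the adjoint of
  \<open>AX\<close> with \<open>AX\<close> vanish, and positivity gives
  \<open>AX = 0\<close>.\<close>

lemma self_adjoint_cancel:
  assumes A: "mat_adj A = A" and AAX: "mat_comp N k A (mat_comp N k A X) = 0"
    and maps: "A \<in> tensor_maps N k k" "X \<in> tensor_maps N k k"
  shows "mat_comp N k A X = 0"
proof -
  let ?Y = "mat_adj (mat_comp N k A X)"
  have "mat_comp N k ?Y (mat_adj ?Y) = 0"
    by (simp add: mat_adj_comp A mat_comp_assoc AAX)
  moreover have "?Y \<in> tensor_maps N k k"
    using tensor_maps_comp[OF maps] by (auto simp: tensor_maps_def mat_adj_def)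
  ultimately have "?Y = 0" using sum_comp_adj_eq_0[of "{()}" N k "\<lambda>_. ?Y" "()"] by simp
  then have "mat_adj ?Y = 0" by (simp only: mat_adj_simps)
  then show ?thesis by (simp only: mat_adj_simps)
qed

lemma tensor_maps_finite_dimensional:
  "\<exists>E. finite E \<and> tensor_maps N k k \<subseteq> tmat.span E"
proof -
  let ?u = "\<lambda>(b, a). (\<lambda>j i. of_bool (j = b \<and> i = a)) :: tmat"
  let ?I = "idx N k \<times> idx N k"
  have "A \<in> tmat.span (?u ` ?I)" if A: "A \<in> tensor_maps N k k" for A
  proof -
    have "A = (\<Sum>x\<in>?I. tmat_scale (A (fst x) (snd x)) (?u x))"
    proof (intro ext)
      fix j i
      have "(\<Sum>x\<in>?I. tmat_scale (A (fst x) (snd x)) (?u x)) j i =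
          (\<Sum>x\<in>?I. tmat_scale (A (fst x) (snd x)) (?u x) j i)"
        by (rule sum_tmat_apply)
      also have "\<dots> = (\<Sum>x\<in>?I. if x = (j, i) then A j i else 0)"
        by (intro sum.cong) (auto simp: tmat_scale_def)
      also have "\<dots> = A j i" using A by (auto simp: tensor_maps_def)
      finally show "A j i = (\<Sum>x\<in>?I. tmat_scale (A (fst x) (snd x)) (?u x)) j i" by simp
    qed
    then show ?thesis
      by (metis (no_types, lifting) imageI tmat.span_base tmat.span_scale tmat.span_sum)
  qed
  then show ?thesis by (intro exI[of _ "?u ` ?I"]) auto
qed

text \<open>There are more than \<open>card E\<close> vectors in the span of \<open>E\<close>.
  Linear dependence is a property of sets, so a repeated value of \<open>f\<close> is treated apart,
  with coefficients 1 and -1.\<close>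

lemma finite_dimensional_relation:
  fixes f :: "nat \<Rightarrow> tmat"
  assumes E: "finite E" and f: "\<And>i. f i \<in> tmat.span E"
  shows "\<exists>n c. (\<Sum>i\<le>n. tmat_scale (c i) (f i)) = 0 \<and> (\<exists>i\<le>n. c i \<noteq> 0)"
proof (cases "inj_on f {..card E}")
  case False
  then obtain i j where ij: "i \<le> card E" "j \<le> card E" "i \<noteq> j" "f i = f j" by (auto simp: inj_on_def)
  let ?c = "\<lambda>l. if l = i then 1 else if l = j then -1 else 0 :: complex"
  have "(\<Sum>l\<le>card E. tmat_scale (?c l) (f l)) = (\<Sum>l\<in>{i, j}. tmat_scale (?c l) (f l))"
    using ij by (intro sum.mono_neutral_right) auto
  also have "\<dots> = 0" using ij by (simp add: tmat_scale_def fun_eq_iff)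
  finally show ?thesis using ij(1) by (intro exI[of _ "card E"] exI[of _ ?c]) auto
next
  case True
  have "tmat.dependent (f ` {..card E})"
  proof (rule ccontr)
    assume "\<not> tmat.dependent (f ` {..card E})"
    then have "card (f ` {..card E}) \<le> card E"
      using tmat.independent_span_bound[OF E] f by blast
    then show False using card_image[OF True] by simp
  qed
  then obtain u where u: "\<exists>v\<in>f ` {..card E}. u v \<noteq> 0" "(\<Sum>v\<in>f ` {..card E}. tmat_scale (u v) v) = 0"
    using tmat.dependent_finite[of "f ` {..card E}"] by auto
  then have "(\<Sum>i\<le>card E. tmat_scale (u (f i)) (f i)) = 0"
    by (simp add: sum.reindex[OF True])
  then show ?thesis using u(1) by (intro exI[of _ "card E"] exI[of _ "\<lambda>i. u (f i)"]) auto
qed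

text \<open>
  The support projection is obtained as a polynomial in \<open>A\<close> without constant term: cancel the lowest
  power of \<open>A\<close> in a linear relation between its powers.
\<close>

lemma support_projection:
  assumes A: "A \<in> V" "mat_adj A = A" and V: "tmat.subspace V" "V \<subseteq> tensor_maps N k k"
    and closed: "\<And>X Y. X \<in> V \<Longrightarrow> Y \<in> V \<Longrightarrow> mat_comp N k X Y \<in> V"
  shows "\<exists>Q\<in>V. is_projection N k Q \<and> mat_comp N k Q A = A \<and> (\<exists>Y. Q = mat_comp N k A Y)"
proof -
  let ?m = "mat_comp N k"
  \<comment> \<open>\<open>pw n\<close> is the power \<open>n + 1\<close> of \<open>A\<close>, so
    that it lies in \<open>V\<close>, which need not contain the identity. This shifts the exponents
    below by one.\<close>
  define pw where "pw n = (?m A ^^ n) A" for n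
  have pw_0: "pw 0 = A" and pw_Suc: "pw (Suc n) = ?m A (pw n)" for n by (simp_all add: pw_def)
  have pwV: "pw n \<in> V" for n by (induction n) (simp_all add: pw_0 pw_Suc A closed)
  have tm: "X \<in> tensor_maps N k k" if "X \<in> V" for X using that V(2) by blast
  have pw_add: "pw (Suc (m + n)) = ?m (pw m) (pw n)" for m n
    by (induction m) (simp_all add: pw_0 pw_Suc mat_comp_assoc)
  have commute: "?m A (pw n) = ?m (pw n) A" for n
  proof (induction n)
    case (Suc n)
    then show ?case unfolding pw_Suc by (metis mat_comp_assoc)
  qed (simp add: pw_0)
  obtain E where E: "finite E" "tensor_maps N k k \<subseteq> tmat.span E"
    using tensor_maps_finite_dimensional by blast
  then obtain n c where rel: "(\<Sum>i\<le>n. tmat_scale (c i) (pw i)) = 0" and nz: "\<exists>i\<le>n. c i \<noteq> 0"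
    using finite_dimensional_relation[of E pw] pwV tm by blast
  define m where "m = (LEAST i. i \<le> n \<and> c i \<noteq> 0)"
  have m: "m \<le> n" "c m \<noteq> 0" using LeastI_ex[OF nz[simplified]] unfolding m_def by auto
  have low: "c i = 0" if "i < m" for i
    using not_less_Least[of i "\<lambda>i. i \<le> n \<and> c i \<noteq> 0"] that m(1) unfolding m_def by auto
  \<comment> \<open>When \<open>pw m\<close> is formally divided out of the relation, the constant
    term \<open>c m\<close> remains and \<open>Z\<close> collects the other terms; so the product of
    \<open>pw m\<close> with \<open>W\<close> is zero.\<close>
  define Z where "Z = (\<Sum>i\<in>{m<..n}. tmat_scale (c i) (pw (i - Suc m)))"
  have ZV: "Z \<in> V" unfolding Z_def
    by (intro tmat.subspace_sum tmat.subspace_scale V(1) pwV)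
  define W where "W = tmat_scale (c m) (id_mat N k) + Z"
  have W: "W \<in> tensor_maps N k k" unfolding W_def
    by (intro tmat.subspace_add tmat.subspace_scale subspace_tensor_maps id_mat_in_tensor_maps tm ZV)
  have mulW: "?m X W = tmat_scale (c m) X + ?m X Z" if "X \<in> V" for X
    unfolding W_def by (simp add: mat_comp_add mat_comp_scale mat_comp_id tm[OF that])
  have "?m (pw m) Z = (\<Sum>i\<in>{m<..n}. tmat_scale (c i) (pw i))"
    unfolding Z_def mat_comp_sum mat_comp_scale
    by (intro sum.cong) (auto simp: pw_add[symmetric])
  then have "?m (pw m) W = (\<Sum>i\<in>insert m {m<..n}. tmat_scale (c i) (pw i))"
    by (simp add: mulW pwV)
  also have "\<dots> = (\<Sum>i\<le>n. tmat_scale (c i) (pw i))"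
    using m(1) low by (intro sum.mono_neutral_left) (auto simp: not_less_iff_gr_or_eq tmat_scale_def zero_fun_def)
  finally have pW: "?m (pw m) W = 0" using rel by simp
  \<comment> \<open>Self-adjointness lets the powers of \<open>A\<close> be cancelled down to the
    first; there the relation says that \<open>- Z / c m\<close> is a right unit for
    \<open>A\<close>.\<close>
  have "?m A W = 0" if "?m (pw j) W = 0" for j
    using that
  proof (induction j)
    case (Suc j)
    have "?m (pw j) W = 0"
    proof (cases j)
      case 0
      show ?thesis
        using self_adjoint_cancel[OF A(2) _ tm[OF A(1)] W] Suc.prems
        unfolding 0 pw_0 pw_Suc mat_comp_assoc by blast
    next
      case (Suc j')
      show ?thesis
        using self_adjoint_cancel[OF A(2) _ tm[OF A(1)] tensor_maps_comp[OF tm[OF pwV[of j']] W]] Suc.prems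
        unfolding \<open>j = Suc j'\<close> pw_Suc mat_comp_assoc by blast
    qed
    then show ?case by (rule Suc.IH)
  qed (simp add: pw_0)
  then have AW: "tmat_scale (c m) A + ?m A Z = 0" using mulW[OF A(1)] pW by metis
  define Q where "Q = tmat_scale (- 1 / c m) Z"
  have QV: "Q \<in> V" unfolding Q_def by (intro tmat.subspace_scale V(1) ZV)
  have AQ: "?m A Q = A"
  proof -
    have "?m A Z = tmat_scale (- c m) A"
      using AW by (simp add: add_eq_0_iff tmat_scale_def fun_eq_iff)
    then show ?thesis
      unfolding Q_def mat_comp_scale using m(2) by (simp only: tmat_scale_scale) (simp add: tmat_scale_def)
  qed
  have "?m A Z = ?m Z A"
    unfolding Z_def mat_comp_sum mat_comp_scale commute ..
  then have QA: "?m Q A = A" using AQ unfolding Q_def mat_comp_scale by (simp only:)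
  have "\<exists>Y. pw j = ?m A Y" for j
    by (cases j) (use mat_comp_id(2)[OF tm[OF A(1)]] in \<open>auto simp: pw_0 pw_Suc intro: sym\<close>)
  then obtain R where R: "pw j = ?m A (R j)" for j by metis
  have Z: "Z = ?m A (\<Sum>i\<in>{m<..n}. tmat_scale (c i) (R (i - Suc m)))"
    unfolding Z_def mat_comp_sum mat_comp_scale R ..
  obtain Y where Y: "Q = ?m A Y"
    unfolding Q_def by (subst (asm) Z) (simp only: mat_comp_scale(2)[symmetric])
  \<comment> \<open>The adjoint of \<open>Q\<close> fixes \<open>A\<close>, and \<open>Q\<close> has
    \<open>A\<close> as a left factor, so the adjoint of \<open>Q\<close> times \<open>Q\<close> is
    \<open>Q\<close>. Self-adjointness and idempotency follow together.\<close>
  have "?m (mat_adj Q) A = A" using arg_cong[OF AQ, of mat_adj] by (simp add: mat_adj_comp A)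
  then have QQ: "?m (mat_adj Q) Q = Q" using Y by (metis mat_comp_assoc)
  then have adj: "mat_adj Q = Q" by (metis mat_adj_comp mat_adj_simps(1))
  then have "is_projection N k Q" using QQ tm[OF QV] by (simp add: is_projection_def)
  then show ?thesis using QV QA Y by blast
qed

text \<open>The supremum is the support of the sum of the projections. It has this sum as a left
  factor, so any matrix \<open>Q'\<close> fixing all the projections fixes it too.\<close>

lemma proj_sup_exists:
  assumes S: "finite S" "S \<subseteq> V" "\<And>P. P \<in> S \<Longrightarrow> is_projection N k P"
    and V: "tmat.subspace V" "V \<subseteq> tensor_maps N k k"
    and closed: "\<And>X Y. X \<in> V \<Longrightarrow> Y \<in> V \<Longrightarrow> mat_comp N k X Y \<in> V"
  shows "proj_sup N k S \<in> V" "is_projection N k (proj_sup N k S)"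
    "\<And>P. P \<in> S \<Longrightarrow> mat_comp N k (proj_sup N k S) P = P"
    "\<And>Q'. (\<And>P. P \<in> S \<Longrightarrow> mat_comp N k Q' P = P) \<Longrightarrow>
       mat_comp N k Q' (proj_sup N k S) = proj_sup N k S"
proof -
  let ?m = "mat_comp N k"
  let ?A = "\<Sum>P\<in>S. P"
  have adj: "mat_adj P = P" "?m P P = P" "P \<in> tensor_maps N k k" if "P \<in> S" for P
    using S(3)[OF that] by (auto simp: is_projection_def)
  have AV: "?A \<in> V" using S(2) by (intro tmat.subspace_sum V(1)) auto
  have Aadj: "mat_adj ?A = ?A" unfolding mat_adj_sum using adj by (intro sum.cong) auto
  obtain Q Y where Q: "Q \<in> V" "is_projection N k Q" "?m Q ?A = ?A" "Q = ?m ?A Y"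
    using support_projection[OF AV Aadj V closed] by blast
  have Qp: "mat_adj Q = Q" "?m Q Q = Q" "Q \<in> tensor_maps N k k" using Q(2) by (auto simp: is_projection_def)
  have min: "?m Q' Q = Q" if "\<And>P. P \<in> S \<Longrightarrow> ?m Q' P = P" for Q'
  proof -
    have "?m Q' ?A = ?A" unfolding mat_comp_sum using that by (intro sum.cong) auto
    then show ?thesis unfolding Q(4) mat_comp_assoc[symmetric] by simp
  qed
  have ub: "?m Q P = P" if P: "P \<in> S" for P
  proof -
    have AQ: "?m ?A Q = ?A" using arg_cong[OF Q(3), of mat_adj] by (simp add: mat_adj_comp Aadj Qp)
    \<comment> \<open>The defects \<open>P - QP\<close> times their adjoints add up to the sum of
      the projections compressed by \<open>1 - Q\<close> on both sides, which is zero.\<close>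
    have "(\<Sum>P\<in>S. ?m (P - ?m Q P) (mat_adj (P - ?m Q P))) = (\<Sum>P\<in>S. (P - ?m P Q) - (?m Q P - ?m Q (?m P Q)))"
    proof (intro sum.cong refl)
      fix P assume P: "P \<in> S"
      have "?m (P - ?m Q P) (mat_adj (P - ?m Q P)) = ?m (P - ?m Q P) (P - ?m P Q)"
        by (simp add: mat_adj_comp adj[OF P] Qp)
      also have "\<dots> = (?m P P - ?m (?m P P) Q) - (?m Q (?m P P) - ?m Q (?m (?m P P) Q))"
        by (simp add: mat_comp_diff mat_comp_assoc)
      finally show "?m (P - ?m Q P) (mat_adj (P - ?m Q P)) = (P - ?m P Q) - (?m Q P - ?m Q (?m P Q))"
        by (simp add: adj[OF P])
    qed
    also have "\<dots> = (?A - ?m ?A Q) - (?m Q ?A - ?m Q (?m ?A Q))"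
      by (simp add: sum_subtractf mat_comp_sum)
    also have "\<dots> = 0" by (simp add: AQ Q(3))
    finally have "P - ?m Q P = 0"
      using P adj Qp
      by (intro sum_comp_adj_eq_0[OF S(1), of N k "\<lambda>P. P - ?m Q P"])
        (auto intro!: tmat.subspace_diff subspace_tensor_maps tensor_maps_comp)
    then show ?thesis by simp
  qed
  have "proj_sup N k S = Q"
    unfolding proj_sup_def
  proof (rule the_equality)
    show "is_projection N k Q \<and> (\<forall>P\<in>S. proj_le N k P Q) \<and>
        (\<forall>Q'. is_projection N k Q' \<and> (\<forall>P\<in>S. proj_le N k P Q') \<longrightarrow> proj_le N k Q Q')"
      using Q(2) ub min by (auto simp: proj_le_def)
    fix Q' assume Q': "is_projection N k Q' \<and> (\<forall>P\<in>S. proj_le N k P Q') \<and>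
        (\<forall>Q''. is_projection N k Q'' \<and> (\<forall>P\<in>S. proj_le N k P Q'') \<longrightarrow> proj_le N k Q' Q'')"
    then have "?m Q' Q = Q" using min by (auto simp: proj_le_def)
    moreover have "?m Q Q' = Q'" using Q' Q(2) ub by (auto simp: proj_le_def)
    moreover have "mat_adj Q' = Q'" using Q' by (simp add: is_projection_def)
    ultimately show "Q' = Q" using Qp(1) by (metis mat_adj_comp)
  qed
  then show "proj_sup N k S \<in> V" "is_projection N k (proj_sup N k S)"
    "\<And>P. P \<in> S \<Longrightarrow> ?m (proj_sup N k S) P = P"
    "\<And>Q'. (\<And>P. P \<in> S \<Longrightarrow> ?m Q' P = P) \<Longrightarrow> ?m Q' (proj_sup N k S) = proj_sup N k S"
    using Q ub min by auto
qed

section \<open>Representations of finite regular involutive monoids\<close>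

text \<open>The endomorphisms of a word form such a monoid; the argument on ideals uses these laws
  and finiteness alone.\<close>

locale regular_star_monoid =
  fixes S :: "'s set" and mul :: "'s \<Rightarrow> 's \<Rightarrow> 's" (infixl "\<cdot>" 70) and inv :: "'s \<Rightarrow> 's" and one :: 's
  assumes finite_S: "finite S"
    and mul_closed [simp]: "x \<in> S \<Longrightarrow> y \<in> S \<Longrightarrow> x \<cdot> y \<in> S"
    and inv_closed [simp]: "x \<in> S \<Longrightarrow> inv x \<in> S"
    and one_closed [simp]: "one \<in> S"
    and mul_assoc: "x \<in> S \<Longrightarrow> y \<in> S \<Longrightarrow> z \<in> S \<Longrightarrow> x \<cdot> y \<cdot> z = x \<cdot> (y \<cdot> z)"
    and inv_inv: "x \<in> S \<Longrightarrow> inv (inv x) = x"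
    and inv_mul: "x \<in> S \<Longrightarrow> y \<in> S \<Longrightarrow> inv (x \<cdot> y) = inv y \<cdot> inv x"
    and one_mul: "x \<in> S \<Longrightarrow> one \<cdot> x = x" "x \<in> S \<Longrightarrow> x \<cdot> one = x"
    and regular: "x \<in> S \<Longrightarrow> x \<cdot> inv x \<cdot> x = x"
begin

definition is_proj :: "'s \<Rightarrow> bool" where
  "is_proj p \<longleftrightarrow> p \<in> S \<and> p \<cdot> p = p \<and> inv p = p"

definition below :: "'s \<Rightarrow> 's \<Rightarrow> bool" where
  "below q p \<longleftrightarrow> p \<cdot> q = q \<and> q \<cdot> p = q \<and> q \<noteq> p"

text \<open>The range projection of \<open>x\<close>; it selects the right ideal to which
  \<open>x\<close> will contribute a basis vector.\<close>

definition src :: "'s \<Rightarrow> 's" where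
  "src x = x \<cdot> inv x"

definition ideal :: "'s \<Rightarrow> 's set" where
  "ideal x = {a \<cdot> x \<cdot> b | a b. a \<in> S \<and> b \<in> S}"

text \<open>A numerical stand-in for the inclusion order of two-sided ideals, on which the
  triangularity arguments run.\<close>

definition height :: "'s \<Rightarrow> nat" where
  "height x = card (ideal x)"

lemma is_proj_S: "is_proj p \<Longrightarrow> p \<in> S"
  by (simp add: is_proj_def)

lemma src_proj:
  assumes x: "x \<in> S"
  shows "is_proj (src x)"
proof -
  have "src x \<cdot> src x = src x"
    using regular[OF x] x by (simp add: src_def mul_assoc[symmetric])
  then show ?thesis using x by (simp add: is_proj_def src_def inv_mul inv_inv)
qed

lemma idealI: "a \<in> S \<Longrightarrow> b \<in> S \<Longrightarrow> a \<cdot> x \<cdot> b \<in> ideal x"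
  by (auto simp: ideal_def)

lemma finite_ideal: "x \<in> S \<Longrightarrow> finite (ideal x)"
  by (rule finite_subset[OF _ finite_S]) (auto simp: ideal_def)

lemma height_mul:
  assumes x: "x \<in> S" and y: "y \<in> S"
  shows "height (x \<cdot> y) \<le> height x" "height (x \<cdot> y) \<le> height y"
proof -
  have "ideal (x \<cdot> y) \<subseteq> ideal x"
  proof
    fix z assume "z \<in> ideal (x \<cdot> y)"
    then obtain a b where ab: "a \<in> S" "b \<in> S" "z = a \<cdot> (x \<cdot> y) \<cdot> b" by (auto simp: ideal_def)
    then have "z = a \<cdot> x \<cdot> (y \<cdot> b)" using x y by (simp add: mul_assoc)
    then show "z \<in> ideal x" using ab y by (simp add: idealI)
  qed
  then show "height (x \<cdot> y) \<le> height x" unfolding height_def by (intro card_mono finite_ideal x)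
  have "ideal (x \<cdot> y) \<subseteq> ideal y"
  proof
    fix z assume "z \<in> ideal (x \<cdot> y)"
    then obtain a b where ab: "a \<in> S" "b \<in> S" "z = a \<cdot> (x \<cdot> y) \<cdot> b" by (auto simp: ideal_def)
    then have "z = a \<cdot> x \<cdot> y \<cdot> b" using x y by (simp add: mul_assoc)
    then show "z \<in> ideal y" using ab x by (simp add: idealI)
  qed
  then show "height (x \<cdot> y) \<le> height y" unfolding height_def by (intro card_mono finite_ideal y)
qed

text \<open>If the ideals coincided, \<open>p\<close> would have the form \<open>a q b\<close>.
  Cutting \<open>a\<close> and \<open>b\<close> down to \<open>pSp\<close> gives
  \<open>x y = p\<close>, and finiteness turns this into \<open>y x = p\<close>. But
  \<open>y\<close> absorbs \<open>q\<close> on the left, so \<open>q p = p\<close>, that is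
  \<open>q = p\<close>.\<close>

lemma below_height:
  assumes p: "is_proj p" and q: "is_proj q" and qp: "below q p"
  shows "height q < height p"
proof (rule ccontr)
  assume "\<not> height q < height p"
  have pS: "p \<in> S" and pp: "p \<cdot> p = p" and qS: "q \<in> S" and qq: "q \<cdot> q = q"
    and pq: "p \<cdot> q = q" and qp': "q \<cdot> p = q" and ne: "q \<noteq> p"
    using p q qp by (auto simp: is_proj_def below_def)
  have "ideal q \<subseteq> ideal p"
  proof
    fix z assume "z \<in> ideal q"
    then obtain a b where ab: "a \<in> S" "b \<in> S" "z = a \<cdot> (p \<cdot> q) \<cdot> b" unfolding pq by (auto simp: ideal_def)
    then have "z = a \<cdot> p \<cdot> (q \<cdot> b)" using pS qS by (simp add: mul_assoc)
    then show "z \<in> ideal p" using ab qS by (simp add: idealI)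
  qed
  then have "ideal q = ideal p"
    using \<open>\<not> height q < height p\<close> unfolding height_def
    by (intro card_seteq finite_ideal pS) auto
  moreover have "p \<in> ideal p"
    unfolding ideal_def using pS one_mul by (intro CollectI exI[of _ one]) auto
  ultimately obtain a b where ab: "a \<in> S" "b \<in> S" "p = a \<cdot> q \<cdot> b" unfolding ideal_def by blast
  define x where "x = p \<cdot> a \<cdot> q"
  define y where "y = q \<cdot> b \<cdot> p"
  have xS: "x \<in> S" and yS: "y \<in> S" using ab pS qS by (simp_all add: x_def y_def)
  have "x \<cdot> y = p \<cdot> (a \<cdot> (q \<cdot> q) \<cdot> b) \<cdot> p"
    using ab pS qS by (simp add: x_def y_def mul_assoc)
  then have xy: "x \<cdot> y = p" by (simp only: qq ab(3)[symmetric] pp)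
  have qy: "q \<cdot> y = y" and py: "p \<cdot> y = y"
    using ab(1,2) pS qS pp qq pq by (simp_all add: x_def y_def mul_assoc[symmetric])
  have xp: "x \<cdot> p = x"
    using ab(1,2) pS qS qp' by (simp add: x_def mul_assoc)
  \<comment> \<open>In the finite monoid \<open>pSp\<close> the one-sided inverse \<open>y\<close> of \<open>x\<close> is two-sided.\<close>
  define M where "M = {z \<in> S. p \<cdot> z = z \<and> z \<cdot> p = z}"
  have "finite M" using finite_S by (simp add: M_def)
  moreover have "(\<lambda>z. z \<cdot> x) ` M \<subseteq> M"
    using xS pS xp by (auto simp: M_def mul_assoc) (simp add: mul_assoc[symmetric])
  moreover have "inj_on (\<lambda>z. z \<cdot> x) M"
  proof (rule inj_on_inverseI[where g = "\<lambda>z. z \<cdot> y"])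
    show "z \<cdot> x \<cdot> y = z" if "z \<in> M" for z using that xS yS xy by (simp add: M_def mul_assoc)
  qed
  ultimately have "(\<lambda>z. z \<cdot> x) ` M = M" by (intro endo_inj_surj)
  moreover have "p \<in> M" using pS pp by (simp add: M_def)
  ultimately obtain z where z: "z \<in> M" "z \<cdot> x = p" by force
  have "z = z \<cdot> (x \<cdot> y)" using z(1) xy by (simp add: M_def)
  also have "\<dots> = y" using z xS yS py by (simp add: M_def mul_assoc[symmetric])
  finally have "y \<cdot> x = p" using z(2) by simp
  then have "q \<cdot> p = p" using qy qS yS xS by (metis mul_assoc)
  then show False using qp' ne by simp
qed

end

text \<open>The coefficients are indexed by \<open>X\<close> rather than by the image, so that
  \<open>f\<close> may take a value twice.\<close>

lemma in_span_image_finite: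
  assumes "finite X" and v: "v \<in> tmat.span (f ` X)"
  shows "\<exists>u. v = (\<Sum>x\<in>X. tmat_scale (u x) (f x))"
  using v
proof (induction rule: tmat.span_induct_alt)
  case base
  show ?case by (intro exI[of _ "\<lambda>_. 0"]) simp
next
  case (step c b v)
  then obtain x u where x: "x \<in> X" "b = f x" and u: "v = (\<Sum>x\<in>X. tmat_scale (u x) (f x))" by blast
  have "(\<Sum>y\<in>X. tmat_scale ((u(x := c + u x)) y) (f y)) =
      tmat_scale (c + u x) (f x) + (\<Sum>y\<in>X - {x}. tmat_scale (u y) (f y))"
    by (subst sum.remove[OF assms(1) x(1)]) (auto intro!: sum.cong)
  also have "\<dots> = tmat_scale c b + v"
    unfolding u x(2) sum.remove[OF assms(1) x(1), of "\<lambda>y. tmat_scale (u y) (f y)"]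
    by (simp only: tmat.scale_left_distrib add.assoc)
  finally show ?case by metis
qed

lemma mat_comp_in_span:
  assumes A: "A \<in> tmat.span \<A>" and B: "B \<in> tmat.span \<B>"
    and V: "tmat.subspace V" "\<And>A B. A \<in> \<A> \<Longrightarrow> B \<in> \<B> \<Longrightarrow> mat_comp N k A B \<in> V"
  shows "mat_comp N k A B \<in> V"
proof -
  have *: "mat_comp N k A B \<in> V" if "A \<in> \<A>" for A
    using B
  proof (induction rule: tmat.span_induct_alt)
    case base
    show ?case using tmat.subspace_0[OF V(1)] by (simp only: mat_comp_0)
  next
    case (step c b v)
    then show ?case
      unfolding mat_comp_add mat_comp_scale using V that
      by (intro tmat.subspace_add tmat.subspace_scale) auto
  qed
  show ?thesis
    using A
  proof (induction rule: tmat.span_induct_alt)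
    case base
    show ?case using tmat.subspace_0[OF V(1)] by (simp only: mat_comp_0)
  next
    case (step c a v)
    then show ?case
      unfolding mat_comp_add mat_comp_scale using V *
      by (intro tmat.subspace_add tmat.subspace_scale) auto
  qed
qed

section \<open>A second basis adapted to the projections\<close>

text \<open>The positive scalars stand for removed loops and normalisations. In
  \<open>T_indep\<close> the coefficients are indexed by \<open>S\<close>, which makes
  \<open>T\<close> injective as well.\<close>

locale projective_rep = regular_star_monoid S mul inv one
  for S :: "'s set" and mul :: "'s \<Rightarrow> 's \<Rightarrow> 's" (infixl "\<cdot>" 70) and inv :: "'s \<Rightarrow> 's" and one :: 's +
  fixes T :: "'s \<Rightarrow> tmat" and N k :: nat
  assumes T_maps: "x \<in> S \<Longrightarrow> T x \<in> tensor_maps N k k"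
    and T_mul: "x \<in> S \<Longrightarrow> y \<in> S \<Longrightarrow>
        \<exists>c>0. mat_comp N k (T x) (T y) = tmat_scale (complex_of_real c) (T (x \<cdot> y))"
    and T_proj: "is_proj p \<Longrightarrow> is_projection N k (T p)"
    and T_one: "T one = id_mat N k"
    and T_indep: "(\<Sum>x\<in>S. tmat_scale (c x) (T x)) = 0 \<Longrightarrow> x \<in> S \<Longrightarrow> c x = 0"
begin

abbreviation comp :: "tmat \<Rightarrow> tmat \<Rightarrow> tmat" (infixl "\<odot>" 70) where
  "A \<odot> B \<equiv> mat_comp N k A B"

definition Q :: "'s \<Rightarrow> tmat" where
  "Q p = proj_sup N k {T q | q. is_proj q \<and> below q p}"

definition P :: "'s \<Rightarrow> tmat" where
  "P p = T p - Q p"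

definition Y :: "'s \<Rightarrow> tmat" where
  "Y s = P (src s) \<odot> T s"

lemma T_mul_in_span:
  assumes "X \<subseteq> S" "X' \<subseteq> S" "\<And>x x'. x \<in> X \<Longrightarrow> x' \<in> X' \<Longrightarrow> x \<cdot> x' \<in> Z"
    and "A \<in> tmat.span (T ` X)" "B \<in> tmat.span (T ` X')"
  shows "A \<odot> B \<in> tmat.span (T ` Z)"
proof (rule mat_comp_in_span[OF assms(4,5) tmat.subspace_span])
  fix A B assume "A \<in> T ` X" "B \<in> T ` X'"
  then obtain x x' where x: "x \<in> X" "x' \<in> X'" "A = T x" "B = T x'" by blast
  then obtain c :: real where "A \<odot> B = tmat_scale (of_real c) (T (x \<cdot> x'))" using T_mul assms(1,2) by blast
  then show "A \<odot> B \<in> tmat.span (T ` Z)"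
    using assms(3) x by (simp add: tmat.span_base tmat.span_scale)
qed

lemma T_span_maps: "X \<subseteq> S \<Longrightarrow> tmat.span (T ` X) \<subseteq> tensor_maps N k k"
  using T_maps by (intro tmat.span_minimal subspace_tensor_maps) auto

text \<open>Elements of height less than that of \<open>p\<close> are closed under products, so
  their span is an algebra, and the supremum of the projections below \<open>p\<close> stays in
  it.\<close>

lemma Q_props:
  assumes p: "is_proj p"
  shows "Q p \<in> tmat.span (T ` {x \<in> S. height x < height p})"
    and "is_projection N k (Q p)"
    and "\<And>q. is_proj q \<Longrightarrow> below q p \<Longrightarrow> Q p \<odot> T q = T q"
    and "\<And>A. (\<And>q. is_proj q \<Longrightarrow> below q p \<Longrightarrow> A \<odot> T q = T q) \<Longrightarrow> A \<odot> Q p = Q p"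
proof -
  let ?X = "{T q | q. is_proj q \<and> below q p}" and ?V = "tmat.span (T ` {x \<in> S. height x < height p})"
  have fin: "finite ?X"
    by (rule finite_subset[of _ "T ` S"]) (auto simp: is_proj_S finite_S)
  have sub: "?X \<subseteq> ?V" using below_height[OF p] by (auto simp: is_proj_S intro!: tmat.span_base)
  have proj: "is_projection N k A" if "A \<in> ?X" for A using that T_proj by auto
  have closed: "A \<odot> B \<in> ?V" if "A \<in> ?V" "B \<in> ?V" for A B
    by (rule T_mul_in_span[OF _ _ _ that]) (auto intro: le_less_trans[OF height_mul(1)])
  note sup = proj_sup_exists[OF fin sub proj tmat.subspace_span T_span_maps closed]
  show "Q p \<in> ?V" "is_projection N k (Q p)"
    unfolding Q_def using sup(1,2) by blast+
  show "Q p \<odot> T q = T q" if "is_proj q" "below q p" for q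
    unfolding Q_def using that by (intro sup(3)) auto
  show "A \<odot> Q p = Q p" if "\<And>q. is_proj q \<Longrightarrow> below q p \<Longrightarrow> A \<odot> T q = T q" for A
    unfolding Q_def using that by (intro sup(4)) auto
qed

lemma T_nonzero: "x \<in> S \<Longrightarrow> T x \<noteq> 0"
proof
  assume x: "x \<in> S" and "T x = 0"
  then have "(\<Sum>y\<in>S. tmat_scale (if y = x then 1 else 0) (T y)) = 0"
    by (intro sum.neutral) auto
  from T_indep[OF this x] show False by simp
qed

text \<open>Idempotency of \<open>T p\<close> forces the positive scalar in its product with
  \<open>T q\<close> to satisfy \<open>c * c = c\<close>.\<close>

lemma T_below:
  assumes p: "is_proj p" and q: "is_proj q" and qp: "below q p"
  shows "T p \<odot> T q = T q"
proof -
  obtain c :: real where c: "c > 0" "T p \<odot> T q = tmat_scale (of_real c) (T q)"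
    using T_mul[OF is_proj_S[OF p] is_proj_S[OF q]] qp by (auto simp: below_def)
  have "T p \<odot> T p = T p" using T_proj[OF p] by (simp add: is_projection_def)
  then have "T p \<odot> (T p \<odot> T q) = T p \<odot> T q" by (simp flip: mat_comp_assoc)
  then have "tmat_scale (of_real (c * c)) (T q) = tmat_scale (of_real c) (T q)"
    unfolding c(2) mat_comp_scale tmat_scale_scale by simp
  then have "tmat_scale (of_real (c * c) - of_real c) (T q) = 0"
    by (simp only: tmat.scale_left_diff_distrib) simp
  then have "complex_of_real (c * c) = of_real c"
    using T_nonzero[OF is_proj_S[OF q]] by (simp only: tmat.scale_eq_0_iff) simp
  then have "c = 1" using c(1) by (simp only: of_real_eq_iff) simp
  then show ?thesis using c(2) by simp
qed

text \<open>\<open>T p\<close> fixes each \<open>T q\<close> with \<open>q\<close> below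
  \<open>p\<close>, hence also their supremum. So \<open>P p\<close> is a difference of nested
  projections, and it annihilates \<open>T q\<close> because both of its terms fix
  \<open>T q\<close>.\<close>

lemma P_props:
  assumes p: "is_proj p"
  shows "P p \<in> tmat.span (T ` S)" "P p \<odot> T p = P p" "P p \<odot> P p = P p"
    "is_proj q \<Longrightarrow> below q p \<Longrightarrow> P p \<odot> T q = 0"
proof -
  have T: "T p \<odot> T p = T p" "mat_adj (T p) = T p" using T_proj[OF p] by (auto simp: is_projection_def)
  have Qp: "Q p \<odot> Q p = Q p" "mat_adj (Q p) = Q p" using Q_props(2)[OF p] by (auto simp: is_projection_def)
  have TQ: "T p \<odot> Q p = Q p" using Q_props(4)[OF p] T_below[OF p] by blast
  then have QT: "Q p \<odot> T p = Q p" using T(2) Qp(2) by (metis mat_adj_comp)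
  have "Q p \<in> tmat.span (T ` S)"
    using Q_props(1)[OF p] tmat.span_mono[of "T ` {x \<in> S. height x < height p}" "T ` S"] by auto
  then show "P p \<in> tmat.span (T ` S)"
    unfolding P_def using is_proj_S[OF p] by (intro tmat.span_diff) (auto intro: tmat.span_base)
  show "P p \<odot> T p = P p" by (simp add: P_def mat_comp_diff T QT)
  show "P p \<odot> P p = P p" by (simp add: P_def mat_comp_diff T QT TQ Qp)
  show "P p \<odot> T q = 0" if "is_proj q" "below q p"
    using T_below[OF p that] Q_props(3)[OF p that] by (simp add: P_def mat_comp_diff)
qed

lemma src_mul:
  assumes s: "s \<in> S"
  obtains c :: real where "c > 0" "T (src s) \<odot> T s = tmat_scale (of_real c) (T s)"
proof -
  have "src s \<in> S" "src s \<cdot> s = s"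
    using s regular by (simp_all add: src_def)
  then show ?thesis using that T_mul[of "src s" s] s by auto
qed

text \<open>The \<open>Y s\<close> form a basis of the algebra that is unitriangular, up to scalars, over the \<open>T s\<close>.\<close>

lemma Y_expand:
  assumes s: "s \<in> S"
  shows "\<exists>c. c \<noteq> 0 \<and> Y s - tmat_scale c (T s) \<in> tmat.span (T ` {x \<in> S. height x < height s})"
proof -
  obtain c :: real where c: "c > 0" "T (src s) \<odot> T s = tmat_scale (of_real c) (T s)"
    using src_mul[OF s] by blast
  have p: "is_proj (src s)" by (rule src_proj[OF s])
  have h: "height (src s) \<le> height s" unfolding src_def using s by (intro height_mul) auto
  have "Q (src s) \<odot> T s \<in> tmat.span (T ` {x \<in> S. height x < height s})"
  proof (rule T_mul_in_span[OF _ _ _ Q_props(1)[OF p]])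
    show "T s \<in> tmat.span (T ` {s})" by (intro tmat.span_base) simp
    show "x \<cdot> x' \<in> {x \<in> S. height x < height s}"
      if "x \<in> {x \<in> S. height x < height (src s)}" "x' \<in> {s}" for x x'
      using that s h height_mul(1)[of x s] by auto
  qed (use s in auto)
  then have "Y s - tmat_scale (of_real c) (T s) \<in> tmat.span (T ` {x \<in> S. height x < height s})"
    by (simp add: Y_def P_def mat_comp_diff c(2) tmat.span_neg)
  moreover have "complex_of_real c \<noteq> 0" using c(1) by simp
  ultimately show ?thesis by blast
qed

lemma T_combination_in_span:
  assumes v: "(\<Sum>x\<in>X. tmat_scale (b x) (T x)) \<in> tmat.span (T ` Z)"
    and X: "X \<subseteq> S" and Z: "Z \<subseteq> S" and disj: "X \<inter> Z = {}" and x: "x \<in> X"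
  shows "b x = 0"
proof -
  have fin: "finite X" "finite Z" using X Z finite_S finite_subset by auto
  obtain u where u: "(\<Sum>x\<in>X. tmat_scale (b x) (T x)) = (\<Sum>x\<in>Z. tmat_scale (u x) (T x))"
    using in_span_image_finite[OF fin(2) v] by blast
  let ?c = "\<lambda>x. if x \<in> X then b x else if x \<in> Z then - u x else 0"
  have "(\<Sum>x\<in>S. tmat_scale (?c x) (T x)) = (\<Sum>x\<in>X \<union> Z. tmat_scale (?c x) (T x))"
    using X Z by (intro sum.mono_neutral_right finite_S) auto
  also have "\<dots> = (\<Sum>x\<in>X. tmat_scale (?c x) (T x)) + (\<Sum>x\<in>Z. tmat_scale (?c x) (T x))"
    by (rule sum.union_disjoint[OF fin disj])
  also have "(\<Sum>x\<in>X. tmat_scale (?c x) (T x)) = (\<Sum>x\<in>X. tmat_scale (b x) (T x))"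
    by (intro sum.cong) auto
  also have "(\<Sum>x\<in>Z. tmat_scale (?c x) (T x)) = - (\<Sum>x\<in>Z. tmat_scale (u x) (T x))"
    unfolding sum_negf[symmetric] using disj by (intro sum.cong) auto
  finally have "(\<Sum>x\<in>S. tmat_scale (?c x) (T x)) = 0" unfolding u by (rule trans) (rule right_minus)
  from T_indep[OF this] x X show ?thesis by fastforce
qed

text \<open>Let \<open>n\<close> be the maximal height with a nonzero coefficient. Modulo the span
  of the \<open>T x\<close> of smaller height only multiples of the \<open>T x\<close> of height
  \<open>n\<close> remain, and these are independent of that span.\<close>

lemma Y_indep:
  assumes zero: "(\<Sum>s\<in>S. tmat_scale (a s) (Y s)) = 0" and s: "s \<in> S"
  shows "a s = 0"
proof (rule ccontr)
  assume as: "a s \<noteq> 0"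
  let ?N = "{s \<in> S. a s \<noteq> 0}"
  define n where "n = Max (height ` ?N)"
  have fin: "finite (height ` ?N)" using finite_S by simp
  have "n \<in> height ` ?N" unfolding n_def using s as by (intro Max_in[OF fin]) auto
  then obtain r where r: "r \<in> S" "a r \<noteq> 0" "height r = n" by auto
  have le: "height x \<le> n" if "x \<in> S" "a x \<noteq> 0" for x
    unfolding n_def using that by (intro Max_ge[OF fin]) auto
  let ?V = "tmat.span (T ` {x \<in> S. height x < n})"
  have "\<forall>x\<in>S. \<exists>c. c \<noteq> 0 \<and> Y x - tmat_scale c (T x) \<in> tmat.span (T ` {y \<in> S. height y < height x})"
    using Y_expand by blast
  from bchoice[OF this] obtain c where c: "\<And>x. x \<in> S \<Longrightarrow> c x \<noteq> 0"
    "\<And>x. x \<in> S \<Longrightarrow> Y x - tmat_scale (c x) (T x) \<in> tmat.span (T ` {y \<in> S. height y < height x})"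
    by blast
  have "tmat_scale (a x) (Y x) - (if height x = n then tmat_scale (a x * c x) (T x) else 0) \<in> ?V"
    if x: "x \<in> S" for x
  proof (cases "a x = 0")
    case False
    have mono: "tmat.span (T ` {y \<in> S. height y < height x}) \<subseteq> ?V"
      using le[OF x False] by (intro tmat.span_mono) auto
    have *: "tmat_scale (a x) (Y x) - tmat_scale (a x * c x) (T x) \<in> ?V"
    proof -
      have "tmat_scale (a x) (Y x - tmat_scale (c x) (T x)) \<in> ?V"
        using c(2)[OF x] mono by (intro tmat.span_scale) auto
      then show ?thesis by (simp only: tmat.scale_right_diff_distrib tmat_scale_scale)
    qed
    show ?thesis
    proof (cases "height x = n")
      case True
      then show ?thesis using * by simp
    next
      case neq: False
      then have "tmat_scale (a x * c x) (T x) \<in> ?V"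
        using le[OF x False] x by (intro tmat.span_scale tmat.span_base) auto
      then show ?thesis using tmat.span_add[OF *] neq by fastforce
    qed
  qed (simp add: tmat.span_zero)
  then have "(\<Sum>x\<in>S. tmat_scale (a x) (Y x) - (if height x = n then tmat_scale (a x * c x) (T x) else 0)) \<in> ?V"
    by (intro tmat.span_sum)
  then have "- (\<Sum>x\<in>S. if height x = n then tmat_scale (a x * c x) (T x) else 0) \<in> ?V"
    by (simp only: sum_subtractf zero) simp
  then have "(\<Sum>x\<in>S. if height x = n then tmat_scale (a x * c x) (T x) else 0) \<in> ?V"
    using tmat.span_neg by fastforce
  then have "(\<Sum>x\<in>{x \<in> S. height x = n}. tmat_scale (a x * c x) (T x)) \<in> ?V"
    by (simp only: sum.inter_filter[OF finite_S])
  then have "a r * c r = 0" by (rule T_combination_in_span) (use r in auto)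
  then show False using r c by auto
qed

lemma T_in_span_Y:
  assumes "s \<in> S"
  shows "T s \<in> tmat.span (Y ` S)"
  using assms
proof (induction "height s" arbitrary: s rule: less_induct)
  case less
  obtain c where c: "c \<noteq> 0" "Y s - tmat_scale c (T s) \<in> tmat.span (T ` {x \<in> S. height x < height s})"
    using Y_expand[OF less.prems] by blast
  have "tmat.span (T ` {x \<in> S. height x < height s}) \<subseteq> tmat.span (Y ` S)"
    using less.hyps by (intro tmat.span_minimal tmat.subspace_span) auto
  then have "Y s - (Y s - tmat_scale c (T s)) \<in> tmat.span (Y ` S)"
    using tmat.span_diff[OF tmat.span_base[OF imageI[OF less.prems]] subsetD[OF _ c(2)]] by blast
  then have "tmat_scale (1 / c) (Y s - (Y s - tmat_scale c (T s))) \<in> tmat.span (Y ` S)"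
    by (rule tmat.span_scale)
  moreover have "tmat_scale (1 / c) (Y s - (Y s - tmat_scale c (T s))) = T s"
    using c(1) by (simp add: tmat_scale_def fun_eq_iff)
  ultimately show ?case by simp
qed

text \<open>Replace \<open>x\<close> by \<open>y = q x\<close>; then \<open>src y\<close> is
  \<open>q\<close> or lies below it. In the first case the product is \<open>Y y\<close> up to a
  scalar. In the second \<open>P q\<close> kills \<open>T (src y)\<close>, which fixes
  \<open>T y\<close> up to a nonzero scalar.\<close>

lemma P_mul_in_span_Y:
  assumes q: "is_proj q" and x: "x \<in> S"
  shows "P q \<odot> T x \<in> tmat.span (Y ` {s \<in> S. src s = q})"
proof -
  have qS: "q \<in> S" and qq: "q \<cdot> q = q" and iq: "inv q = q" using q by (auto simp: is_proj_def)
  define y where "y = q \<cdot> x"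
  have yS: "y \<in> S" using qS x by (simp add: y_def)
  obtain c :: real where c: "T q \<odot> T x = tmat_scale (of_real c) (T y)"
    using T_mul[OF qS x] unfolding y_def by blast
  have "P q \<odot> T x = P q \<odot> (T q \<odot> T x)"
    using P_props(2)[OF q] by (simp flip: mat_comp_assoc)
  then have Px: "P q \<odot> T x = tmat_scale (of_real c) (P q \<odot> T y)" by (simp only: c mat_comp_scale)
  have "P q \<odot> T y \<in> tmat.span (Y ` {s \<in> S. src s = q})"
  proof (cases "src y = q")
    case True
    then have "P q \<odot> T y = Y y" by (simp add: Y_def)
    then show ?thesis using True yS by (auto intro: tmat.span_base)
  next
    case False
    have "q \<cdot> src y = src y"
      using qS x qq by (simp add: src_def y_def mul_assoc[symmetric])
    moreover have "src y \<cdot> q = src y"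
      using qS x qq iq by (simp add: src_def y_def mul_assoc inv_mul)
    ultimately have "below (src y) q" using False by (simp add: below_def)
    then have 0: "P q \<odot> T (src y) = 0" using P_props(4)[OF q src_proj[OF yS]] by blast
    obtain d :: real where d: "d > 0" "T (src y) \<odot> T y = tmat_scale (of_real d) (T y)"
      using src_mul[OF yS] by blast
    have "tmat_scale (of_real d) (P q \<odot> T y) = P q \<odot> (T (src y) \<odot> T y)"
      by (simp only: d(2) mat_comp_scale)
    also have "\<dots> = 0" by (simp only: mat_comp_assoc[symmetric] 0 mat_comp_0)
    finally have "P q \<odot> T y = 0" using d(1) by (simp only: tmat.scale_eq_0_iff) simp
    then show ?thesis by (simp only: tmat.span_zero)
  qed
  then show ?thesis unfolding Px by (rule tmat.span_scale)
qed

section \<open>The idempotents of the direct sum\<close>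

lemma sum_fibres:
  assumes "\<And>s. s \<in> S \<Longrightarrow> f s \<in> I" "finite I"
  shows "(\<Sum>p\<in>I. \<Sum>s\<in>{s \<in> S. f s = p}. g s) = (\<Sum>s\<in>S. g s)"
  using assms finite_S by (intro sum.group) auto

definition e_coeff :: "'s \<Rightarrow> complex" where
  "e_coeff = (SOME b. id_mat N k = (\<Sum>s\<in>S. tmat_scale (b s) (Y s)))"

text \<open>For a projection \<open>p\<close>, this is the component of the identity in the right
  ideal generated by \<open>P p\<close>.\<close>

definition e :: "'s \<Rightarrow> tmat" where
  "e p = (\<Sum>s\<in>{s \<in> S. src s = p}. tmat_scale (e_coeff s) (Y s))"

lemma finite_projs: "finite {p. is_proj p}"
  by (rule finite_subset[OF _ finite_S]) (auto simp: is_proj_def)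

lemma sum_e: "(\<Sum>p | is_proj p. e p) = id_mat N k"
proof -
  have "\<exists>b. id_mat N k = (\<Sum>s\<in>S. tmat_scale (b s) (Y s))"
    using in_span_image_finite[OF finite_S T_in_span_Y[OF one_closed]] by (simp only: T_one)
  then have "id_mat N k = (\<Sum>s\<in>S. tmat_scale (e_coeff s) (Y s))"
    unfolding e_coeff_def by (rule someI_ex)
  then show ?thesis unfolding e_def
    by (subst sum_fibres) (auto simp: src_proj finite_projs)
qed

lemma P_e: "is_proj p \<Longrightarrow> P p \<odot> e p = e p"
  unfolding e_def mat_comp_sum mat_comp_scale
  by (intro sum.cong) (auto simp: Y_def P_props(3) simp flip: mat_comp_assoc)

text \<open>Directness of the sum of the right ideals. Coefficients chosen for each \<open>q\<close>
  separately merge into one family, since each \<open>s\<close> lies over a single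
  projection.\<close>

lemma fibre_sum_indep:
  assumes d: "\<And>q. is_proj q \<Longrightarrow> d q \<in> tmat.span (Y ` {s \<in> S. src s = q})"
    and zero: "(\<Sum>q | is_proj q. d q) = 0" and q: "is_proj q"
  shows "d q = 0"
proof -
  have "\<forall>q\<in>{q. is_proj q}. \<exists>u. d q = (\<Sum>s\<in>{s \<in> S. src s = q}. tmat_scale (u s) (Y s))"
    using d finite_S by (auto intro!: in_span_image_finite)
  from bchoice[OF this] obtain u
    where u: "\<And>q. is_proj q \<Longrightarrow> d q = (\<Sum>s\<in>{s \<in> S. src s = q}. tmat_scale (u q s) (Y s))"
    by blast
  then have u': "d q = (\<Sum>s\<in>{s \<in> S. src s = q}. tmat_scale (u (src s) s) (Y s))" if "is_proj q" for q
    using that by (auto intro: sum.cong)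
  have "(\<Sum>s\<in>S. tmat_scale (u (src s) s) (Y s)) =
      (\<Sum>q | is_proj q. \<Sum>s\<in>{s \<in> S. src s = q}. tmat_scale (u (src s) s) (Y s))"
    by (rule sum_fibres[symmetric]) (auto simp: src_proj finite_projs)
  also have "\<dots> = (\<Sum>q | is_proj q. d q)" using u' by (intro sum.cong) auto
  finally have "(\<Sum>s\<in>S. tmat_scale (u (src s) s) (Y s)) = 0" using zero by simp
  then have "u (src s) s = 0" if "s \<in> S" for s 
    using Y_indep[of "\<lambda>s. u (src s) s", OF _ that] by blast
  then show ?thesis unfolding u'[OF q] by (intro sum.neutral) auto
qed

lemma P_span_in_span_Y:
  assumes q: "is_proj q" and A: "A \<in> tmat.span (T ` S)"
  shows "P q \<odot> A \<in> tmat.span (Y ` {s \<in> S. src s = q})"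
proof (rule mat_comp_in_span[OF _ A tmat.subspace_span])
  show "P q \<in> tmat.span {P q}" by (intro tmat.span_base) simp
qed (use P_mul_in_span_Y[OF q] in auto)

text \<open>Multiplying the decomposition of the identity by \<open>P p\<close> on the right
  decomposes \<open>P p\<close> along the right ideals. As \<open>P p\<close> lies in one of them,
  the other components vanish.\<close>

lemma e_P:
  assumes p: "is_proj p" and q: "is_proj q"
  shows "e q \<odot> P p = (if q = p then P p else 0)"
proof -
  let ?W = "\<lambda>q. tmat.span (Y ` {s \<in> S. src s = q})"
  have Pmap: "P p \<in> tensor_maps N k k" using P_props(1)[OF p] T_span_maps by blast
  have e: "e q \<odot> P p \<in> ?W q" if q: "is_proj q" for q
    unfolding e_def mat_comp_sum mat_comp_scale
  proof (intro tmat.span_sum tmat.span_scale)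
    fix s assume s: "s \<in> {s \<in> S. src s = q}"
    have "T s \<odot> P p \<in> tmat.span (T ` S)"
      using s by (intro T_mul_in_span[OF _ _ _ _ P_props(1)[OF p], of S]) (auto intro: tmat.span_base)
    then have "P q \<odot> (T s \<odot> P p) \<in> ?W q" by (rule P_span_in_span_Y[OF q])
    then show "Y s \<odot> P p \<in> ?W q" using s by (simp add: Y_def mat_comp_assoc)
  qed
  have Pp: "P p \<in> ?W p"
  proof -
    have "T one \<in> tmat.span (T ` S)" by (intro tmat.span_base) simp
    from P_span_in_span_Y[OF p this] show ?thesis by (simp add: T_one mat_comp_id(2)[OF Pmap])
  qed
  let ?d = "\<lambda>q. e q \<odot> P p - (if q = p then P p else 0)"
  have "?d q = 0"
  proof (rule fibre_sum_indep[OF _ _ q])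
    show "?d q \<in> ?W q" if "is_proj q" for q
    proof (cases "q = p")
      case True
      then show ?thesis using e[OF that] Pp by (simp add: tmat.span_diff)
    next
      case False
      then show ?thesis using e[OF that] by simp
    qed
    have "(\<Sum>q | is_proj q. ?d q) = (\<Sum>q | is_proj q. e q) \<odot> P p - P p"
      using p finite_projs by (simp add: sum_subtractf mat_comp_sum)
    then show "(\<Sum>q | is_proj q. ?d q) = 0"
      using mat_comp_id(1)[OF Pmap] by (simp add: sum_e)
  qed
  then show ?thesis by simp
qed

lemma mat_apply_comp: "mat_apply N k (A \<odot> B) \<xi> = mat_apply N k A (mat_apply N k B \<xi>)"
proof
  fix j
  have "(\<Sum>i\<in>idx N k. (\<Sum>m\<in>idx N k. A j m * B m i) * \<xi> i) =
      (\<Sum>i\<in>idx N k. \<Sum>m\<in>idx N k. A j m * (B m i * \<xi> i))"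
    by (simp add: sum_distrib_right mult.assoc)
  also have "\<dots> = (\<Sum>m\<in>idx N k. \<Sum>i\<in>idx N k. A j m * (B m i * \<xi> i))"
    by (rule sum.swap)
  finally show "mat_apply N k (A \<odot> B) \<xi> j = mat_apply N k A (mat_apply N k B \<xi>) j"
    by (simp add: mat_apply_def mat_comp_def sum_distrib_left)
qed

lemma mat_apply_add:
  "mat_apply N k A (\<xi> + \<eta>) = mat_apply N k A \<xi> + mat_apply N k A \<eta>"
  "mat_apply N k (A + B) \<xi> = mat_apply N k A \<xi> + mat_apply N k B \<xi>"
  by (simp_all add: mat_apply_def fun_eq_iff distrib_left distrib_right sum.distrib)

lemma mat_apply_0 [simp]: "mat_apply N k A 0 = 0" "mat_apply N k 0 \<xi> = 0"
  by (simp_all add: mat_apply_def fun_eq_iff)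

lemma mat_apply_sum:
  "mat_apply N k A (\<Sum>x\<in>X. f x) = (\<Sum>x\<in>X. mat_apply N k A (f x))"
  "mat_apply N k (\<Sum>x\<in>X. h x) \<xi> = (\<Sum>x\<in>X. mat_apply N k (h x) \<xi>)"
  by (induction X rule: infinite_finite_induct) (simp_all only: mat_apply_add mat_apply_0 sum.infinite sum.empty sum.insert not_False_eq_True)

lemma mat_apply_id: "\<xi> \<in> tensor_space N k \<Longrightarrow> mat_apply N k (id_mat N k) \<xi> = \<xi>"
proof
  fix j assume \<xi>: "\<xi> \<in> tensor_space N k"
  have "mat_apply N k (id_mat N k) \<xi> j = (\<Sum>i\<in>idx N k. if i = j then \<xi> j else 0)"
    unfolding mat_apply_def id_mat_def by (intro sum.cong) auto
  then show "mat_apply N k (id_mat N k) \<xi> j = \<xi> j" using \<xi> by (auto simp: tensor_space_def)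
qed

lemma mat_apply_in_tensor_space:
  "A \<in> tensor_maps N k k \<Longrightarrow> mat_apply N k A \<xi> \<in> tensor_space N k"
  by (auto simp: tensor_maps_def tensor_space_def mat_apply_def)

text \<open>\<open>e p\<close> and \<open>P p\<close> fix each other from the left and so have the
  same range, while \<open>e q\<close> vanishes on the ranges for \<open>p\<close> other than
  \<open>q\<close>. So applying \<open>e q\<close> reads off the component at
  \<open>q\<close>.\<close>

theorem direct_sum:
  assumes \<xi>: "\<xi> \<in> tensor_space N k"
  shows "\<exists>!v. v \<in> (\<Pi>\<^sub>E p\<in>{p. is_proj p}. mat_range N k (P p)) \<and> \<xi> = (\<Sum>p | is_proj p. v p)"
proof
  let ?ap = "mat_apply N k"
  let ?v = "\<lambda>p\<in>{p. is_proj p}. ?ap (e p) \<xi>"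
  have emap: "e p \<in> tensor_maps N k k" if "is_proj p" for p
  proof -
    have "Y s \<in> tensor_maps N k k" if "s \<in> S" for s
      unfolding Y_def using that P_props(1)[OF src_proj] T_span_maps T_maps by (intro tensor_maps_comp) blast+
    then show ?thesis unfolding e_def
      by (intro tmat.subspace_sum tmat.subspace_scale subspace_tensor_maps) auto
  qed
  have "?ap (e p) \<xi> \<in> mat_range N k (P p)" if p: "is_proj p" for p
  proof -
    have "?ap (e p) \<xi> = ?ap (P p) (?ap (e p) \<xi>)"
      by (simp only: P_e[OF p] flip: mat_apply_comp)
    then show ?thesis
      unfolding mat_range_def using mat_apply_in_tensor_space[OF emap[OF p], of \<xi>] by blast
  qed
  moreover have "\<xi> = (\<Sum>p | is_proj p. ?ap (e p) \<xi>)"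
    using mat_apply_id[OF \<xi>] by (simp only: sum_e[symmetric] mat_apply_sum)
  then have "\<xi> = (\<Sum>p | is_proj p. ?v p)" by simp
  ultimately show "?v \<in> (\<Pi>\<^sub>E p\<in>{p. is_proj p}. mat_range N k (P p)) \<and> \<xi> = (\<Sum>p | is_proj p. ?v p)"
    by auto
  fix v assume v: "v \<in> (\<Pi>\<^sub>E p\<in>{p. is_proj p}. mat_range N k (P p)) \<and> \<xi> = (\<Sum>p | is_proj p. v p)"
  show "v = ?v"
  proof
    fix q
    show "v q = ?v q"
    proof (cases "is_proj q")
      case q: True
      have ev: "?ap (e q) (v p) = (if p = q then v q else 0)" if p: "is_proj p" for p
      proof -
        have "v p \<in> mat_range N k (P p)" using v p by auto
        then obtain \<eta> where \<eta>: "v p = ?ap (P p) \<eta>" by (auto simp: mat_range_def)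
        then have "?ap (e q) (v p) = ?ap (e q \<odot> P p) \<eta>" by (simp only: mat_apply_comp)
        then show ?thesis using \<eta> e_P[OF p q] by auto
      qed
      have "?ap (e q) \<xi> = (\<Sum>p | is_proj p. ?ap (e q) (v p))"
        using v by (simp only: mat_apply_sum)
      also have "\<dots> = (\<Sum>p | is_proj p. if p = q then v q else 0)"
        using ev by (intro sum.cong) auto
      also have "\<dots> = v q" using q finite_projs by simp
      finally show ?thesis using q by simp
    next
      case False
      then show ?thesis using PiE_arb[OF conjunct1[OF v], of q] by simp
    qed
  qed
qed

end

section \<open>Subrepresentations\<close>

lemma scaleC_sum_right: "c *\<^sub>C (\<Sum>x\<in>X. f x) = (\<Sum>x\<in>X. c *\<^sub>C f x)" for f :: "'b \<Rightarrow> 'a::cstar_algebra"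
proof -
  interpret additive "\<lambda>x :: 'a. c *\<^sub>C x" by unfold_locales (rule scaleC_add_right)
  show ?thesis by (rule sum)
qed

lemma scaleC_sum_left: "(\<Sum>x\<in>X. f x) *\<^sub>C a = (\<Sum>x\<in>X. f x *\<^sub>C a)" for a :: "'a::cstar_algebra"
proof -
  interpret additive "\<lambda>c. c *\<^sub>C a" by unfold_locales (rule scaleC_add_left)
  show ?thesis by (rule sum)
qed

lemma scaleC_zero_left [simp]: "0 *\<^sub>C a = 0" for a :: "'a::cstar_algebra"
  using scaleC_sum_left[of "\<lambda>_. 0" "{}"] by simp

lemma subspace_mat_range: "tvec.subspace (mat_range N k A)"
proof -
  have "\<exists>\<zeta>\<in>tensor_space N k. mat_apply N k A \<xi> + mat_apply N k A \<eta> = mat_apply N k A \<zeta>"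
    if "\<xi> \<in> tensor_space N k" "\<eta> \<in> tensor_space N k" for \<xi> \<eta>
    using that by (intro bexI[of _ "\<xi> + \<eta>"])
      (auto simp: tensor_space_def mat_apply_def fun_eq_iff distrib_left sum.distrib)
  moreover have "\<exists>\<zeta>\<in>tensor_space N k. tvec_scale c (mat_apply N k A \<xi>) = mat_apply N k A \<zeta>"
    if "\<xi> \<in> tensor_space N k" for c \<xi>
    using that by (intro bexI[of _ "tvec_scale c \<xi>"])
      (auto simp: tensor_space_def tvec_scale_def mat_apply_def fun_eq_iff sum_distrib_left mult_ac)
  moreover have "\<exists>\<zeta>\<in>tensor_space N k. 0 = mat_apply N k A \<zeta>"
    by (intro bexI[of _ 0]) (auto simp: tensor_space_def mat_apply_def fun_eq_iff)
  ultimately show ?thesis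
    unfolding tvec.subspace_def mat_range_def by (fastforce simp: image_iff)
qed

text \<open>A vector in the range is fixed by the idempotent \<open>M\<close>, and intertwining
  moves \<open>M\<close> outside the coaction. What results is a combination of columns of
  \<open>M\<close> with coefficients in the algebra.\<close>

lemma subrepresentation_mat_range:
  fixes G :: "('a::cstar_algebra, 'b::cstar_algebra) quantum_group"
  assumes M: "M \<in> Hom G w w" and idem: "mat_comp N k M M = M"
    and N: "fund_dim G = N" and k: "length w = k"
  shows "subrepresentation N k (tensor_rep G w) (mat_range N k M)
    (\<lambda>i j. \<Sum>m\<in>idx N k. M i m *\<^sub>C tensor_rep G w m j)"
proof -
  let ?U = "tensor_rep G w" and ?I = "idx N k"
  have Mmap: "M \<in> tensor_maps N k k"
    and comm: "\<And>j i. j \<in> ?I \<Longrightarrow> i \<in> ?I \<Longrightarrow>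
        (\<Sum>m\<in>?I. M j m *\<^sub>C ?U m i) = (\<Sum>m\<in>?I. M m i *\<^sub>C ?U j m)"
    using M N k by (auto simp: Hom_def Let_def)
  have sub: "mat_range N k M \<subseteq> tensor_space N k"
    using Mmap by (auto simp: mat_range_def tensor_space_def tensor_maps_def mat_apply_def)
  have unit: "(\<lambda>i. M i m) \<in> mat_range N k M" if m: "m \<in> ?I" for m
  proof -
    have "(\<lambda>i. M i m) = mat_apply N k M (\<lambda>i. of_bool (i = m))"
      using m by (auto simp: mat_apply_def fun_eq_iff of_bool_def if_distrib[of "\<lambda>x. _ * x"] cong: if_cong)
    moreover have "(\<lambda>i. of_bool (i = m)) \<in> tensor_space N k" using m by (auto simp: tensor_space_def)
    ultimately show ?thesis by (auto simp: mat_range_def)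
  qed
  have fixed: "mat_apply N k M \<xi> = \<xi>" if \<xi>: "\<xi> \<in> mat_range N k M" for \<xi>
  proof -
    obtain \<eta> where \<eta>: "\<xi> = mat_apply N k M \<eta>" using \<xi> unfolding mat_range_def by blast
    have "mat_apply N k M (mat_apply N k M \<eta>) j = mat_apply N k (mat_comp N k M M) \<eta> j" for j
    proof -
      have "(\<Sum>m\<in>?I. M j m * (\<Sum>i\<in>?I. M m i * \<eta> i)) = (\<Sum>m\<in>?I. \<Sum>i\<in>?I. M j m * M m i * \<eta> i)"
        by (simp add: sum_distrib_left mult.assoc)
      also have "\<dots> = (\<Sum>i\<in>?I. \<Sum>m\<in>?I. M j m * M m i * \<eta> i)" by (rule sum.swap)
      finally show ?thesis by (simp add: mat_apply_def mat_comp_def sum_distrib_right)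
    qed
    then show ?thesis unfolding \<eta> idem by (intro ext)
  qed
  have act: "coaction N k ?U \<xi> i = (\<Sum>m\<in>?I. M i m *\<^sub>C coaction N k ?U \<xi> m)"
    if \<xi>: "\<xi> \<in> mat_range N k M" and i: "i \<in> ?I" for \<xi> i
  proof -
    have "coaction N k ?U \<xi> i = (\<Sum>j\<in>?I. (\<Sum>m\<in>?I. M j m * \<xi> m) *\<^sub>C ?U i j)"
      using fixed[OF \<xi>] i by (simp add: coaction_def mat_apply_def fun_eq_iff)
    also have "\<dots> = (\<Sum>j\<in>?I. \<Sum>m\<in>?I. \<xi> m *\<^sub>C M j m *\<^sub>C ?U i j)"
      by (simp add: scaleC_sum_left scaleC_scaleC mult.commute)
    also have "\<dots> = (\<Sum>m\<in>?I. \<Sum>j\<in>?I. \<xi> m *\<^sub>C M j m *\<^sub>C ?U i j)" by (rule sum.swap)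
    \<comment> \<open>The intertwining relation moves \<open>M\<close> from the right of
      \<open>?U\<close> to its left.\<close>
    also have "\<dots> = (\<Sum>m\<in>?I. \<Sum>j\<in>?I. \<xi> m *\<^sub>C M i j *\<^sub>C ?U j m)"
      unfolding scaleC_sum_right[symmetric] using comm[OF i] by (intro sum.cong) auto
    also have "\<dots> = (\<Sum>j\<in>?I. \<Sum>m\<in>?I. \<xi> m *\<^sub>C M i j *\<^sub>C ?U j m)" by (rule sum.swap)
    also have "\<dots> = (\<Sum>j\<in>?I. M i j *\<^sub>C coaction N k ?U \<xi> j)"
      by (intro sum.cong) (auto simp: coaction_def scaleC_sum_right scaleC_scaleC mult.commute)
    finally show ?thesis .
  qed
  have out: "coaction N k U \<xi> i = 0" if "i \<notin> ?I" for U :: "index \<Rightarrow> index \<Rightarrow> 'a" and \<xi> i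
    using that by (simp add: coaction_def)
  have span: "coaction N k ?U \<xi> \<in> algebra_span (mat_range N k M)" if \<xi>: "\<xi> \<in> mat_range N k M" for \<xi>
  proof -
    \<comment> \<open>\<open>algebra_span\<close> numbers its summands by naturals, so the
      multi-indices are enumerated.\<close>
    obtain h where h: "bij_betw h {..<card ?I} ?I"
      using ex_bij_betw_nat_finite[OF finite_idx] by (auto simp: atLeast0LessThan)
    have "coaction N k ?U \<xi> i = (\<Sum>r<card ?I. M i (h r) *\<^sub>C coaction N k ?U \<xi> (h r))" for i
    proof (cases "i \<in> ?I")
      case True
      then show ?thesis
        using act[OF \<xi>] sum.reindex_bij_betw[OF h, of "\<lambda>m. M i m *\<^sub>C coaction N k ?U \<xi> m"] by simp
    next
      case False
      then show ?thesis using Mmap out by (simp add: tensor_maps_def)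
    qed
    then have eq: "coaction N k ?U \<xi> = (\<lambda>i. \<Sum>r<card ?I. M i (h r) *\<^sub>C coaction N k ?U \<xi> (h r))"
      by (rule ext)
    have "\<forall>r<card ?I. (\<lambda>i. M i (h r)) \<in> mat_range N k M"
      using unit bij_betwE[OF h] by auto
    then show ?thesis
      unfolding algebra_span_def using eq
      by (intro CollectI exI[of _ "card ?I"] exI[of _ "\<lambda>r i. M i (h r)"]
          exI[of _ "\<lambda>r. coaction N k ?U \<xi> (h r)"] conjI)
  qed
  have "coaction N k (\<lambda>i j. \<Sum>m\<in>?I. M i m *\<^sub>C ?U m j) \<xi> i = coaction N k ?U \<xi> i"
    if \<xi>: "\<xi> \<in> mat_range N k M" for \<xi> i
  proof (cases "i \<in> ?I")
    case True
    then have "coaction N k (\<lambda>i j. \<Sum>m\<in>?I. M i m *\<^sub>C ?U m j) \<xi> i =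
        (\<Sum>j\<in>?I. \<Sum>m\<in>?I. M i m *\<^sub>C \<xi> j *\<^sub>C ?U m j)"
      by (simp add: coaction_def scaleC_sum_right scaleC_scaleC mult.commute)
    also have "\<dots> = (\<Sum>m\<in>?I. \<Sum>j\<in>?I. M i m *\<^sub>C \<xi> j *\<^sub>C ?U m j)" by (rule sum.swap)
    also have "\<dots> = (\<Sum>m\<in>?I. M i m *\<^sub>C coaction N k ?U \<xi> m)"
      by (intro sum.cong) (auto simp: coaction_def scaleC_sum_right)
    finally show ?thesis using act[OF \<xi> True] by simp
  next
    case False
    then show ?thesis using out by simp
  qed
  then show ?thesis
    unfolding subrepresentation_def using sub span subspace_mat_range by blast
qed

lemma T_map_id_part: "N > 0 \<Longrightarrow> T_map N (id_part w) = id_mat N (length w)"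
proof (intro ext)
  fix j i assume "N > 0"
  show "T_map N (id_part w) j i = id_mat N (length w) j i"
  proof (cases "i \<in> idx N (length w) \<and> j \<in> idx N (length w)")
    case True
    then show ?thesis
      using compatible_id_part[of i N w j] \<open>N > 0\<close>
      by (auto simp: T_map_entry non_through_id_part id_mat_def)
  qed (auto simp: T_map_entry id_mat_def)
qed

theorem proposition3p7:
  fixes N :: nat
    and \<C> :: "partition set"
    and G :: "('a::cstar_algebra, 'b::cstar_algebra) quantum_group"
    and w :: "colour list"
  assumes "N \<ge> 4"
    and "category_of_noncrossing_partitions \<C>"
    and "easy_quantum_group N \<C> G"
  shows "is_direct_sum_of_subrepresentations N (length w) (tensor_rep G w)
           (Proj \<C> w) (\<lambda>p. mat_range N (length w) (P_map N \<C> p)) (u_part G \<C>)"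
proof -
  interpret partition_category \<C> N
    using assms by unfold_locales (auto simp: category_of_noncrossing_partitions_def)
  have nc: "noncrossing p" if "p \<in> \<C>" for p
    using assms(2) that by (auto simp: category_of_noncrossing_partitions_def)
  let ?k = "length w"
  interpret M: regular_star_monoid "endos w" vconcat reflect "id_part w"
    by unfold_locales
      (rule finite_endos endos_closed endos_assoc reflect_reflect endos_reflect_vconcat
        endos_id endos_regular; assumption)+
  have proj_iff: "M.is_proj p \<longleftrightarrow> p \<in> Proj \<C> w" for p
    unfolding M.is_proj_def using all_partitions by (auto simp: Proj_def projective_def endos_def)
  interpret R: projective_rep "endos w" vconcat reflect "id_part w" "T_map N" N ?k
  proof unfold_locales
    show "T_map N x \<in> tensor_maps N ?k ?k" if "x \<in> endos w" for x
      using that by (auto simp: endos_def tensor_maps_def T_map_entry)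
    \<comment> \<open>In \<open>vconcat x y\<close> the partition \<open>y\<close> is on top and
      acts first, hence the reversed order of the arguments below.\<close>
    show "\<exists>c>0. mat_comp N ?k (T_map N x) (T_map N y) = tmat_scale (complex_of_real c) (T_map N (vconcat x y))"
      if "x \<in> endos w" "y \<in> endos w" for x y
      using that T_map_comp[of y x N] all_partitions N0 by (auto simp: endos_def)
    show "is_projection N ?k (T_map N p)" if "M.is_proj p" for p
      using that T_map_projection[OF _ N0, of p] by (auto simp: proj_iff Proj_def)
    show "T_map N (id_part w) = id_mat N ?k" by (rule T_map_id_part[OF N0])
    show "c x = 0" if "(\<Sum>x\<in>endos w. tmat_scale (c x) (T_map N x)) = 0" "x \<in> endos w" for c x
      by (rule T_map_independent[OF finite_endos assms(1) _ that]) (auto simp: endos_def all_partitions nc)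
  qed
  have P: "P_map N \<C> p = R.P p" if "p \<in> Proj \<C> w" for p
    using that
    by (simp add: P_map_def R.P_def R.Q_def M.below_def dominated_def proj_iff Proj_def[of \<C> w])
  have I: "Proj \<C> w = {p. M.is_proj p}" by (simp add: proj_iff)
  \<comment> \<open>The span of the abstract representation is the whole endomorphism algebra, so
    membership of \<open>R.P p\<close> in that span makes it an intertwiner.\<close>
  have G: "fund_dim G = N" and Hom: "Hom G w w = tmat.span (T_map N ` endos w)"
    using assms(3) by (auto simp: easy_quantum_group_def endos_def image_def intro!: arg_cong[of _ _ tmat.span])
  have "subrepresentation N ?k (tensor_rep G w) (mat_range N ?k (P_map N \<C> p)) (u_part G \<C> p)"
    if p: "p \<in> Proj \<C> w" for p
  proof -
    have pr: "M.is_proj p" and up: "up p = w" using p proj_iff by (auto simp: Proj_def)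
    show ?thesis
      unfolding u_part_def G up P[OF p]
      using R.P_props(1,3)[OF pr] by (intro subrepresentation_mat_range G) (simp_all add: Hom)
  qed
  moreover have "\<exists>!v. v \<in> (\<Pi>\<^sub>E p\<in>Proj \<C> w. mat_range N ?k (P_map N \<C> p)) \<and> \<xi> = (\<Sum>p\<in>Proj \<C> w. v p)"
    if "\<xi> \<in> tensor_space N ?k" for \<xi>
  proof -
    have "(\<Pi>\<^sub>E p\<in>Proj \<C> w. mat_range N ?k (P_map N \<C> p)) = (\<Pi>\<^sub>E p\<in>Proj \<C> w. mat_range N ?k (R.P p))"
      by (intro PiE_cong) (simp add: P)
    then show ?thesis using R.direct_sum[OF that] unfolding I by simp
  qed
  ultimately show ?thesis
    unfolding is_direct_sum_of_subrepresentations_def using R.finite_projs by (simp add: I)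
qed

end
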